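(* Fix a round $t$ and a one-step admissible upper state $(U_t,Q_t)$, and let $\mathcal J_t^{\mathrm{id}},\mathcal J_t^{\mathrm{ex}}$ be the objectives defined in the context. Let $(w_t^{\mathrm{id}},\theta_t^{\mathrm{id}})$ and $(w_t^{\mathrm{ex}},\theta_t^{\mathrm{ex}})$ be ($\mathcal F_t$-measurable) minimizers of $\mathcal J_t^{\mathrm{id}}$ and $\mathcal J_t^{\mathrm{ex}}$, respectively, over $w\in\Delta_{S_t}$, $\theta\in[\underline\theta,\bar\theta]^{S_t}$. If round $t$ is run with the controls $(w_t^{\mathrm{id}},\theta_t^{\mathrm{id}})$, then $$\mathbb E[F(x_{t+1})-F_\star\mid\mathcal F_t]\le\mathcal J_t^{\mathrm{id}}(w_t^{\mathrm{id}},\theta_t^{\mathrm{id}})\le\mathcal J_t^{\mathrm{ex}}(w_t^{\mathrm{ex}},\theta_t^{\mathrm{ex}}).$$ Moreover, for every predictable feasible benchmark pair $(\bar w_t,\bar\theta_t)$, $$\mathbb E[F(x_{t+1})-F_\star\mid\mathcal F_t]\le\mathcal J_t^{\mathrm{id}}(\bar w_t,\bar\theta_t)-\Gamma_t,\qquad \Gamma_t\ge0,\qquad \Gamma_t=\mathcal J_t^{\mathrm{id}}(\bar w_t,\bar\theta_t)-\mathcal J_t^{\mathrm{id}}(w_t^{\mathrm{id}},\theta_t^{\mathrm{id}}).$$ For fixed amplitudes $\theta$, the weight subproblem $\min_{w\in\Delta_{S_t}}\mathcal J_t^{\mathrm{id}}(w,\theta)$ is a strictly convex quadratic program with the exact KKT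 law $$w_{i,t}^\star=\frac{\bigl(\mu_i(\theta_i;U_t,Q_t)-\lambda_t\bigr)_+}{L\,\kappa_i(\theta_i;U_t,Q_t)},\qquad i\in\mathcal S_t,$$ where $\lambda_t$ is chosen so that the weights sum to one.
   Context: Problem: $F(x)=\frac1n\sum_{i=1}^nF_i(x)$, $F_i(x)=\frac1{m_i}\sum_{j=1}^{m_i}\phi_{ij}(x)$, each $\phi_{ij}:\mathbb R^d\to\mathbb R$ convex and $L$-smooth ($\|\nabla\phi_{ij}(x)-\nabla\phi_{ij}(y)\|\le L\|x-y\|$). There are $x_\star\in\arg\min F$ and $R>0$; $B(x_\star,R)=\{x:\|x-x_\star\|\le R\}$, $F_\star:=F(x_\star)$, $f_t:=F(x_t)-F_\star$, $\bar f:=LR^2/2$. Node $i$ has a local horizon $H_i\in\{1,2,\dots\}$, minibatch size $b_i$, and variance level $v_i^2:=\sup_{x\in B(x_\star,R)}\frac1{m_i}\sum_j\|\nabla\phi_{ij}(x)-\nabla F_i(x)\|^2$. Algorithm (HEW-Local SGD). Local controls $c_{i,0}$ are given and $c_0=\frac1n\sum_ic_{i,0}$. At round $t$, with nonempty active set $\mathcal S_t\subseteq[n]$, weights $w_t\in\Delta_{S_t}:=\{w\in\mathbb R_+^{S_t}:\sum_{i\in\mathcal S_t}w_i=1\}$ and amplitudes $\theta_{i,t}\in[\underline\theta,\bar\theta]$, $0<\underline\theta\le\bar\theta\le1$: each $i\in\mathcal S_t$ sets $\eta_{i,t}=\theta_{i,t}/(LH_i)$, $y_{i,t}^{(0)}=x_t$,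 and for $\ell=0,\dots,H_i-1$ draws a minibatch $\mathcal B_{i,t,\ell}\subseteq[m_i]$ of size $b_i$, computes $g_{i,t,\ell}=\frac1{b_i}\sum_{j\in\mathcal B_{i,t,\ell}}\nabla\phi_{ij}(y_{i,t}^{(\ell)})$ and sets $y_{i,t}^{(\ell+1)}=y_{i,t}^{(\ell)}-\eta_{i,t}(g_{i,t,\ell}-c_{i,t}+c_t)$; then $\Delta_{i,t}=y_{i,t}^{(H_i)}-x_t$ and $c_{i,t+1}=c_{i,t}-c_t+\frac1{H_i\eta_{i,t}}(x_t-y_{i,t}^{(H_i)})$. For $i\notin\mathcal S_t$, $c_{i,t+1}=c_{i,t}$. The server sets $x_{t+1}=x_t+\sum_{i\in\mathcal S_t}w_{i,t}\Delta_{i,t}$ and $c_{t+1}=c_t+\frac1n\sum_{i\in\mathcal S_t}(c_{i,t+1}-c_{i,t})$. Standing assumptions: almost surely $x_t,y_{i,t}^{(\ell)}\in B(x_\star,R)$ for all rounds $t$, active $i$ and $0\le\ell\le H_i$. $\mathcal F_t$ is the sigma-field generated by the initial state and all minibatches drawn strictly before round $t$; "predictable" at round $t$ means $\mathcal F_t$-measurable, and $\mathcal S_t$ and control pairs are predictable. $\mathcal G_{i,t,\ell}$ is generated by $\mathcal F_t$ and all minibatches of node $i$ drawn strictly before local step $\ell$ of round $t$; conditionally on $\mathcal G_{i,t,\ell}$ the minibatches are independent across active nodes and local steps, $\mathbb E[g_{i,t,\ell}\mid\mathcal G_{i,t,\ell}]=\nabla F_i(y_{i,t}^{(\ell)})$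 and $\mathbb E[\|g_{i,t,\ell}-\nabla F_i(y_{i,t}^{(\ell)})\|^2\mid\mathcal G_{i,t,\ell}]\le v_i^2/b_i$. A one-step admissible upper state at round $t$ is an $\mathcal F_t$-measurable pair $(U_t,Q_t)$ with $f_t\le U_t$ and $\max_{1\le i\le n}\|c_{i,t}-\nabla F_i(x_t)\|^2\le Q_t$ almost surely; $U_t^\sharp:=\min\{U_t,\bar f\}$. Objective: with $T_a(u)=\frac u{1+au}$, $A_i(\theta_i)=\frac{\theta_i}{2LR^2}$, $s_i(U_t^\sharp;\theta_i)=U_t^\sharp-T_{A_i(\theta_i)}(U_t^\sharp)$, $$\rho_i(\theta_i;U_t,Q_t)=32e^{2\theta_i}\theta_i^3U_t+\frac{16\theta_i+64e^{2\theta_i}\theta_i^3}{L}Q_t+8e^{2\theta_i}\frac{\theta_i^3v_i^2}{LH_ib_i},$$ $$\kappa_i(\theta_i;U_t,Q_t)=16e^{2\theta_i}\frac{\theta_i^4}{L}U_t+32e^{2\theta_i}\frac{\theta_i^4}{L^2}Q_t+(2\theta_i^2+4e^{2\theta_i}\theta_i^4)\frac{v_i^2}{L^2H_ib_i},$$ $\mu_i(\theta_i;U_t,Q_t)=s_i(U_t^\sharp;\theta_i)-\rho_i(\theta_i;U_t,Q_t)$, put $\mathcal J_t^{\mathrm{id}}(w,\theta)=U_t^\sharp-\sum_{i\in\mathcal S_t}w_i\mu_i(\theta_i;U_t,Q_t)+\frac L2\sum_{i\in\mathcal S_t}w_i^2\kappa_i(\theta_i;U_t,Q_t)$. Given $\mathcal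 F_t$-measurable variance proxies $\widehat v_{i,t}^2\ge v_i^2$, $\mathcal J_t^{\mathrm{ex}}$ is $\mathcal J_t^{\mathrm{id}}$ with every $v_i^2$ in $\rho_i,\kappa_i$ replaced by $\widehat v_{i,t}^2$. $(x)_+=\max\{x,0\}$.
   Formalization: The final claim (strictly convex quadratic program and KKT law for the weights) is stated under the extra condition κ_i(θ_i;U_t,Q_t) > 0 for all i in S_t; if U_t = Q_t = 0 and v_i = 0 then κ_i = 0, and the formula divides by zero. *)

theory Defs
  imports "HOL-Probability.Probability"
begin

definition gradient :: "(real^'d \<Rightarrow> real) \<Rightarrow> real^'d \<Rightarrow> real^'d" where
  "gradient f x = (THE D. GDERIV f x :> D)"

definition L_smooth :: "real \<Rightarrow> (real^'d \<Rightarrow> real) \<Rightarrow> bool" where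
  "L_smooth L f \<longleftrightarrow> (\<forall>x. f differentiable (at x)) \<and>
     (\<forall>x y. norm (gradient f x - gradient f y) \<le> L * norm (x - y))"

(* The library's conditional expectation is real-valued; vectors are treated componentwise. *)
definition vec_cond_exp :: "'a measure \<Rightarrow> 'a measure \<Rightarrow> ('a \<Rightarrow> real^'d) \<Rightarrow> 'a \<Rightarrow> real^'d" where
  "vec_cond_exp M G X \<omega> = (\<chi> k. real_cond_exp M G (\<lambda>\<omega>'. X \<omega>' $ k) \<omega>)"

definition strictly_convex_on :: "'v::real_vector set \<Rightarrow> ('v \<Rightarrow> real) \<Rightarrow> bool" where
  "strictly_convex_on C f \<longleftrightarrow> convex C \<and>
     (\<forall>x\<in>C. \<forall>y\<in>C. \<forall>u. x \<noteq> y \<and> 0 < u \<and> u < 1 \<longrightarrow>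
        f ((1 - u) *\<^sub>R x + u *\<^sub>R y) < (1 - u) * f x + u * f y)"

definition quadratic_function :: "(real^'n \<Rightarrow> real) \<Rightarrow> bool" where
  "quadratic_function f \<longleftrightarrow>
     (\<exists>(A::real^'n^'n) b c. transpose A = A \<and> (\<forall>w. f w = (1/2) * (w \<bullet> (A *v w)) + b \<bullet> w + c))"


(* The nodes are the elements of the finite type 'n, so n = CARD('n).  The samples of node i
   are numbered 1, ..., samples P i. *)
record ('n, 'd) problem =
  phi :: "'n \<Rightarrow> nat \<Rightarrow> real^'d \<Rightarrow> real"
  samples :: "'n \<Rightarrow> nat"
  smooth_const :: real
  x_star :: "real^'d"
  radius :: real
  horizon :: "'n \<Rightarrow> nat"
  batch_size :: "'n \<Rightarrow> nat"
  theta_lo :: real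
  theta_hi :: real

definition local_obj :: "('n::finite, 'd::finite) problem \<Rightarrow> 'n \<Rightarrow> real^'d \<Rightarrow> real" where
  "local_obj P i x = (\<Sum>j=1..samples P i. phi P i j x) / real (samples P i)"

definition global_obj :: "('n::finite, 'd::finite) problem \<Rightarrow> real^'d \<Rightarrow> real" where
  "global_obj P x = (\<Sum>i\<in>UNIV. local_obj P i x) / real CARD('n)"

definition F_star :: "('n::finite, 'd::finite) problem \<Rightarrow> real" where
  "F_star P = global_obj P (x_star P)"

definition f_bar :: "('n::finite, 'd::finite) problem \<Rightarrow> real" where
  "f_bar P = smooth_const P * (radius P)\<^sup>2 / 2"

(* This is the squared level v_i^2. *)
definition variance_level :: "('n::finite, 'd::finite) problem \<Rightarrow> 'n \<Rightarrow> real" where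
  "variance_level P i = (SUP x\<in>cball (x_star P) (radius P).
     (\<Sum>j=1..samples P i. (norm (gradient (phi P i j) x - gradient (local_obj P i) x))\<^sup>2)
       / real (samples P i))"

definition valid_problem :: "('n::finite, 'd::finite) problem \<Rightarrow> bool" where
  "valid_problem P \<longleftrightarrow>
     (\<forall>i. samples P i \<ge> 1) \<and> smooth_const P > 0 \<and>
     (\<forall>i. \<forall>j\<in>{1..samples P i}. convex_on UNIV (phi P i j) \<and> L_smooth (smooth_const P) (phi P i j)) \<and>
     is_arg_min (global_obj P) (\<lambda>x. x \<in> UNIV) (x_star P) \<and> radius P > 0 \<and>
     (\<forall>i. horizon P i \<ge> 1) \<and> (\<forall>i. batch_size P i \<ge> 1) \<and>
     0 < theta_lo P \<and> theta_lo P \<le> theta_hi P \<and> theta_hi P \<le> 1"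


(* Vectors indexed by an active set S are elements of real^'n.  Weights vanish outside S;
   amplitudes are unconstrained outside S, where they are never used. *)
definition coord_space :: "'n set \<Rightarrow> (real^'n) set" where
  "coord_space S = {w. \<forall>i. i \<notin> S \<longrightarrow> w $ i = 0}"

definition weight_simplex :: "'n::finite set \<Rightarrow> (real^'n) set" where
  "weight_simplex S = {w \<in> coord_space S. (\<forall>i\<in>S. 0 \<le> w $ i) \<and> (\<Sum>i\<in>S. w $ i) = 1}"

definition amplitude_box :: "('n::finite, 'd::finite) problem \<Rightarrow> 'n set \<Rightarrow> (real^'n) set" where
  "amplitude_box P S = {\<theta>. \<forall>i\<in>S. \<theta> $ i \<in> {theta_lo P..theta_hi P}}"


(* Random inputs of the algorithm on a sample space 'a: initial state, and for each round t the
   active set, weights and amplitudes.  "batch A i t l" is the minibatch of node i at local step l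
   of round t. *)
record ('a, 'n, 'd) run =
  init_x :: "'a \<Rightarrow> real^'d"
  init_control :: "'n \<Rightarrow> 'a \<Rightarrow> real^'d"
  active :: "nat \<Rightarrow> 'a \<Rightarrow> 'n set"
  weights :: "nat \<Rightarrow> 'a \<Rightarrow> real^'n"
  amplitudes :: "nat \<Rightarrow> 'a \<Rightarrow> real^'n"
  batch :: "'n \<Rightarrow> nat \<Rightarrow> nat \<Rightarrow> 'a \<Rightarrow> nat set"

definition stoch_grad ::
  "('n::finite, 'd::finite) problem \<Rightarrow> 'n \<Rightarrow> nat set \<Rightarrow> real^'d \<Rightarrow> real^'d" where
  "stoch_grad P i B y = (1 / real (batch_size P i)) *\<^sub>R (\<Sum>j\<in>B. gradient (phi P i j) y)"

definition step_size :: "('n::finite, 'd::finite) problem \<Rightarrow> 'n \<Rightarrow> real \<Rightarrow> real" where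
  "step_size P i th = th / (smooth_const P * real (horizon P i))"

(* Local steps of node i from x, with step size eta, minibatches Bs, node control ci and
   server control c. *)
primrec local_steps :: "('n::finite, 'd::finite) problem \<Rightarrow> 'n \<Rightarrow> real \<Rightarrow> (nat \<Rightarrow> nat set) \<Rightarrow>
    real^'d \<Rightarrow> real^'d \<Rightarrow> real^'d \<Rightarrow> nat \<Rightarrow> real^'d" where
  "local_steps P i \<eta> Bs ci c x 0 = x"
| "local_steps P i \<eta> Bs ci c x (Suc l) =
     local_steps P i \<eta> Bs ci c x l
       - \<eta> *\<^sub>R (stoch_grad P i (Bs l) (local_steps P i \<eta> Bs ci c x l) - ci + c)"

(* The state before round t: the iterate x_t, the node controls c_{i,t}, the server control c_t. *)
primrec hew_state :: "('n::finite, 'd::finite) problem \<Rightarrow> ('a, 'n, 'd) run \<Rightarrow> nat \<Rightarrow> 'a \<Rightarrow>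
    (real^'d) \<times> ('n \<Rightarrow> real^'d) \<times> (real^'d)" where
  "hew_state P A 0 \<omega> =
     (init_x A \<omega>, (\<lambda>i. init_control A i \<omega>),
      (1 / real CARD('n)) *\<^sub>R (\<Sum>i\<in>UNIV. init_control A i \<omega>))"
| "hew_state P A (Suc t) \<omega> =
     (case hew_state P A t \<omega> of (x, cs, c) \<Rightarrow>
        let S = active A t \<omega>;
            \<eta> = (\<lambda>i. step_size P i (amplitudes A t \<omega> $ i));
            yH = (\<lambda>i. local_steps P i (\<eta> i) (\<lambda>l. batch A i t l \<omega>) (cs i) c x (horizon P i));
            cs' = (\<lambda>i. if i \<in> S
                        then cs i - c + (1 / (real (horizon P i) * \<eta> i)) *\<^sub>R (x - yH i)
                        else cs i)
        in (x + (\<Sum>i\<in>S. (weights A t \<omega> $ i) *\<^sub>R (yH i - x)), cs',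
            c + (1 / real CARD('n)) *\<^sub>R (\<Sum>i\<in>S. cs' i - cs i)))"

definition iterate :: "('n::finite, 'd::finite) problem \<Rightarrow> ('a, 'n, 'd) run \<Rightarrow> nat \<Rightarrow> 'a \<Rightarrow> real^'d"
  where "iterate P A t \<omega> = fst (hew_state P A t \<omega>)"

definition node_control ::
  "('n::finite, 'd::finite) problem \<Rightarrow> ('a, 'n, 'd) run \<Rightarrow> 'n \<Rightarrow> nat \<Rightarrow> 'a \<Rightarrow> real^'d"
  where "node_control P A i t \<omega> = fst (snd (hew_state P A t \<omega>)) i"

definition server_control ::
  "('n::finite, 'd::finite) problem \<Rightarrow> ('a, 'n, 'd) run \<Rightarrow> nat \<Rightarrow> 'a \<Rightarrow> real^'d"
  where "server_control P A t \<omega> = snd (snd (hew_state P A t \<omega>))"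

definition local_iterate ::
  "('n::finite, 'd::finite) problem \<Rightarrow> ('a, 'n, 'd) run \<Rightarrow> 'n \<Rightarrow> nat \<Rightarrow> nat \<Rightarrow> 'a \<Rightarrow> real^'d" where
  "local_iterate P A i t l \<omega> =
     local_steps P i (step_size P i (amplitudes A t \<omega> $ i)) (\<lambda>k. batch A i t k \<omega>)
       (node_control P A i t \<omega>) (server_control P A t \<omega>) (iterate P A t \<omega>) l"

definition grad_estimate ::
  "('n::finite, 'd::finite) problem \<Rightarrow> ('a, 'n, 'd) run \<Rightarrow> 'n \<Rightarrow> nat \<Rightarrow> nat \<Rightarrow> 'a \<Rightarrow> real^'d" where
  "grad_estimate P A i t l \<omega> = stoch_grad P i (batch A i t l \<omega>) (local_iterate P A i t l \<omega>)"


(* The sigma-field F_t. *)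
definition history ::
  "'a measure \<Rightarrow> ('n::finite, 'd::finite) problem \<Rightarrow> ('a, 'n, 'd) run \<Rightarrow> nat \<Rightarrow> 'a measure" where
  "history M P A t = sigma (space M)
     ({init_x A -` E \<inter> space M | E. E \<in> sets borel} \<union>
      {init_control A i -` E \<inter> space M | i E. E \<in> sets borel} \<union>
      {batch A i r l -` C \<inter> space M | i r l C. r < t \<and> l < horizon P i})"

(* The sigma-field G_{i,t,l}. *)
definition local_history ::
  "'a measure \<Rightarrow> ('n::finite, 'd::finite) problem \<Rightarrow> ('a, 'n, 'd) run \<Rightarrow> 'n \<Rightarrow> nat \<Rightarrow> nat \<Rightarrow> 'a measure"
  where
  "local_history M P A i t l = sigma (space M)
     (sets (history M P A t) \<union> {batch A i t k -` C \<inter> space M | k C. k < l})"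

(* Conditional independence given G of all minibatches of round t, over the (random) active nodes
   and their local steps.  Taking C k l = UNIV for some indices gives the product formula for
   every subfamily. *)
definition batches_cond_indep_at ::
  "'a measure \<Rightarrow> 'a measure \<Rightarrow> ('n::finite, 'd::finite) problem \<Rightarrow> ('a, 'n, 'd) run \<Rightarrow> nat \<Rightarrow>
    ('n \<Rightarrow> nat \<Rightarrow> nat set set) \<Rightarrow> 'a \<Rightarrow> bool" where
  "batches_cond_indep_at M G P A t C \<omega> \<longleftrightarrow>
     real_cond_exp M G (indicator {\<omega>' \<in> space M.
         \<forall>k\<in>active A t \<omega>'. \<forall>l<horizon P k. batch A k t l \<omega>' \<in> C k l}) \<omega>
     = (\<Prod>k\<in>active A t \<omega>. \<Prod>l<horizon P k.
          real_cond_exp M G (indicator {\<omega>' \<in> space M. batch A k t l \<omega>' \<in> C k l}) \<omega>)"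

(* An inactive node draws nothing; this is encoded by an empty minibatch, so that "history"
   is generated by exactly the minibatches that are drawn. *)
definition valid_run ::
  "'a measure \<Rightarrow> ('n::finite, 'd::finite) problem \<Rightarrow> ('a, 'n, 'd) run \<Rightarrow> bool" where
  "valid_run M P A \<longleftrightarrow> prob_space M \<and>
     init_x A \<in> borel_measurable M \<and> (\<forall>i. init_control A i \<in> borel_measurable M) \<and>
     (\<forall>i t l. l < horizon P i \<longrightarrow> batch A i t l \<in> measurable M (count_space UNIV)) \<and>
     (\<forall>t. active A t \<in> measurable (history M P A t) (count_space UNIV)) \<and>
     (\<forall>t. weights A t \<in> borel_measurable (history M P A t)) \<and>
     (\<forall>t. amplitudes A t \<in> borel_measurable (history M P A t)) \<and>
     (\<forall>t. \<forall>\<omega>\<in>space M. active A t \<omega> \<noteq> {} \<and>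
        weights A t \<omega> \<in> weight_simplex (active A t \<omega>) \<and>
        amplitudes A t \<omega> \<in> amplitude_box P (active A t \<omega>)) \<and>
     (\<forall>i t l. \<forall>\<omega>\<in>space M. l < horizon P i \<longrightarrow>
        (if i \<in> active A t \<omega>
         then batch A i t l \<omega> \<subseteq> {1..samples P i} \<and> card (batch A i t l \<omega>) = batch_size P i
         else batch A i t l \<omega> = {})) \<and>
     (AE \<omega> in M. \<forall>t. iterate P A t \<omega> \<in> cball (x_star P) (radius P) \<and>
        (\<forall>i\<in>active A t \<omega>. \<forall>l\<le>horizon P i.
           local_iterate P A i t l \<omega> \<in> cball (x_star P) (radius P))) \<and>
     (\<forall>i t l. l < horizon P i \<longrightarrow>
        (AE \<omega> in M. i \<in> active A t \<omega> \<longrightarrow>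
           vec_cond_exp M (local_history M P A i t l) (grad_estimate P A i t l) \<omega>
             = gradient (local_obj P i) (local_iterate P A i t l \<omega>)) \<and>
        (AE \<omega> in M. i \<in> active A t \<omega> \<longrightarrow>
           real_cond_exp M (local_history M P A i t l)
             (\<lambda>\<omega>'. (norm (grad_estimate P A i t l \<omega>'
                 - gradient (local_obj P i) (local_iterate P A i t l \<omega>')))\<^sup>2) \<omega>
             \<le> variance_level P i / real (batch_size P i)) \<and>
        (\<forall>C. AE \<omega> in M. i \<in> active A t \<omega> \<longrightarrow>
           batches_cond_indep_at M (local_history M P A i t l) P A t C \<omega>))"

definition admissible_upper_state ::
  "'a measure \<Rightarrow> ('n::finite, 'd::finite) problem \<Rightarrow> ('a, 'n, 'd) run \<Rightarrow> nat \<Rightarrow>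
    ('a \<Rightarrow> real) \<Rightarrow> ('a \<Rightarrow> real) \<Rightarrow> bool" where
  "admissible_upper_state M P A t U Q \<longleftrightarrow>
     U \<in> borel_measurable (history M P A t) \<and> Q \<in> borel_measurable (history M P A t) \<and>
     (AE \<omega> in M. global_obj P (iterate P A t \<omega>) - F_star P \<le> U \<omega> \<and>
        (MAX i\<in>UNIV. (norm (node_control P A i t \<omega>
            - gradient (local_obj P i) (iterate P A t \<omega>)))\<^sup>2) \<le> Q \<omega>)"


definition T_map :: "real \<Rightarrow> real \<Rightarrow> real" where
  "T_map a u = u / (1 + a * u)"

definition A_coef :: "('n::finite, 'd::finite) problem \<Rightarrow> real \<Rightarrow> real" where
  "A_coef P th = th / (2 * smooth_const P * (radius P)\<^sup>2)"

definition s_gain :: "('n::finite, 'd::finite) problem \<Rightarrow> real \<Rightarrow> real \<Rightarrow> real" where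
  "s_gain P u th = u - T_map (A_coef P th) u"

definition U_sharp :: "('n::finite, 'd::finite) problem \<Rightarrow> real \<Rightarrow> real" where
  "U_sharp P u = min u (f_bar P)"

(* Below, V i stands for v_i^2 or for its proxy, u and q for the values of U_t and Q_t. *)
definition rho :: "('n::finite, 'd::finite) problem \<Rightarrow> ('n \<Rightarrow> real) \<Rightarrow> real \<Rightarrow> real \<Rightarrow> 'n \<Rightarrow> real \<Rightarrow> real"
  where
  "rho P V u q i th =
     32 * exp (2 * th) * th^3 * u
     + (16 * th + 64 * exp (2 * th) * th^3) / smooth_const P * q
     + 8 * exp (2 * th) * (th^3 * V i / (smooth_const P * real (horizon P i) * real (batch_size P i)))"

definition kappa :: "('n::finite, 'd::finite) problem \<Rightarrow> ('n \<Rightarrow> real) \<Rightarrow> real \<Rightarrow> real \<Rightarrow> 'n \<Rightarrow> real \<Rightarrow> real"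
  where
  "kappa P V u q i th =
     16 * exp (2 * th) * (th^4 / smooth_const P) * u
     + 32 * exp (2 * th) * (th^4 / (smooth_const P)\<^sup>2) * q
     + (2 * th^2 + 4 * exp (2 * th) * th^4)
         * (V i / ((smooth_const P)\<^sup>2 * real (horizon P i) * real (batch_size P i)))"

definition mu :: "('n::finite, 'd::finite) problem \<Rightarrow> ('n \<Rightarrow> real) \<Rightarrow> real \<Rightarrow> real \<Rightarrow> 'n \<Rightarrow> real \<Rightarrow> real"
  where "mu P V u q i th = s_gain P (U_sharp P u) th - rho P V u q i th"

definition objective :: "('n::finite, 'd::finite) problem \<Rightarrow> ('n \<Rightarrow> real) \<Rightarrow> 'n set \<Rightarrow> real \<Rightarrow> real \<Rightarrow>
    (real^'n) \<times> (real^'n) \<Rightarrow> real" where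
  "objective P V S u q z = (case z of (w, \<theta>) \<Rightarrow>
     U_sharp P u - (\<Sum>i\<in>S. w $ i * mu P V u q i (\<theta> $ i))
     + smooth_const P / 2 * (\<Sum>i\<in>S. (w $ i)\<^sup>2 * kappa P V u q i (\<theta> $ i)))"

definition J_id :: "('n::finite, 'd::finite) problem \<Rightarrow> 'n set \<Rightarrow> real \<Rightarrow> real \<Rightarrow>
    (real^'n) \<times> (real^'n) \<Rightarrow> real" where
  "J_id P = objective P (variance_level P)"

definition J_ex :: "('n::finite, 'd::finite) problem \<Rightarrow> ('n \<Rightarrow> real) \<Rightarrow> 'n set \<Rightarrow> real \<Rightarrow> real \<Rightarrow>
    (real^'n) \<times> (real^'n) \<Rightarrow> real" where
  "J_ex P V = objective P V"

definition feasible :: "('n::finite, 'd::finite) problem \<Rightarrow> 'n set \<Rightarrow> (real^'n) \<times> (real^'n) \<Rightarrow> bool" where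
  "feasible P S z \<longleftrightarrow> z \<in> weight_simplex S \<times> amplitude_box P S"

(* A version of E[F(x_{t+1}) - F_star | F_t]. *)
definition next_gap ::
  "'a measure \<Rightarrow> ('n::finite, 'd::finite) problem \<Rightarrow> ('a, 'n, 'd) run \<Rightarrow> nat \<Rightarrow> 'a \<Rightarrow> real" where
  "next_gap M P A t \<omega> =
     real_cond_exp M (history M P A t) (\<lambda>\<omega>'. global_obj P (iterate P A (Suc t) \<omega>') - F_star P) \<omega>"

definition kkt_weights :: "('n::finite, 'd::finite) problem \<Rightarrow> 'n set \<Rightarrow> real \<Rightarrow> real \<Rightarrow> real^'n \<Rightarrow>
    real \<Rightarrow> real^'n" where
  "kkt_weights P S u q \<theta> lam = (\<chi> i. if i \<in> S
     then max (mu P (variance_level P) u q i (\<theta> $ i) - lam) 0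
            / (smooth_const P * kappa P (variance_level P) u q i (\<theta> $ i))
     else 0)"

end

theory Submission
  imports Defs
begin

text \<open>
  The heart of the matter is the one-round inequality: run with any predictable controls
  \<open>(w, \<theta>)\<close>, the conditional expected gap after the round is at most the ideal objective at
  \<open>(w, \<theta>)\<close>. Once this is known (\<open>AE_next_gap_le_objective\<close>), everything said about the controls
  follows from minimality: the ideal minimizer beats each feasible pair, in particular the executable
  minimizer, at which replacing the variances by larger proxies only increases the objective, because
  \<open>\<rho>\<close> and \<open>\<kappa>\<close> are increasing in them (\<open>objective_mono\<close>).

  The minibatches of a round take finitely many values. Hence the conditional expectation given the
  history of a function of the minibatches and of history-measurable data is, almost surely, a finite
  sum weighted with the conditional probabilities of these values
  (\<open>AE_cond_exp_batches\<close>), and the round can be analysed for a fixed outcome as a process on a finite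
  probability space. The hypotheses on the run pass to this space almost surely: given the history, the
  gradient noise of an active node has mean zero, is orthogonal between different local steps and has
  bounded variance (by the tower property through the finer local histories), and the local paths of different active
  nodes are uncorrelated (by conditional independence, taken at the first local step, where the local
  history is the history itself).

  On the finite space, write \<open>z i\<close> for the final local iterate of node \<open>i\<close>. The new iterate is the
  average \<open>\<Sum>i. w i * z i\<close>. Smoothness bounds the mean of \<open>F\<close> at this point by \<open>F\<close> at its mean plus
  \<open>L/2\<close> times its variance; convexity bounds the former by \<open>\<Sum>i. w i * F (mean (z i))\<close>, and since the
  paths are uncorrelated the variance is \<open>\<Sum>i. (w i)\<^sup>2 * Var (z i)\<close>
  (\<open>mean_smooth_convex_average\<close>). For a single node, Minkowski's inequality and a discrete Gronwall
  argument give \<open>\<parallel>y l - x\<parallel> \<le> exp \<theta> * \<theta>/L * (\<parallel>g0\<parallel> + sqrt (v/H))\<close> in \<open>L\<^sup>2\<close>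
  (\<open>rms_displacement_uniform\<close>), where \<open>g0\<close>, the control-corrected local gradient at \<open>x\<close>, differs from
  the global gradient by at most \<open>2 * sqrt Q\<close>. This yields exactly \<open>Var (z i) \<le> \<kappa> i\<close>. Moreover,
  \<open>mean (z i)\<close> is a global gradient step with step size \<open>\<theta>/L\<close> and an error \<open>r\<close>. Such a step changes
  the gap \<open>f\<close> by at most \<open>- \<theta>/(2L) * (\<parallel>gradient\<parallel>\<^sup>2 - \<parallel>r\<parallel>\<^sup>2)\<close>, and \<open>\<parallel>gradient\<parallel> \<ge> f/R\<close> turns the
  first term into the map \<open>T\<close>, while the second one is at most \<open>\<rho> i\<close>.

  The weight subproblem is a separable quadratic program on the simplex. The KKT point is optimal with
  quadratic growth (\<open>qp_growth\<close>), so it is the unique minimizer, and the multiplier exists and is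
  unique because the total weight is continuous, unbounded as the multiplier decreases, and strictly
  decreasing where it is positive.
\<close>

section \<open>Gradients of smooth convex functions\<close>

lemma GDERIV_unique:
  fixes f :: "'v::real_inner \<Rightarrow> real"
  assumes "GDERIV f x :> D" "GDERIV f x :> D'"
  shows "D = D'"
proof -
  have "(\<lambda>h. h \<bullet> D) = (\<lambda>h. h \<bullet> D')"
    using assms unfolding gderiv_def by (rule has_derivative_unique)
  then have "(D - D') \<bullet> D = (D - D') \<bullet> D'" by metis
  then have "(D - D') \<bullet> (D - D') = 0" by (simp add: inner_diff_right)
  then show ?thesis by simp
qed

lemma gradient_eqI: "GDERIV f x :> D \<Longrightarrow> gradient f x = D"
  unfolding gradient_def by (blast intro: GDERIV_unique)

lemma GDERIV_gradient:
  fixes f :: "real^'d \<Rightarrow> real"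
  assumes "f differentiable (at x)"
  shows "GDERIV f x :> gradient f x"
proof -
  obtain f' where f': "(f has_derivative f') (at x)"
    using assms unfolding differentiable_def by blast
  interpret f': linear f' using f' by (rule has_derivative_linear)
  have "f' h = h \<bullet> (\<Sum>b\<in>Basis. f' b *\<^sub>R b)" for h
  proof -
    have "f' h = f' (\<Sum>b\<in>Basis. (h \<bullet> b) *\<^sub>R b)" by (simp add: euclidean_representation)
    also have "\<dots> = (\<Sum>b\<in>Basis. (h \<bullet> b) * f' b)" by (simp add: f'.sum f'.scaleR)
    finally show ?thesis by (simp add: inner_sum_right mult.commute)
  qed
  then have "GDERIV f x :> (\<Sum>b\<in>Basis. f' b *\<^sub>R b)"
    using f' unfolding gderiv_def by (metis (no_types, lifting) ext)
  then show ?thesis using gradient_eqI by metis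
qed

lemma L_smooth_GDERIV: "L_smooth L f \<Longrightarrow> GDERIV f x :> gradient f x"
  unfolding L_smooth_def by (blast intro: GDERIV_gradient)

lemma L_smooth_lipschitz: "L_smooth L f \<Longrightarrow> norm (gradient f x - gradient f y) \<le> L * norm (x - y)"
  unfolding L_smooth_def by blast

lemma L_smooth_continuous_on_gradient:
  assumes "L_smooth L f" "0 \<le> L"
  shows "continuous_on A (gradient f)"
proof -
  have "L-lipschitz_on A (gradient f)"
    using assms by (intro lipschitz_onI) (auto simp: dist_norm L_smooth_lipschitz)
  then show ?thesis by (rule lipschitz_on_continuous_on)
qed

lemma L_smooth_gradient_measurable:
  assumes "L_smooth L f" "0 \<le> L"
  shows "gradient f \<in> borel_measurable borel"
  using L_smooth_continuous_on_gradient[OF assms] by (rule borel_measurable_continuous_onI)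

lemma L_smooth_continuous_on:
  assumes "L_smooth L f"
  shows "continuous_on A f"
  using assms unfolding L_smooth_def
  by (meson differentiable_at_withinI differentiable_imp_continuous_on differentiable_on_def)

lemma GDERIV_average:
  assumes "\<And>i. i \<in> I \<Longrightarrow> GDERIV (f i) x :> D i"
  shows "GDERIV (\<lambda>x. (\<Sum>i\<in>I. f i x) / c) x :> (1 / c) *\<^sub>R (\<Sum>i\<in>I. D i)"
proof -
  have "((\<lambda>x. (\<Sum>i\<in>I. f i x) * (1 / c)) has_derivative (\<lambda>h. (\<Sum>i\<in>I. h \<bullet> D i) * (1 / c))) (at x)"
    using assms unfolding gderiv_def
    by (intro has_derivative_mult_left has_derivative_sum) auto
  then show ?thesis
    unfolding gderiv_def by (simp add: inner_sum_right)
qed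

lemma gradient_average:
  assumes "\<And>i. i \<in> I \<Longrightarrow> L_smooth L (f i)"
  shows "gradient (\<lambda>x. (\<Sum>i\<in>I. f i x) / c) x = (1 / c) *\<^sub>R (\<Sum>i\<in>I. gradient (f i) x)"
  by (intro gradient_eqI GDERIV_average) (use assms in \<open>auto intro: L_smooth_GDERIV\<close>)

lemma L_smooth_average:
  fixes f :: "'i \<Rightarrow> real^'d \<Rightarrow> real"
  assumes smooth: "\<And>i. i \<in> I \<Longrightarrow> L_smooth L (f i)" and I: "finite I" "I \<noteq> {}"
  shows "L_smooth L (\<lambda>x. (\<Sum>i\<in>I. f i x) / real (card I))"
  unfolding L_smooth_def
proof (intro conjI allI)
  let ?c = "real (card I)"
  have c: "?c > 0" using I by (simp add: card_gt_0_iff)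
  show "(\<lambda>x. (\<Sum>i\<in>I. f i x) / ?c) differentiable (at x)" for x
    using GDERIV_average[where D = "\<lambda>i. gradient (f i) x", OF L_smooth_GDERIV[OF smooth]]
    unfolding gderiv_def differentiable_def by blast
  fix x y
  have "norm ((\<Sum>i\<in>I. gradient (f i) x) - (\<Sum>i\<in>I. gradient (f i) y))
      \<le> (\<Sum>i\<in>I. norm (gradient (f i) x - gradient (f i) y))"
    unfolding sum_subtractf[symmetric] by (rule norm_sum)
  also have "\<dots> \<le> (\<Sum>i\<in>I. L * norm (x - y))"
    by (intro sum_mono L_smooth_lipschitz smooth)
  finally have "norm ((\<Sum>i\<in>I. gradient (f i) x) - (\<Sum>i\<in>I. gradient (f i) y)) \<le> ?c * (L * norm (x - y))"
    by simp
  moreover have "norm ((1 / ?c) *\<^sub>R (a::real^'d) - (1 / ?c) *\<^sub>R b) = norm (a - b) / ?c" for a b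
    using c by (simp flip: scaleR_right_diff_distrib)
  ultimately show "norm (gradient (\<lambda>x. (\<Sum>i\<in>I. f i x) / ?c) x - gradient (\<lambda>x. (\<Sum>i\<in>I. f i x) / ?c) y)
      \<le> L * norm (x - y)"
    using c by (simp add: gradient_average[OF smooth] pos_divide_le_eq mult.commute)
qed

lemma convex_on_average:
  assumes "\<And>i. i \<in> I \<Longrightarrow> convex_on C (f i)" "finite I" "convex C"
  shows "convex_on C (\<lambda>x. (\<Sum>i\<in>I. f i x) / real (card I))"
proof -
  have "convex_on C (\<lambda>x. \<Sum>i\<in>I. f i x)"
    using assms(2,1)
    by (induction I rule: finite_induct) (auto intro: convex_on_add simp: convex_on_const assms(3))
  then show ?thesis
    by (auto intro!: convex_on_cmul[where c = "1 / real (card I)", simplified])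
qed

lemma DERIV_along_segment:
  fixes f :: "real^'d \<Rightarrow> real"
  assumes "L_smooth L f"
  shows "((\<lambda>s. f (x + s *\<^sub>R h)) has_real_derivative gradient f (x + s *\<^sub>R h) \<bullet> h) (at s within A)"
proof -
  have "(f has_derivative (\<lambda>k. k \<bullet> gradient f (x + s *\<^sub>R h))) (at (x + s *\<^sub>R h))"
    using L_smooth_GDERIV[OF assms] unfolding gderiv_def .
  then have "((\<lambda>s. f (x + s *\<^sub>R h)) has_derivative (\<lambda>r. (r *\<^sub>R h) \<bullet> gradient f (x + s *\<^sub>R h))) (at s within A)"
    by (intro has_derivative_compose[where f = "\<lambda>s. x + s *\<^sub>R h" and g = f])
       (auto intro!: derivative_eq_intros)
  then show ?thesis
    unfolding has_field_derivative_def
    by (rule has_derivative_eq_rhs) (auto simp: fun_eq_iff inner_commute)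
qed

lemma smooth_descent:
  assumes "L_smooth L f"
  shows "f y \<le> f x + gradient f x \<bullet> (y - x) + L / 2 * (norm (y - x))\<^sup>2"
proof -
  define h where "h = y - x"
  define \<psi> where "\<psi> s = f (x + s *\<^sub>R h) - s * (gradient f x \<bullet> h) - L / 2 * (norm h)\<^sup>2 * s\<^sup>2" for s
  have deriv: "(\<psi> has_real_derivative
      gradient f (x + s *\<^sub>R h) \<bullet> h - gradient f x \<bullet> h - L * (norm h)\<^sup>2 * s) (at s)" for s
    unfolding \<psi>_def
    by (auto intro!: derivative_eq_intros DERIV_along_segment[OF assms] simp: power2_eq_square)
  have "\<psi> 1 \<le> \<psi> 0"
  proof (rule DERIV_nonpos_imp_nonincreasing[of 0 1 \<psi>, OF zero_le_one])
    fix s :: real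
    assume s: "0 \<le> s" "s \<le> 1"
    have "gradient f (x + s *\<^sub>R h) \<bullet> h - gradient f x \<bullet> h
        \<le> norm (gradient f (x + s *\<^sub>R h) - gradient f x) * norm h"
      by (simp add: norm_cauchy_schwarz flip: inner_diff_left)
    also have "\<dots> \<le> L * norm ((x + s *\<^sub>R h) - x) * norm h"
      by (intro mult_right_mono L_smooth_lipschitz[OF assms]) auto
    also have "\<dots> = L * (norm h)\<^sup>2 * s" using s by (simp add: power2_eq_square)
    finally show "\<exists>D. (\<psi> has_real_derivative D) (at s) \<and> D \<le> 0"
      using deriv by (intro exI[of _ "gradient f (x + s *\<^sub>R h) \<bullet> h - gradient f x \<bullet> h - L * (norm h)\<^sup>2 * s"]) auto
  qed
  then show ?thesis by (simp add: \<psi>_def h_def)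
qed

lemma convex_gradient_lower_bound:
  assumes "L_smooth L f" "convex_on UNIV f"
  shows "f x + gradient f x \<bullet> (y - x) \<le> f y"
proof -
  define \<psi> where "\<psi> s = f (x + s *\<^sub>R (y - x))" for s
  have "convex_on UNIV \<psi>"
  proof (rule convex_onI)
    fix t a b :: real
    assume t: "0 < t" "t < 1"
    have "x + ((1 - t) *\<^sub>R a + t *\<^sub>R b) *\<^sub>R (y - x)
        = (1 - t) *\<^sub>R (x + a *\<^sub>R (y - x)) + t *\<^sub>R (x + b *\<^sub>R (y - x))"
      by (simp add: algebra_simps)
    then show "\<psi> ((1 - t) *\<^sub>R a + t *\<^sub>R b) \<le> (1 - t) * \<psi> a + t * \<psi> b"
      unfolding \<psi>_def using convex_onD[OF assms(2), of t] t by simp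
  qed simp
  moreover have "(\<psi> has_real_derivative gradient f x \<bullet> (y - x)) (at 0 within UNIV)"
    using DERIV_along_segment[OF assms(1), of x "y - x" 0 UNIV] by (simp add: \<psi>_def[abs_def])
  ultimately have "\<psi> 1 - \<psi> 0 \<ge> (gradient f x \<bullet> (y - x)) * (1 - 0)"
    by (intro convex_on_imp_above_tangent[of UNIV]) auto
  then show ?thesis by (simp add: \<psi>_def)
qed

text \<open>The value at the minimizer \<open>z\<close> is compared with the value after a gradient step of size \<open>1/L\<close>.\<close>

lemma gradient_norm_le_gap:
  assumes "L_smooth L f" "L > 0" "\<And>y. f z \<le> f y"
  shows "(norm (gradient f x))\<^sup>2 \<le> 2 * L * (f x - f z)"
proof -
  have "f z \<le> f (x - (1 / L) *\<^sub>R gradient f x)" by (rule assms(3))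
  also have "\<dots> \<le> f x - (norm (gradient f x))\<^sup>2 / (2 * L)"
    using smooth_descent[OF assms(1), of "x - (1 / L) *\<^sub>R gradient f x" x] \<open>L > 0\<close>
    by (simp add: power2_norm_eq_inner[symmetric] power_mult_distrib field_simps power2_eq_square)
  finally show ?thesis using \<open>L > 0\<close> by (simp add: field_simps)
qed

section \<open>Means over a finite distribution\<close>

lemma sq_norm_add_le:
  fixes a b :: "'v::real_inner"
  shows "(norm (a + b))\<^sup>2 \<le> 2 * (norm a)\<^sup>2 + 2 * (norm b)\<^sup>2"
  using inner_ge_zero[of "a - b"]
  by (simp add: power2_norm_eq_inner inner_add_left inner_add_right inner_diff_left
      inner_diff_right inner_commute)

text \<open>A probability distribution on a finite set, given by its point masses.\<close>

locale finite_distribution =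
  fixes \<Omega> :: "'b set" and p :: "'b \<Rightarrow> real"
  assumes finite_\<Omega>: "finite \<Omega>"
    and p_nonneg: "\<And>b. b \<in> \<Omega> \<Longrightarrow> 0 \<le> p b"
    and p_sum: "(\<Sum>b\<in>\<Omega>. p b) = 1"
begin

definition mean :: "('b \<Rightarrow> 'v::real_vector) \<Rightarrow> 'v" where
  "mean f = (\<Sum>b\<in>\<Omega>. p b *\<^sub>R f b)"

text \<open>The root mean square, that is, the \<open>L\<^sup>2\<close> norm of a random vector.\<close>

definition rms :: "('b \<Rightarrow> 'v::real_inner) \<Rightarrow> real" where
  "rms f = sqrt (mean (\<lambda>b. (norm (f b))\<^sup>2))"

lemma mean_cong: "(\<And>b. b \<in> \<Omega> \<Longrightarrow> f b = g b) \<Longrightarrow> mean f = mean g"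
  unfolding mean_def by (auto intro: sum.cong)

lemma mean_const [simp]: "mean (\<lambda>_. c) = c"
  unfolding mean_def by (simp add: p_sum flip: scaleR_left.sum)

lemma mean_add: "mean (\<lambda>b. f b + g b) = mean f + mean g"
  unfolding mean_def by (simp add: scaleR_add_right sum.distrib)

lemma mean_diff: "mean (\<lambda>b. f b - g b) = mean f - mean g"
  unfolding mean_def by (simp add: scaleR_diff_right sum_subtractf)

lemma mean_scaleR: "mean (\<lambda>b. c *\<^sub>R f b) = c *\<^sub>R mean f"
  unfolding mean_def by (simp add: scaleR_sum_right mult.commute)

lemma mean_cmult: "mean (\<lambda>b. c * f b) = c * (mean f :: real)"
  using mean_scaleR[of c f] by simp

lemma mean_sum: "mean (\<lambda>b. \<Sum>i\<in>I. f i b) = (\<Sum>i\<in>I. mean (f i))"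
  unfolding mean_def by (simp add: scaleR_sum_right) (rule sum.swap)

lemma mean_inner_left: "mean (\<lambda>b. f b \<bullet> c) = mean f \<bullet> c"
  unfolding mean_def by (simp add: inner_sum_left)

lemma mean_inner_right: "mean (\<lambda>b. c \<bullet> f b) = c \<bullet> mean f"
  unfolding mean_def by (simp add: inner_sum_right)

lemma mean_mono: "(\<And>b. b \<in> \<Omega> \<Longrightarrow> f b \<le> g b) \<Longrightarrow> mean f \<le> (mean g :: real)"
  unfolding mean_def by (auto intro!: sum_mono mult_left_mono p_nonneg)

lemma mean_nonneg: "(\<And>b. b \<in> \<Omega> \<Longrightarrow> 0 \<le> f b) \<Longrightarrow> 0 \<le> (mean f :: real)"
  unfolding mean_def by (auto intro!: sum_nonneg mult_nonneg_nonneg p_nonneg)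

lemma mean_norm_square_centered:
  fixes f :: "'b \<Rightarrow> 'v::real_inner"
  shows "mean (\<lambda>b. (norm (f b - mean f))\<^sup>2) = mean (\<lambda>b. (norm (f b))\<^sup>2) - (norm (mean f))\<^sup>2"
proof -
  have "(norm (f b - mean f))\<^sup>2 = ((norm (f b))\<^sup>2 - 2 * (f b \<bullet> mean f)) + (norm (mean f))\<^sup>2" for b
    by (simp add: power2_norm_eq_inner inner_diff_left inner_diff_right inner_commute)
  then show ?thesis
    by (simp add: mean_add mean_diff mean_cmult mean_inner_left power2_norm_eq_inner)
qed

lemma norm_mean_square_le:
  fixes f :: "'b \<Rightarrow> 'v::real_inner"
  shows "(norm (mean f))\<^sup>2 \<le> mean (\<lambda>b. (norm (f b))\<^sup>2)"
  using mean_norm_square_centered[of f] mean_nonneg[of "\<lambda>b. (norm (f b - mean f))\<^sup>2"] by simp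

lemma mean_norm_square_centered_le:
  fixes f :: "'b \<Rightarrow> 'v::real_inner"
  shows "mean (\<lambda>b. (norm (f b - mean f))\<^sup>2) \<le> mean (\<lambda>b. (norm (f b))\<^sup>2)"
  by (simp add: mean_norm_square_centered)

lemma rms_nonneg: "0 \<le> rms f"
  unfolding rms_def by (simp add: mean_nonneg)

lemma rms_square: "(rms f)\<^sup>2 = mean (\<lambda>b. (norm (f b))\<^sup>2)"
  unfolding rms_def by (simp add: mean_nonneg)

lemma rms_eq_L2_set: "rms f = L2_set (\<lambda>b. sqrt (p b) * norm (f b)) \<Omega>"
  unfolding rms_def L2_set_def mean_def
  by (auto intro!: sum.cong arg_cong[where f = sqrt] simp: power_mult_distrib p_nonneg)

lemma rms_const [simp]: "rms (\<lambda>_. c) = norm c"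
  unfolding rms_def by simp

lemma rms_add_le: "rms (\<lambda>b. f b + g b) \<le> rms f + rms g"
proof -
  have "rms (\<lambda>b. f b + g b) \<le> L2_set (\<lambda>b. sqrt (p b) * norm (f b) + sqrt (p b) * norm (g b)) \<Omega>"
    unfolding rms_eq_L2_set
    by (rule L2_set_mono)
       (auto simp: p_nonneg norm_triangle_ineq simp flip: distrib_left intro!: mult_left_mono)
  also have "\<dots> \<le> rms f + rms g"
    unfolding rms_eq_L2_set by (rule L2_set_triangle_ineq)
  finally show ?thesis .
qed

lemma rms_mono:
  assumes "\<And>b. b \<in> \<Omega> \<Longrightarrow> norm (f b) \<le> norm (g b)"
  shows "rms f \<le> rms g"
  unfolding rms_def using assms by (intro real_sqrt_le_mono mean_mono power_mono) auto

lemma rms_scaleR: "rms (\<lambda>b. c *\<^sub>R f b) = \<bar>c\<bar> * rms f"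
  unfolding rms_def by (simp add: power_mult_distrib mean_cmult real_sqrt_mult)

lemma rms_sum_le: "rms (\<lambda>b. \<Sum>i\<in>I. f i b) \<le> (\<Sum>i\<in>I. rms (f i))"
proof (induction I rule: infinite_finite_induct)
  case (insert i I)
  then show ?case using rms_add_le[of "f i" "\<lambda>b. \<Sum>i\<in>I. f i b"] by simp
qed auto

text \<open>Independent random variables have uncorrelated images.\<close>

lemma mean_inner_indep:
  fixes f :: "'x \<Rightarrow> 'v::real_inner" and g :: "'y \<Rightarrow> 'v"
  assumes indep: "\<And>u v. u \<in> X ` \<Omega> \<Longrightarrow> v \<in> Y ` \<Omega> \<Longrightarrow>
    (\<Sum>b | b \<in> \<Omega> \<and> X b = u \<and> Y b = v. p b)
      = (\<Sum>b | b \<in> \<Omega> \<and> X b = u. p b) * (\<Sum>b | b \<in> \<Omega> \<and> Y b = v. p b)"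
  shows "mean (\<lambda>b. f (X b) \<bullet> g (Y b)) = mean (\<lambda>b. f (X b)) \<bullet> mean (\<lambda>b. g (Y b))"
proof -
  have X: "mean (\<lambda>b. f (X b)) = (\<Sum>u\<in>X ` \<Omega>. (\<Sum>b | b \<in> \<Omega> \<and> X b = u. p b) *\<^sub>R f u)"
    unfolding mean_def sum.image_gen[OF finite_\<Omega>, of _ X] scaleR_left.sum
    by (auto intro!: sum.cong)
  have Y: "mean (\<lambda>b. g (Y b)) = (\<Sum>v\<in>Y ` \<Omega>. (\<Sum>b | b \<in> \<Omega> \<and> Y b = v. p b) *\<^sub>R g v)"
    unfolding mean_def sum.image_gen[OF finite_\<Omega>, of _ Y] scaleR_left.sum
    by (auto intro!: sum.cong)
  have "mean (\<lambda>b. f (X b) \<bullet> g (Y b))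
      = (\<Sum>u\<in>X ` \<Omega>. \<Sum>b | b \<in> \<Omega> \<and> X b = u. p b * (f u \<bullet> g (Y b)))"
    unfolding mean_def sum.image_gen[OF finite_\<Omega>, of _ X] by (auto intro!: sum.cong)
  also have "\<dots> = (\<Sum>u\<in>X ` \<Omega>. \<Sum>v\<in>Y ` \<Omega>. \<Sum>b | b \<in> \<Omega> \<and> X b = u \<and> Y b = v. p b * (f u \<bullet> g v))"
  proof (rule sum.cong)
    fix u
    have "(\<Sum>b | b \<in> \<Omega> \<and> X b = u. p b * (f u \<bullet> g (Y b)))
        = (\<Sum>v\<in>Y ` \<Omega>. \<Sum>b | b \<in> {b \<in> \<Omega>. X b = u} \<and> Y b = v. p b * (f u \<bullet> g (Y b)))"
      by (rule sum.group[symmetric]) (auto simp: finite_\<Omega>)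
    also have "\<dots> = (\<Sum>v\<in>Y ` \<Omega>. \<Sum>b | b \<in> \<Omega> \<and> X b = u \<and> Y b = v. p b * (f u \<bullet> g v))"
      by (intro sum.cong) auto
    finally show "(\<Sum>b | b \<in> \<Omega> \<and> X b = u. p b * (f u \<bullet> g (Y b)))
        = (\<Sum>v\<in>Y ` \<Omega>. \<Sum>b | b \<in> \<Omega> \<and> X b = u \<and> Y b = v. p b * (f u \<bullet> g v))" .
  qed simp
  also have "\<dots> = (\<Sum>u\<in>X ` \<Omega>. \<Sum>v\<in>Y ` \<Omega>.
      (\<Sum>b | b \<in> \<Omega> \<and> X b = u. p b) * (\<Sum>b | b \<in> \<Omega> \<and> Y b = v. p b) * (f u \<bullet> g v))"
    by (intro sum.cong) (auto simp: indep simp flip: sum_distrib_right)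
  also have "\<dots> = mean (\<lambda>b. f (X b)) \<bullet> mean (\<lambda>b. g (Y b))"
    unfolding X Y inner_sum_left unfolding inner_sum_right inner_scaleR_left inner_scaleR_right
    by (intro sum.cong refl) (simp only: mult_ac)
  finally show ?thesis .
qed

text \<open>Averaging uncorrelated points: convexity handles the mean displacement, smoothness the
  fluctuation, and only the fluctuation is charged with the squared weights.\<close>

lemma mean_smooth_convex_average:
  fixes F :: "real^'d \<Rightarrow> real"
  assumes smooth: "L_smooth L F" and "0 \<le> L" and convex: "convex_on UNIV F"
    and S: "finite S" and w: "\<And>i. i \<in> S \<Longrightarrow> 0 \<le> w i" "(\<Sum>i\<in>S. w i) = 1"
    and uncorr: "\<And>i k. i \<in> S \<Longrightarrow> k \<in> S \<Longrightarrow> i \<noteq> k \<Longrightarrow> mean (\<lambda>b. z i b \<bullet> z k b) = mean (z i) \<bullet> mean (z k)"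
  shows "mean (\<lambda>b. F (\<Sum>i\<in>S. w i *\<^sub>R z i b))
    \<le> (\<Sum>i\<in>S. w i * F (mean (z i)))
      + L / 2 * (\<Sum>i\<in>S. (w i)\<^sup>2 * mean (\<lambda>b. (norm (z i b - mean (z i)))\<^sup>2))"
proof -
  define Z where "Z b = (\<Sum>i\<in>S. w i *\<^sub>R z i b)" for b
  define \<xi> where "\<xi> i b = z i b - mean (z i)" for i b
  have mean_Z: "mean Z = (\<Sum>i\<in>S. w i *\<^sub>R mean (z i))"
    unfolding Z_def by (simp add: mean_sum mean_scaleR)
  have Z_centered: "Z b - mean Z = (\<Sum>i\<in>S. w i *\<^sub>R \<xi> i b)" for b
    unfolding mean_Z by (simp add: Z_def \<xi>_def scaleR_diff_right sum_subtractf)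
  have cross: "mean (\<lambda>b. \<xi> i b \<bullet> \<xi> k b) = (if i = k then mean (\<lambda>b. (norm (\<xi> i b))\<^sup>2) else 0)"
    if "i \<in> S" "k \<in> S" for i k
    using uncorr[OF that]
    by (simp add: \<xi>_def power2_norm_eq_inner inner_diff_left inner_diff_right mean_diff
        mean_inner_left mean_inner_right)
  have "mean (\<lambda>b. (norm (Z b - mean Z))\<^sup>2)
      = mean (\<lambda>b. \<Sum>i\<in>S. \<Sum>k\<in>S. (w i * w k) * (\<xi> i b \<bullet> \<xi> k b))"
    unfolding Z_centered power2_norm_eq_inner inner_sum_left inner_sum_right
    by (simp add: inner_sum_left inner_sum_right mult.assoc mult.left_commute inner_commute)
  also have "\<dots> = (\<Sum>i\<in>S. \<Sum>k\<in>S. (w i * w k) * mean (\<lambda>b. \<xi> i b \<bullet> \<xi> k b))"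
    by (simp add: mean_sum mean_cmult)
  also have "\<dots> = (\<Sum>i\<in>S. \<Sum>k\<in>S. if i = k then (w i)\<^sup>2 * mean (\<lambda>b. (norm (\<xi> i b))\<^sup>2) else 0)"
    by (intro sum.cong) (auto simp: cross power2_eq_square)
  also have "\<dots> = (\<Sum>i\<in>S. (w i)\<^sup>2 * mean (\<lambda>b. (norm (\<xi> i b))\<^sup>2))"
    by (simp add: S)
  finally have var: "mean (\<lambda>b. (norm (Z b - mean Z))\<^sup>2)
      = (\<Sum>i\<in>S. (w i)\<^sup>2 * mean (\<lambda>b. (norm (\<xi> i b))\<^sup>2))" .
  have "mean (\<lambda>b. F (Z b))
      \<le> mean (\<lambda>b. F (mean Z) + gradient F (mean Z) \<bullet> (Z b - mean Z) + L / 2 * (norm (Z b - mean Z))\<^sup>2)"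
    by (intro mean_mono smooth_descent[OF smooth])
  also have "\<dots> = F (mean Z) + L / 2 * mean (\<lambda>b. (norm (Z b - mean Z))\<^sup>2)"
    by (simp only: mean_add mean_const mean_cmult mean_inner_right mean_diff) simp
  also have "F (mean Z) \<le> (\<Sum>i\<in>S. w i * F (mean (z i)))"
    unfolding mean_Z using w S by (intro convex_on_sum[OF _ _ convex]) auto
  finally show ?thesis unfolding var unfolding Z_def \<xi>_def by simp
qed

end

section \<open>Local steps with unbiased gradients\<close>

text \<open>The local path of one node over a finite distribution of its minibatch sequences.  \<open>G\<close> is
  the gradient of the node objective, \<open>c\<close> the difference of server and node control, \<open>\<zeta>\<close> the
  gradient noise, and \<open>v\<close> bounds the noise variance.\<close>

locale local_path = finite_distribution \<Omega> p for \<Omega> :: "'b set" and p +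
  fixes G :: "'v::real_inner \<Rightarrow> 'v" and L \<theta> v :: real and H :: nat and x c :: 'v
    and y \<zeta> :: "nat \<Rightarrow> 'b \<Rightarrow> 'v"
  assumes L_pos: "L > 0" and theta_pos: "\<theta> > 0" and H_pos: "H \<ge> 1"
    and lipschitz: "\<And>a b. norm (G a - G b) \<le> L * norm (a - b)"
    and y_0: "\<And>b. b \<in> \<Omega> \<Longrightarrow> y 0 b = x"
    and y_Suc: "\<And>b l. b \<in> \<Omega> \<Longrightarrow> l < H \<Longrightarrow>
      y (Suc l) b = y l b - (\<theta> / (L * real H)) *\<^sub>R (G (y l b) + \<zeta> l b + c)"
    and noise_mean: "\<And>l. l < H \<Longrightarrow> mean (\<zeta> l) = 0"
    and noise_orthogonal: "\<And>k l. k < l \<Longrightarrow> l < H \<Longrightarrow> mean (\<lambda>b. \<zeta> k b \<bullet> \<zeta> l b) = 0"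
    and noise_variance: "\<And>l. l < H \<Longrightarrow> mean (\<lambda>b. (norm (\<zeta> l b))\<^sup>2) \<le> v"
begin

text \<open>The step size, the mean direction of the steps as long as the iterate stays close to \<open>x\<close>, and the
  noise accumulated before step \<open>l\<close>.\<close>

definition \<eta> :: real where "\<eta> = \<theta> / (L * real H)"
definition g0 :: 'v where "g0 = G x + c"
definition noise_sum :: "nat \<Rightarrow> 'b \<Rightarrow> 'v" where "noise_sum l b = (\<Sum>k<l. \<zeta> k b)"

text \<open>The averaged deviation of the local gradients from the gradient at the starting point.\<close>

definition drift :: "'b \<Rightarrow> 'v" where "drift b = (1 / real H) *\<^sub>R (\<Sum>l<H. G (y l b) - G x)"

text \<open>The bound on the second moment of the drift that follows from the displacement bound.\<close>

definition drift_bound :: real where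
  "drift_bound = 2 * exp (2 * \<theta>) * \<theta>\<^sup>2 * ((norm g0)\<^sup>2 + v / real H)"

lemma v_nonneg: "v \<ge> 0"
  using noise_variance[of 0] mean_nonneg[of "\<lambda>b. (norm (\<zeta> 0 b))\<^sup>2"] H_pos by simp

lemma eta_pos: "\<eta> > 0"
  unfolding \<eta>_def using L_pos theta_pos H_pos by simp

lemma path_displacement:
  assumes "b \<in> \<Omega>" "l \<le> H"
  shows "y l b - x = (\<Sum>k<l. - \<eta> *\<^sub>R (G (y k b) - G x)) + ((- \<eta> * real l) *\<^sub>R g0 + - \<eta> *\<^sub>R noise_sum l b)"
  using assms(2)
proof (induction l)
  case 0
  then show ?case using assms(1) by (simp add: y_0 noise_sum_def)
next
  case (Suc l)
  have step: "y (Suc l) b = y l b - \<eta> *\<^sub>R (G (y l b) + \<zeta> l b + c)"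
    using y_Suc[OF assms(1), of l] Suc.prems by (simp add: \<eta>_def)
  have "y (Suc l) b - x = (y l b - x) - \<eta> *\<^sub>R ((G (y l b) - G x) + g0 + \<zeta> l b)"
    unfolding step g0_def by (simp add: algebra_simps)
  then show ?case using Suc by (simp add: noise_sum_def algebra_simps)
qed

lemma noise_sum_second_moment: "l \<le> H \<Longrightarrow> mean (\<lambda>b. (norm (noise_sum l b))\<^sup>2) \<le> real l * v"
proof (induction l)
  case 0
  then show ?case by (simp add: noise_sum_def)
next
  case (Suc l)
  have "(norm (noise_sum (Suc l) b))\<^sup>2
      = (norm (noise_sum l b))\<^sup>2 + 2 * (\<Sum>k<l. \<zeta> k b \<bullet> \<zeta> l b) + (norm (\<zeta> l b))\<^sup>2" for b
    by (simp add: noise_sum_def power2_norm_eq_inner inner_add_left inner_add_right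
        inner_sum_left inner_sum_right inner_commute)
  then have "mean (\<lambda>b. (norm (noise_sum (Suc l) b))\<^sup>2)
      = mean (\<lambda>b. (norm (noise_sum l b))\<^sup>2) + 2 * (\<Sum>k<l. mean (\<lambda>b. \<zeta> k b \<bullet> \<zeta> l b))
        + mean (\<lambda>b. (norm (\<zeta> l b))\<^sup>2)"
    by (simp add: mean_add mean_cmult mean_sum)
  also have "(\<Sum>k<l. mean (\<lambda>b. \<zeta> k b \<bullet> \<zeta> l b)) = 0"
    using Suc.prems by (intro sum.neutral) (auto simp: noise_orthogonal)
  finally show ?case
    using Suc noise_variance[of l] by (simp add: algebra_simps)
qed

text \<open>A discrete Gronwall argument: each local gradient deviates from the one at \<open>x\<close> by at most
  \<open>L\<close> times the displacement reached so far, and the remaining terms, the constant direction \<open>g0\<close> and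
  the noise, contribute at most \<open>\<theta>/L * (\<parallel>g0\<parallel> + sqrt (v/H))\<close>. Because the noise terms are orthogonal,
  their sum over \<open>H\<close> steps is only of order \<open>sqrt H\<close>, whence the factor \<open>1/H\<close> at \<open>v\<close>.\<close>

lemma rms_displacement:
  assumes "l \<le> H"
  shows "rms (\<lambda>b. y l b - x) \<le> (1 + \<theta> / real H) ^ l * (\<theta> / L * (norm g0 + sqrt (v / real H)))"
  using assms
proof (induction l rule: less_induct)
  case (less l)
  define K where "K = \<theta> / L * (norm g0 + sqrt (v / real H))"
  have H: "real H > 0" using H_pos by simp
  have "rms (\<lambda>b. y l b - x)
      = rms (\<lambda>b. (\<Sum>k<l. - \<eta> *\<^sub>R (G (y k b) - G x)) + ((- \<eta> * real l) *\<^sub>R g0 + - \<eta> *\<^sub>R noise_sum l b))"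
    unfolding rms_def
    by (intro arg_cong[where f = sqrt] mean_cong) (simp only: path_displacement[OF _ less.prems])
  also have "\<dots> \<le> (\<Sum>k<l. rms (\<lambda>b. - \<eta> *\<^sub>R (G (y k b) - G x)))
      + (rms (\<lambda>b. (- \<eta> * real l) *\<^sub>R g0) + rms (\<lambda>b. - \<eta> *\<^sub>R noise_sum l b))"
    by (intro order_trans[OF rms_add_le] add_mono rms_sum_le order_refl)
  also have "(\<Sum>k<l. rms (\<lambda>b. - \<eta> *\<^sub>R (G (y k b) - G x)))
      \<le> (\<Sum>k<l. \<theta> / real H * ((1 + \<theta> / real H) ^ k * K))"
  proof (rule sum_mono)
    fix k assume k: "k \<in> {..<l}"
    have "rms (\<lambda>b. - \<eta> *\<^sub>R (G (y k b) - G x)) \<le> rms (\<lambda>b. (\<eta> * L) *\<^sub>R (y k b - x))"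
      using eta_pos L_pos lipschitz by (intro rms_mono) (simp add: mult.assoc)
    also have "\<dots> = \<theta> / real H * rms (\<lambda>b. y k b - x)"
      using eta_pos L_pos by (simp add: rms_scaleR) (simp add: \<eta>_def)
    also have "\<dots> \<le> \<theta> / real H * ((1 + \<theta> / real H) ^ k * K)"
      using less.IH[of k] k less.prems theta_pos H by (intro mult_left_mono) (auto simp: K_def)
    finally show "rms (\<lambda>b. - \<eta> *\<^sub>R (G (y k b) - G x)) \<le> \<theta> / real H * ((1 + \<theta> / real H) ^ k * K)" .
  qed
  also have "rms (\<lambda>b. (- \<eta> * real l) *\<^sub>R g0) + rms (\<lambda>b. - \<eta> *\<^sub>R noise_sum l b) \<le> K"
  proof -
    have "rms (\<lambda>b. (- \<eta> * real l) *\<^sub>R g0) = \<eta> * real l * norm g0"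
      using eta_pos by (simp add: rms_scaleR abs_mult)
    also have "\<dots> \<le> \<eta> * real H * norm g0"
      using eta_pos less.prems by (intro mult_right_mono mult_left_mono) auto
    finally have 1: "rms (\<lambda>b. (- \<eta> * real l) *\<^sub>R g0) \<le> \<eta> * real H * norm g0" .
    have "mean (\<lambda>b. (norm (noise_sum l b))\<^sup>2) \<le> real H * v"
      using noise_sum_second_moment[OF less.prems] less.prems v_nonneg
      by (meson mult_right_mono of_nat_mono order_trans)
    then have "rms (noise_sum l) \<le> sqrt (real H * v)" unfolding rms_def by simp
    also have "real H * v = (real H)\<^sup>2 * (v / real H)"
      using H by (simp add: power2_eq_square)
    also have "sqrt \<dots> = real H * sqrt (v / real H)"
      unfolding real_sqrt_mult by simp
    finally have "rms (\<lambda>b. - \<eta> *\<^sub>R noise_sum l b) \<le> \<eta> * (real H * sqrt (v / real H))"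
      using eta_pos by (simp add: rms_scaleR[of "-\<eta>", simplified])
    with 1 show ?thesis using H by (simp add: K_def \<eta>_def algebra_simps)
  qed
  finally have "rms (\<lambda>b. y l b - x) \<le> (\<Sum>k<l. \<theta> / real H * ((1 + \<theta> / real H) ^ k * K)) + K"
    by simp
  also have "\<dots> = (1 + \<theta> / real H) ^ l * K"
    by (induction l) (auto simp: algebra_simps)
  finally show ?case by (simp add: K_def)
qed

lemma rms_displacement_uniform:
  assumes "l \<le> H"
  shows "rms (\<lambda>b. y l b - x) \<le> exp \<theta> * (\<theta> / L * (norm g0 + sqrt (v / real H)))"
proof -
  have H: "real H > 0" using H_pos by simp
  have "(1 + \<theta> / real H) ^ l \<le> exp (\<theta> / real H) ^ l"
    using theta_pos H by (intro power_mono exp_ge_add_one_self) auto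
  also have "\<dots> = exp (real l * (\<theta> / real H))" by (rule exp_of_nat_mult[symmetric])
  also have "\<dots> \<le> exp \<theta>"
    using assms theta_pos H by (simp add: field_simps)
  finally have "(1 + \<theta> / real H) ^ l \<le> exp \<theta>" .
  moreover have "0 \<le> \<theta> / L * (norm g0 + sqrt (v / real H))"
    using L_pos theta_pos v_nonneg H by simp
  ultimately show ?thesis
    using rms_displacement[OF assms] by (meson mult_right_mono order_trans)
qed

lemma drift_second_moment: "mean (\<lambda>b. (norm (drift b))\<^sup>2) \<le> drift_bound"
proof -
  have H: "real H > 0" using H_pos by simp
  define K where "K = norm g0 + sqrt (v / real H)"
  have "rms drift = 1 / real H * rms (\<lambda>b. \<Sum>l<H. G (y l b) - G x)"
    unfolding drift_def[abs_def] by (simp add: rms_scaleR)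
  also have "\<dots> \<le> 1 / real H * (\<Sum>l<H. rms (\<lambda>b. G (y l b) - G x))"
    by (intro mult_left_mono rms_sum_le) simp
  also have "\<dots> \<le> 1 / real H * (\<Sum>l<H. exp \<theta> * \<theta> * K)"
  proof (intro mult_left_mono sum_mono)
    fix l assume l: "l \<in> {..<H}"
    have "rms (\<lambda>b. G (y l b) - G x) \<le> rms (\<lambda>b. L *\<^sub>R (y l b - x))"
      using L_pos lipschitz by (intro rms_mono) simp
    also have "\<dots> = L * rms (\<lambda>b. y l b - x)" using L_pos by (simp add: rms_scaleR)
    also have "\<dots> \<le> L * (exp \<theta> * (\<theta> / L * K))"
      unfolding K_def using L_pos l by (intro mult_left_mono rms_displacement_uniform) auto
    finally show "rms (\<lambda>b. G (y l b) - G x) \<le> exp \<theta> * \<theta> * K" using L_pos by simp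
  qed simp
  also have "\<dots> = exp \<theta> * \<theta> * K" using H by simp
  finally have "(rms drift)\<^sup>2 \<le> (exp \<theta> * \<theta> * K)\<^sup>2"
    by (intro power_mono rms_nonneg)
  also have "\<dots> = exp (2 * \<theta>) * \<theta>\<^sup>2 * K\<^sup>2"
    by (simp add: power_mult_distrib exp_double)
  also have "K\<^sup>2 \<le> 2 * ((norm g0)\<^sup>2 + v / real H)"
    using sum_squares_bound[of "norm g0" "sqrt (v / real H)"] v_nonneg H
    by (simp add: K_def power2_sum)
  finally have "(rms drift)\<^sup>2 \<le> exp (2 * \<theta>) * \<theta>\<^sup>2 * (2 * ((norm g0)\<^sup>2 + v / real H))"
    by (simp add: mult_left_mono)
  then show ?thesis
    unfolding rms_square drift_bound_def by (simp only: mult_ac)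
qed

lemma final_displacement:
  assumes "b \<in> \<Omega>"
  shows "y H b = x - (\<theta> / L) *\<^sub>R (g0 + drift b + (1 / real H) *\<^sub>R noise_sum H b)"
proof -
  have H: "real H > 0" using H_pos by simp
  have "\<eta> = \<theta> / L * (1 / real H)" by (simp add: \<eta>_def)
  then have "y H b - x = - ((\<theta> / L) *\<^sub>R (g0 + drift b + (1 / real H) *\<^sub>R noise_sum H b))"
    unfolding path_displacement[OF assms order_refl] drift_def using H
    by (simp add: scaleR_add_right scaleR_sum_right sum_negf add_ac)
  then show ?thesis by (simp add: algebra_simps)
qed

lemma mean_noise_sum: "mean (noise_sum H) = 0"
  unfolding noise_sum_def by (simp add: mean_sum noise_mean)

lemma mean_final: "mean (y H) = x - (\<theta> / L) *\<^sub>R (g0 + mean drift)"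
proof -
  have "mean (y H) = mean (\<lambda>b. x - (\<theta> / L) *\<^sub>R (g0 + drift b + (1 / real H) *\<^sub>R noise_sum H b))"
    by (rule mean_cong) (rule final_displacement)
  then show ?thesis by (simp add: mean_diff mean_add mean_scaleR mean_noise_sum)
qed

lemma norm_mean_drift: "(norm (mean drift))\<^sup>2 \<le> drift_bound"
  using norm_mean_square_le[of drift] drift_second_moment by simp

lemma variance_final:
  "mean (\<lambda>b. (norm (y H b - mean (y H)))\<^sup>2) \<le> (\<theta> / L)\<^sup>2 * (2 * drift_bound + 2 * (v / real H))"
proof -
  have H: "real H > 0" using H_pos by simp
  define N where "N b = (1 / real H) *\<^sub>R noise_sum H b" for b
  have "mean (\<lambda>b. (norm (y H b - mean (y H)))\<^sup>2)
      = mean (\<lambda>b. (\<theta> / L)\<^sup>2 * (norm ((drift b - mean drift) + N b))\<^sup>2)"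
  proof (rule mean_cong)
    fix b assume b: "b \<in> \<Omega>"
    have "y H b - mean (y H) = - ((\<theta> / L) *\<^sub>R ((drift b - mean drift) + N b))"
      unfolding mean_final final_displacement[OF b] N_def by (simp add: algebra_simps)
    then show "(norm (y H b - mean (y H)))\<^sup>2 = (\<theta> / L)\<^sup>2 * (norm ((drift b - mean drift) + N b))\<^sup>2"
      by (simp add: power_divide power_mult_distrib)
  qed
  also have "\<dots> = (\<theta> / L)\<^sup>2 * mean (\<lambda>b. (norm ((drift b - mean drift) + N b))\<^sup>2)"
    by (rule mean_cmult)
  also have "\<dots> \<le> (\<theta> / L)\<^sup>2 * (2 * drift_bound + 2 * (v / real H))"
  proof (rule mult_left_mono)
    have "mean (\<lambda>b. (norm ((drift b - mean drift) + N b))\<^sup>2)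
        \<le> mean (\<lambda>b. 2 * (norm (drift b - mean drift))\<^sup>2 + 2 * (norm (N b))\<^sup>2)"
      by (intro mean_mono sq_norm_add_le)
    also have "\<dots> = 2 * mean (\<lambda>b. (norm (drift b - mean drift))\<^sup>2) + 2 * mean (\<lambda>b. (norm (N b))\<^sup>2)"
      by (simp add: mean_add mean_cmult)
    also have "mean (\<lambda>b. (norm (drift b - mean drift))\<^sup>2) \<le> drift_bound"
      using mean_norm_square_centered_le[of drift] drift_second_moment by simp
    also have "mean (\<lambda>b. (norm (N b))\<^sup>2) \<le> v / real H"
    proof -
      have "mean (\<lambda>b. (norm (N b))\<^sup>2) = (1 / real H)\<^sup>2 * mean (\<lambda>b. (norm (noise_sum H b))\<^sup>2)"
        unfolding N_def by (simp add: power_mult_distrib power_divide flip: mean_cmult)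
      also have "\<dots> \<le> (1 / real H)\<^sup>2 * (real H * v)"
        by (intro mult_left_mono noise_sum_second_moment) auto
      finally show ?thesis using H by (simp add: power2_eq_square)
    qed
    finally show "mean (\<lambda>b. (norm ((drift b - mean drift) + N b))\<^sup>2) \<le> 2 * drift_bound + 2 * (v / real H)"
      by simp
  qed simp
  finally show ?thesis .
qed

end

section \<open>One round over a finite distribution of minibatches\<close>

text \<open>Here \<open>g\<close> stands for the global gradient at the starting point, which is small when the gap is,
  and \<open>g0 - g\<close> for the error of the controls.\<close>

lemma (in local_path) drift_bound_le:
  assumes "(norm g)\<^sup>2 \<le> 2 * L * u" "(norm (g0 - g))\<^sup>2 \<le> 4 * q"
  shows "drift_bound \<le> 2 * exp (2 * \<theta>) * \<theta>\<^sup>2 * (4 * L * u + 8 * q + v / real H)"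
proof -
  have "(norm g0)\<^sup>2 \<le> 2 * (norm g)\<^sup>2 + 2 * (norm (g0 - g))\<^sup>2"
    using sq_norm_add_le[of g "g0 - g"] by simp
  then show ?thesis
    unfolding drift_bound_def using assms by (intro mult_left_mono) auto
qed

text \<open>Since \<open>\<theta> \<le> 1\<close>, the quadratic term of the descent inequality is at most
  \<open>\<theta>/(2L) * \<parallel>g + r\<parallel>\<^sup>2\<close>; then the inner products of \<open>g\<close> and \<open>r\<close> cancel.\<close>

lemma descent_perturbed_gradient_step:
  assumes "L_smooth L F" "L > 0" "0 \<le> \<theta>" "\<theta> \<le> 1"
  shows "F (x - (\<theta> / L) *\<^sub>R (gradient F x + r))
    \<le> F x - \<theta> / (2 * L) * (norm (gradient F x))\<^sup>2 + \<theta> / (2 * L) * (norm r)\<^sup>2"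
proof -
  let ?g = "gradient F x"
  have "F (x - (\<theta> / L) *\<^sub>R (?g + r))
      \<le> F x - \<theta> / L * (?g \<bullet> (?g + r)) + L / 2 * ((\<theta> / L)\<^sup>2 * (norm (?g + r))\<^sup>2)"
    using smooth_descent[OF assms(1), of "x - (\<theta> / L) *\<^sub>R (?g + r)" x]
    by (simp add: power_mult_distrib power_divide)
  also have "L / 2 * ((\<theta> / L)\<^sup>2 * (norm (?g + r))\<^sup>2) = \<theta> * (\<theta> / (2 * L) * (norm (?g + r))\<^sup>2)"
    using \<open>L > 0\<close> by (simp add: power2_eq_square)
  also have "\<dots> \<le> 1 * (\<theta> / (2 * L) * (norm (?g + r))\<^sup>2)"
    using assms by (intro mult_right_mono) auto
  also have "F x - \<theta> / L * (?g \<bullet> (?g + r)) + \<dots>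
      = F x - \<theta> / (2 * L) * (norm ?g)\<^sup>2 + \<theta> / (2 * L) * (norm r)\<^sup>2"
    using \<open>L > 0\<close>
    by (simp add: power2_norm_eq_inner inner_add_left inner_add_right inner_commute field_simps)
  finally show ?thesis by simp
qed

lemma T_map_upper:
  assumes "0 \<le> a" "0 \<le> f" "f \<le> u"
  shows "f - a * f\<^sup>2 \<le> T_map a u"
proof -
  have "(f - a * f\<^sup>2) * (1 + a * f) = f - a\<^sup>2 * f ^ 3"
    by (simp add: algebra_simps power2_eq_square power3_eq_cube)
  also have "\<dots> \<le> f" using assms by simp
  finally have "f - a * f\<^sup>2 \<le> f / (1 + a * f)"
    using assms by (simp add: pos_le_divide_eq add_pos_nonneg)
  also have "\<dots> \<le> u / (1 + a * u)"
  proof -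
    have "f * (1 + a * u) \<le> u * (1 + a * f)" using assms by (simp add: algebra_simps)
    moreover have "0 < 1 + a * f" "0 < 1 + a * u"
      using assms by (auto intro!: add_pos_nonneg mult_nonneg_nonneg)
    ultimately show ?thesis by (simp add: divide_simps)
  qed
  finally show ?thesis by (simp add: T_map_def)
qed

context
  fixes P :: "('n::finite, 'd::finite) problem"
  assumes problem: "valid_problem P"
begin

lemma valid_problemD:
  shows "samples P i \<ge> 1" "smooth_const P > 0" "radius P > 0" "horizon P i \<ge> 1" "batch_size P i \<ge> 1"
    "0 < theta_lo P" "theta_hi P \<le> 1"
    "j \<in> {1..samples P i} \<Longrightarrow> convex_on UNIV (phi P i j)"
    "j \<in> {1..samples P i} \<Longrightarrow> L_smooth (smooth_const P) (phi P i j)"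
  using problem unfolding valid_problem_def by auto

lemma F_star_le: "F_star P \<le> global_obj P x"
  using problem unfolding valid_problem_def is_arg_min_def F_star_def by (simp add: not_less)

lemma local_obj_eq_average:
  "local_obj P i = (\<lambda>x. (\<Sum>j\<in>{1..samples P i}. phi P i j x) / real (card {1..samples P i}))"
  by (simp add: local_obj_def fun_eq_iff)

lemma global_obj_eq_average:
  "global_obj P = (\<lambda>x. (\<Sum>i\<in>UNIV. local_obj P i x) / real (card (UNIV :: 'n set)))"
  by (simp add: global_obj_def fun_eq_iff)

lemma local_obj_smooth: "L_smooth (smooth_const P) (local_obj P i)"
  unfolding local_obj_eq_average using valid_problemD(1)[of i]
  by (intro L_smooth_average valid_problemD(9)) auto

lemma local_obj_convex: "convex_on UNIV (local_obj P i)"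
  unfolding local_obj_eq_average by (intro convex_on_average valid_problemD(8)) auto

lemma global_obj_smooth: "L_smooth (smooth_const P) (global_obj P)"
  unfolding global_obj_eq_average by (intro L_smooth_average local_obj_smooth) auto

lemma global_obj_convex: "convex_on UNIV (global_obj P)"
  unfolding global_obj_eq_average by (intro convex_on_average local_obj_convex) auto

lemma gradient_global_obj:
  "gradient (global_obj P) x = (1 / real CARD('n)) *\<^sub>R (\<Sum>i\<in>UNIV. gradient (local_obj P i) x)"
  unfolding global_obj_eq_average by (intro gradient_average[where L = "smooth_const P"] local_obj_smooth)

lemma gradient_norm_le:
  "(norm (gradient (global_obj P) x))\<^sup>2 \<le> 2 * smooth_const P * (global_obj P x - F_star P)"
  using gradient_norm_le_gap[OF global_obj_smooth valid_problemD(2), of "x_star P" x] F_star_le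
  by (simp add: F_star_def)

lemma gap_le_f_bar:
  assumes "x \<in> cball (x_star P) (radius P)"
  shows "global_obj P x - F_star P \<le> f_bar P"
proof -
  have "gradient (global_obj P) (x_star P) = 0"
    using gradient_norm_le[of "x_star P"] by (simp add: F_star_def)
  then have "global_obj P x - F_star P \<le> smooth_const P / 2 * (norm (x - x_star P))\<^sup>2"
    using smooth_descent[OF global_obj_smooth, of x "x_star P"] by (simp add: F_star_def)
  also have "\<dots> \<le> smooth_const P / 2 * (radius P)\<^sup>2"
    using assms valid_problemD(2) 
    by (intro mult_left_mono power_mono) (auto simp: dist_norm norm_minus_commute)
  finally show ?thesis by (simp add: f_bar_def)
qed

lemma gap_le_gradient_norm:
  assumes "x \<in> cball (x_star P) (radius P)"
  shows "global_obj P x - F_star P \<le> norm (gradient (global_obj P) x) * radius P"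
proof -
  have "global_obj P x - F_star P \<le> gradient (global_obj P) x \<bullet> (x - x_star P)"
    using convex_gradient_lower_bound[OF global_obj_smooth global_obj_convex, of x "x_star P"]
    by (simp add: F_star_def inner_diff_right)
  also have "\<dots> \<le> norm (gradient (global_obj P) x) * norm (x - x_star P)"
    by (rule norm_cauchy_schwarz)
  also have "\<dots> \<le> norm (gradient (global_obj P) x) * radius P"
    using assms by (intro mult_left_mono) (auto simp: dist_norm norm_minus_commute)
  finally show ?thesis .
qed

text \<open>A gradient step contracts the gap by the map \<open>T\<close>, and a perturbation \<open>r\<close> of the direction costs
  \<open>\<theta>/(2L) * \<parallel>r\<parallel>\<^sup>2\<close>.\<close>

lemma perturbed_step_gap:
  assumes x: "x \<in> cball (x_star P) (radius P)" and u: "global_obj P x - F_star P \<le> u"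
    and \<theta>: "0 \<le> \<theta>" "\<theta> \<le> 1"
  shows "global_obj P (x - (\<theta> / smooth_const P) *\<^sub>R (gradient (global_obj P) x + r)) - F_star P
    \<le> T_map (A_coef P \<theta>) (U_sharp P u) + \<theta> / (2 * smooth_const P) * (norm r)\<^sup>2"
proof -
  let ?L = "smooth_const P" and ?R = "radius P" and ?g = "gradient (global_obj P) x"
  define f where "f = global_obj P x - F_star P"
  have pos: "?L > 0" "?R > 0" by (rule valid_problemD)+
  have f: "0 \<le> f" "f \<le> U_sharp P u"
    using F_star_le[of x] u gap_le_f_bar[OF x] by (auto simp: f_def U_sharp_def)
  have "f\<^sup>2 \<le> (norm ?g * ?R)\<^sup>2"
    using gap_le_gradient_norm[OF x] f(1) by (intro power_mono) (auto simp: f_def)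
  then have "A_coef P \<theta> * f\<^sup>2 \<le> A_coef P \<theta> * (norm ?g * ?R)\<^sup>2"
    using pos \<theta> by (intro mult_left_mono) (auto simp: A_coef_def)
  also have "\<dots> = \<theta> / (2 * ?L) * (norm ?g)\<^sup>2"
    using pos by (simp add: A_coef_def power_mult_distrib)
  finally have "f - \<theta> / (2 * ?L) * (norm ?g)\<^sup>2 \<le> f - A_coef P \<theta> * f\<^sup>2" by simp
  also have "\<dots> \<le> T_map (A_coef P \<theta>) (U_sharp P u)"
    using pos \<theta> by (intro T_map_upper f) (simp add: A_coef_def)
  finally show ?thesis
    using descent_perturbed_gradient_step[OF global_obj_smooth pos(1) \<theta>, of x r]
    by (simp add: f_def)
qed

text \<open>The direction corrected by the controls deviates from the global gradient by the error of
  one node control and the average of all of them, each of norm at most \<open>sqrt q\<close>.\<close>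

lemma control_error:
  fixes cs :: "'n \<Rightarrow> real^'d"
  assumes cs: "\<And>i. (norm (cs i - gradient (local_obj P i) x))\<^sup>2 \<le> q"
  shows "(norm ((gradient (local_obj P i) x + ((1 / real CARD('n)) *\<^sub>R (\<Sum>k\<in>UNIV. cs k) - cs i))
      - gradient (global_obj P) x))\<^sup>2 \<le> 4 * q"
proof -
  define e where "e k = cs k - gradient (local_obj P k) x" for k
  have q: "0 \<le> q" using cs order_trans zero_le_power2 by blast
  have e: "norm (e k) \<le> sqrt q" for k
    unfolding e_def using cs by (simp add: real_le_rsqrt)
  have "norm ((1 / real CARD('n)) *\<^sub>R (\<Sum>k\<in>UNIV. e k)) \<le> 1 / real CARD('n) * (\<Sum>k\<in>(UNIV::'n set). sqrt q)"
    unfolding norm_scaleR by (intro mult_mono order_trans[OF norm_sum] sum_mono e) auto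
  then have avg: "norm ((1 / real CARD('n)) *\<^sub>R (\<Sum>k\<in>UNIV. e k)) \<le> sqrt q" by simp
  have "(gradient (local_obj P i) x + ((1 / real CARD('n)) *\<^sub>R (\<Sum>k\<in>UNIV. cs k) - cs i))
      - gradient (global_obj P) x = (1 / real CARD('n)) *\<^sub>R (\<Sum>k\<in>UNIV. e k) - e i"
    by (simp add: gradient_global_obj e_def sum_subtractf scaleR_diff_right)
  moreover have "norm ((1 / real CARD('n)) *\<^sub>R (\<Sum>k\<in>UNIV. e k) - e i) \<le> 2 * sqrt q"
    using norm_triangle_ineq4[of "(1 / real CARD('n)) *\<^sub>R (\<Sum>k\<in>UNIV. e k)" "e i"] avg e[of i] by linarith
  then have "(norm ((1 / real CARD('n)) *\<^sub>R (\<Sum>k\<in>UNIV. e k) - e i))\<^sup>2 \<le> (2 * sqrt q)\<^sup>2"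
    by (intro power_mono) auto
  ultimately show ?thesis using q by (simp add: power_mult_distrib)
qed

lemma local_path_mean_gap:
  assumes path: "local_path \<Omega> p (gradient (local_obj P i)) (smooth_const P) \<theta>
      (variance_level P i / real (batch_size P i)) (horizon P i) x c y \<zeta>"
    and x: "x \<in> cball (x_star P) (radius P)" and u: "global_obj P x - F_star P \<le> u"
    and err: "(norm ((gradient (local_obj P i) x + c) - gradient (global_obj P) x))\<^sup>2 \<le> 4 * q"
    and \<theta>: "\<theta> \<le> 1"
  shows "global_obj P (finite_distribution.mean \<Omega> p (y (horizon P i))) - F_star P
    \<le> T_map (A_coef P \<theta>) (U_sharp P u) + rho P (variance_level P) u q i \<theta>"
proof -
  interpret local_path \<Omega> p "gradient (local_obj P i)" "smooth_const P" \<theta>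
      "variance_level P i / real (batch_size P i)" "horizon P i" x c y \<zeta>
    by (rule path)
  let ?L = "smooth_const P" and ?g = "gradient (global_obj P) x"
  let ?e = "exp (2 * \<theta>)" and ?v = "variance_level P i / (real (horizon P i) * real (batch_size P i))"
  define r where "r = (g0 - ?g) + mean drift"
  have err0: "(norm (g0 - ?g))\<^sup>2 \<le> 4 * q" using err by (simp add: g0_def)
  have q: "0 \<le> q" using order_trans[OF zero_le_power2 err] by simp
  have u0: "0 \<le> u" using F_star_le[of x] u by simp
  have v0: "0 \<le> ?v"
    using divide_nonneg_nonneg[OF v_nonneg, of "real (horizon P i)"] by (simp add: mult.commute)
  have "?L * (global_obj P x - F_star P) \<le> ?L * u" using L_pos u by simp
  then have g: "(norm ?g)\<^sup>2 \<le> 2 * ?L * u" using gradient_norm_le[of x] by linarith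
  have drift: "drift_bound \<le> 2 * ?e * \<theta>\<^sup>2 * (4 * ?L * u + 8 * q + ?v)"
    using drift_bound_le[OF g err0] by (simp add: mult.commute)
  have "(norm r)\<^sup>2 \<le> 2 * (norm (g0 - ?g))\<^sup>2 + 2 * (norm (mean drift))\<^sup>2"
    unfolding r_def by (rule sq_norm_add_le)
  also have "\<dots> \<le> 8 * q + 2 * (2 * ?e * \<theta>\<^sup>2 * (4 * ?L * u + 8 * q + ?v))"
    using err0 norm_mean_drift drift by linarith
  \<comment> \<open>The constants of \<open>\<rho>\<close> leave room: a quarter of each would do.\<close>
  also have "\<dots> \<le> 32 * q + 2 * (?e * \<theta>\<^sup>2 * (32 * ?L * u + 64 * q + 8 * ?v))"
  proof -
    have "(?e * \<theta>\<^sup>2) * (2 * (4 * ?L * u + 8 * q + ?v)) \<le> (?e * \<theta>\<^sup>2) * (32 * ?L * u + 64 * q + 8 * ?v)"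
    proof (rule mult_left_mono)
      have "2 * (4 * a + 8 * q + z) \<le> 32 * a + 64 * q + 8 * z" if "0 \<le> a" "0 \<le> z" for a z
        using that q by simp
      from this[of "?L * u" ?v]
      show "2 * (4 * ?L * u + 8 * q + ?v) \<le> 32 * ?L * u + 64 * q + 8 * ?v"
        using u0 L_pos v0 by (simp add: mult.assoc)
    qed simp
    moreover have "2 * (2 * ?e * \<theta>\<^sup>2 * Z) = 2 * ((?e * \<theta>\<^sup>2) * (2 * Z))" for Z by simp
    ultimately show ?thesis using q by linarith
  qed
  finally have "\<theta> / (2 * ?L) * (norm r)\<^sup>2
      \<le> \<theta> / (2 * ?L) * (32 * q + 2 * (?e * \<theta>\<^sup>2 * (32 * ?L * u + 64 * q + 8 * ?v)))"
    using theta_pos L_pos by (intro mult_left_mono) auto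
  also have "\<dots> = rho P (variance_level P) u q i \<theta>"
  proof -
    have rho: "rho P (variance_level P) u q i \<theta> = 32 * ?e * \<theta>^3 * u
        + (16 * \<theta> + 64 * ?e * \<theta>^3) / ?L * q + 8 * ?e * (\<theta>^3 * ?v / ?L)"
      unfolding rho_def by (simp add: mult_ac)
    have "\<theta> / (2 * ?L) * (32 * q + 2 * (?e * \<theta>\<^sup>2 * (32 * ?L * u + 64 * q + 8 * W)))
        = 32 * ?e * \<theta>^3 * u + (16 * \<theta> + 64 * ?e * \<theta>^3) / ?L * q + 8 * ?e * (\<theta>^3 * W / ?L)" for W
      using L_pos by (simp add: field_simps power2_eq_square power3_eq_cube)
    then show ?thesis unfolding rho .
  qed
  finally have "\<theta> / (2 * ?L) * (norm r)\<^sup>2 \<le> rho P (variance_level P) u q i \<theta>" .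
  moreover have "mean (y (horizon P i)) = x - (\<theta> / ?L) *\<^sub>R (?g + r)"
    by (simp add: mean_final r_def)
  ultimately show ?thesis
    using perturbed_step_gap[OF x u less_imp_le[OF theta_pos] \<theta>, of r] by simp
qed

lemma local_path_variance:
  assumes path: "local_path \<Omega> p (gradient (local_obj P i)) (smooth_const P) \<theta>
      (variance_level P i / real (batch_size P i)) (horizon P i) x c y \<zeta>"
    and u: "global_obj P x - F_star P \<le> u"
    and err: "(norm ((gradient (local_obj P i) x + c) - gradient (global_obj P) x))\<^sup>2 \<le> 4 * q"
  shows "finite_distribution.mean \<Omega> p
      (\<lambda>b. (norm (y (horizon P i) b - finite_distribution.mean \<Omega> p (y (horizon P i))))\<^sup>2)
    \<le> kappa P (variance_level P) u q i \<theta>"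
proof -
  interpret local_path \<Omega> p "gradient (local_obj P i)" "smooth_const P" \<theta>
      "variance_level P i / real (batch_size P i)" "horizon P i" x c y \<zeta>
    by (rule path)
  let ?L = "smooth_const P" and ?g = "gradient (global_obj P) x"
  let ?e = "exp (2 * \<theta>)" and ?v = "variance_level P i / (real (horizon P i) * real (batch_size P i))"
  have err0: "(norm (g0 - ?g))\<^sup>2 \<le> 4 * q" using err by (simp add: g0_def)
  have "?L * (global_obj P x - F_star P) \<le> ?L * u" using L_pos u by simp
  then have g: "(norm ?g)\<^sup>2 \<le> 2 * ?L * u" using gradient_norm_le[of x] by linarith
  have drift: "drift_bound \<le> 2 * ?e * \<theta>\<^sup>2 * (4 * ?L * u + 8 * q + ?v)"
    using drift_bound_le[OF g err0] by (simp add: mult.commute)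
  have "mean (\<lambda>b. (norm (y (horizon P i) b - mean (y (horizon P i))))\<^sup>2)
      \<le> (\<theta> / ?L)\<^sup>2 * (2 * drift_bound + 2 * ?v)"
    using variance_final by (simp add: mult.commute)
  also have "\<dots> \<le> (\<theta> / ?L)\<^sup>2 * (2 * (2 * ?e * \<theta>\<^sup>2 * (4 * ?L * u + 8 * q + ?v)) + 2 * ?v)"
    using drift by (intro mult_left_mono add_mono) auto
  also have "\<dots> = kappa P (variance_level P) u q i \<theta>"
  proof -
    have kappa: "kappa P (variance_level P) u q i \<theta> = 16 * ?e * (\<theta>^4 / ?L) * u
        + 32 * ?e * (\<theta>^4 / ?L\<^sup>2) * q + (2 * \<theta>\<^sup>2 + 4 * ?e * \<theta>^4) * (?v / ?L\<^sup>2)"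
      unfolding kappa_def by (simp add: mult_ac)
    have "(\<theta> / ?L)\<^sup>2 * (2 * (2 * ?e * \<theta>\<^sup>2 * (4 * ?L * u + 8 * q + W)) + 2 * W)
        = 16 * ?e * (\<theta>^4 / ?L) * u + 32 * ?e * (\<theta>^4 / ?L\<^sup>2) * q
          + (2 * \<theta>\<^sup>2 + 4 * ?e * \<theta>^4) * (W / ?L\<^sup>2)" for W
      using L_pos by (simp add: field_simps power2_eq_square power4_eq_xxxx)
    then show ?thesis unfolding kappa .
  qed
  finally show ?thesis .
qed

text \<open>The expected gap after one round, for a server control that is the average of the node
  controls.\<close>

lemma finite_round_bound:
  fixes \<Omega> :: "'b set" and cs :: "'n \<Rightarrow> real^'d"
  assumes w: "w \<in> weight_simplex S" and \<theta>: "\<theta> \<in> amplitude_box P S"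
    and x: "x \<in> cball (x_star P) (radius P)" and u: "global_obj P x - F_star P \<le> u"
    and cs: "\<And>i. (norm (cs i - gradient (local_obj P i) x))\<^sup>2 \<le> q"
    and c: "c = (1 / real CARD('n)) *\<^sub>R (\<Sum>i\<in>UNIV. cs i)"
    and distr: "finite_distribution \<Omega> p"
    and path: "\<And>i. i \<in> S \<Longrightarrow> local_path \<Omega> p (gradient (local_obj P i)) (smooth_const P) (\<theta> $ i)
      (variance_level P i / real (batch_size P i)) (horizon P i) x (c - cs i) (y i) (\<zeta> i)"
    and uncorr: "\<And>i k. i \<in> S \<Longrightarrow> k \<in> S \<Longrightarrow> i \<noteq> k \<Longrightarrow>
      finite_distribution.mean \<Omega> p (\<lambda>b. y i (horizon P i) b \<bullet> y k (horizon P k) b)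
      = finite_distribution.mean \<Omega> p (y i (horizon P i)) \<bullet> finite_distribution.mean \<Omega> p (y k (horizon P k))"
  shows "(\<Sum>b\<in>\<Omega>. p b * (global_obj P (x + (\<Sum>i\<in>S. (w $ i) *\<^sub>R (y i (horizon P i) b - x))) - F_star P))
    \<le> J_id P S u q (w, \<theta>)"
proof -
  interpret finite_distribution \<Omega> p by (rule distr)
  let ?L = "smooth_const P"
  let ?z = "\<lambda>i. y i (horizon P i)"
  let ?\<rho> = "\<lambda>i. rho P (variance_level P) u q i (\<theta> $ i)"
  let ?\<kappa> = "\<lambda>i. kappa P (variance_level P) u q i (\<theta> $ i)"
  have w0: "\<And>i. i \<in> S \<Longrightarrow> 0 \<le> w $ i" and w1: "(\<Sum>i\<in>S. w $ i) = 1"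
    using w by (auto simp: weight_simplex_def)
  have th1: "\<theta> $ i \<le> 1" if "i \<in> S" for i
    using that \<theta> valid_problemD(7) by (force simp: amplitude_box_def)
  have err: "(norm ((gradient (local_obj P i) x + (c - cs i)) - gradient (global_obj P) x))\<^sup>2 \<le> 4 * q" for i
    unfolding c by (rule control_error) (rule cs)
  have "x + (\<Sum>i\<in>S. (w $ i) *\<^sub>R (?z i b - x)) = (\<Sum>i\<in>S. (w $ i) *\<^sub>R ?z i b)" for b
    using w1 by (simp add: scaleR_diff_right sum_subtractf flip: scaleR_left.sum)
  then have "(\<Sum>b\<in>\<Omega>. p b * (global_obj P (x + (\<Sum>i\<in>S. (w $ i) *\<^sub>R (?z i b - x))) - F_star P))
      = mean (\<lambda>b. global_obj P (\<Sum>i\<in>S. (w $ i) *\<^sub>R ?z i b)) - F_star P"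
    using mean_diff[of "\<lambda>b. global_obj P (\<Sum>i\<in>S. (w $ i) *\<^sub>R ?z i b)" "\<lambda>_. F_star P"]
    unfolding mean_def[of "\<lambda>b. global_obj P (\<Sum>i\<in>S. (w $ i) *\<^sub>R ?z i b) - F_star P"] by simp
  also have "mean (\<lambda>b. global_obj P (\<Sum>i\<in>S. (w $ i) *\<^sub>R ?z i b))
      \<le> (\<Sum>i\<in>S. w $ i * global_obj P (mean (?z i)))
        + ?L / 2 * (\<Sum>i\<in>S. (w $ i)\<^sup>2 * mean (\<lambda>b. (norm (?z i b - mean (?z i)))\<^sup>2))"
    using valid_problemD(2) w0 w1 uncorr
    by (intro mean_smooth_convex_average[OF global_obj_smooth _ global_obj_convex]) auto
  also have "\<dots> \<le> (\<Sum>i\<in>S. w $ i * (F_star P + T_map (A_coef P (\<theta> $ i)) (U_sharp P u) + ?\<rho> i))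
        + ?L / 2 * (\<Sum>i\<in>S. (w $ i)\<^sup>2 * ?\<kappa> i)"
    using valid_problemD(2) local_path_mean_gap[OF path x u err th1] local_path_variance[OF path u err]
    by (intro add_mono mult_left_mono sum_mono w0) (auto simp: algebra_simps)
  also have "(\<Sum>i\<in>S. w $ i * (F_star P + T_map (A_coef P (\<theta> $ i)) (U_sharp P u) + ?\<rho> i))
      = F_star P + (\<Sum>i\<in>S. w $ i * (U_sharp P u - mu P (variance_level P) u q i (\<theta> $ i)))"
    using w1 by (simp add: mu_def s_gain_def distrib_left sum.distrib flip: sum_distrib_right)
  also have "(\<Sum>i\<in>S. w $ i * (U_sharp P u - mu P (variance_level P) u q i (\<theta> $ i)))
      = U_sharp P u - (\<Sum>i\<in>S. w $ i * mu P (variance_level P) u q i (\<theta> $ i))"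
    using w1 by (simp add: right_diff_distrib sum_subtractf flip: sum_distrib_right)
  finally show ?thesis by (simp add: J_id_def objective_def)
qed

end

section \<open>Separable quadratic programs on the simplex\<close>

lemma polyhedron_weight_simplex: "polyhedron (weight_simplex S :: (real^'n::finite) set)"
proof -
  have "weight_simplex S
      = (\<Inter>i\<in>-S. {w. axis i 1 \<bullet> w = 0}) \<inter> (\<Inter>i\<in>S. {w. axis i 1 \<bullet> w \<ge> 0})
        \<inter> {w::real^'n. (\<Sum>i\<in>S. axis i 1) \<bullet> w = 1}"
    by (auto simp: weight_simplex_def coord_space_def inner_axis' inner_sum_left)
  also have "polyhedron \<dots>"
    by (intro polyhedron_Int polyhedron_Inter) (auto intro: polyhedron_hyperplane polyhedron_halfspace_ge)
  finally show ?thesis .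
qed

lemma weight_simplex_D:
  assumes "w \<in> weight_simplex S"
  shows "i \<notin> S \<Longrightarrow> w $ i = 0" "0 \<le> w $ i" "(\<Sum>i\<in>S. w $ i) = 1"
  using assms by (cases "i \<in> S"; auto simp: weight_simplex_def coord_space_def)+

text \<open>Minimization over the simplex of a quadratic function with linear coefficients \<open>- m i\<close> and
  positive curvatures \<open>L * k i\<close> in the coordinates in \<open>S\<close>, and none in the others.\<close>

locale separable_qp =
  fixes S :: "'n::finite set" and m k :: "'n \<Rightarrow> real" and L c :: real
  assumes S_nonempty: "S \<noteq> {}" and L_pos: "L > 0" and k_pos: "\<And>i. i \<in> S \<Longrightarrow> k i > 0"
begin

definition qp :: "real^'n \<Rightarrow> real" where
  "qp w = c - (\<Sum>i\<in>S. w $ i * m i) + L / 2 * (\<Sum>i\<in>S. (w $ i)\<^sup>2 * k i)"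

text \<open>The stationary point of the Lagrangian with multiplier \<open>lam\<close>, truncated at zero.\<close>

definition kkt :: "real \<Rightarrow> real^'n" where
  "kkt lam = (\<chi> i. if i \<in> S then max (m i - lam) 0 / (L * k i) else 0)"

lemma quadratic_qp: "quadratic_function qp"
proof -
  let ?A = "\<chi> i j. if i = j \<and> i \<in> S then L * k i else 0"
  let ?b = "\<chi> i. if i \<in> S then - m i else 0"
  have "(?A *v w) $ i = (if i \<in> S then L * k i * w $ i else 0)" for w :: "real^'n" and i
  proof -
    have "(?A *v w) $ i = (\<Sum>j\<in>UNIV. if j = i then (if i \<in> S then L * k i * w $ i else 0) else 0)"
      unfolding matrix_vector_mult_def vec_lambda_beta by (intro sum.cong) auto
    then show ?thesis by simp
  qed
  then have "qp w = (1 / 2) * (w \<bullet> (?A *v w)) + ?b \<bullet> w + c" for w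
    by (simp add: qp_def inner_vec_def if_distrib[of "\<lambda>a. _ * a"] if_distrib[of "\<lambda>a. a * _"]
        sum.If_cases sum_distrib_left sum_negf power2_eq_square mult_ac flip: sum_divide_distrib)
  moreover have "transpose ?A = ?A"
    by (auto simp: transpose_def vec_eq_iff)
  ultimately show ?thesis unfolding quadratic_function_def by blast
qed

lemma qp_strictly_convex: "strictly_convex_on (coord_space S) qp"
  unfolding strictly_convex_on_def
proof (intro conjI ballI allI impI)
  show "convex (coord_space S :: (real^'n) set)"
    unfolding convex_def coord_space_def by auto
  fix x y :: "real^'n" and u :: real
  assume xy: "x \<in> coord_space S" "y \<in> coord_space S" and u: "x \<noteq> y \<and> 0 < u \<and> u < 1"
  then obtain i where i: "x $ i \<noteq> y $ i" by (auto simp: vec_eq_iff)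
  with xy have "i \<in> S" by (metis (mono_tags, lifting) coord_space_def mem_Collect_eq)
  have "(\<Sum>i\<in>S. (((1 - u) *\<^sub>R x + u *\<^sub>R y) $ i)\<^sup>2 * k i)
      = (\<Sum>i\<in>S. (1 - u) * ((x $ i)\<^sup>2 * k i) + u * ((y $ i)\<^sup>2 * k i) - u * (1 - u) * ((x $ i - y $ i)\<^sup>2 * k i))"
    by (intro sum.cong) (auto simp: power2_eq_square algebra_simps)
  also have "\<dots> = (1 - u) * (\<Sum>i\<in>S. (x $ i)\<^sup>2 * k i) + u * (\<Sum>i\<in>S. (y $ i)\<^sup>2 * k i)
      - u * (1 - u) * (\<Sum>i\<in>S. (x $ i - y $ i)\<^sup>2 * k i)"
    by (simp add: sum.distrib sum_subtractf sum_distrib_left)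
  finally have sq: "(\<Sum>i\<in>S. (((1 - u) *\<^sub>R x + u *\<^sub>R y) $ i)\<^sup>2 * k i)
      = (1 - u) * (\<Sum>i\<in>S. (x $ i)\<^sup>2 * k i) + u * (\<Sum>i\<in>S. (y $ i)\<^sup>2 * k i)
      - u * (1 - u) * (\<Sum>i\<in>S. (x $ i - y $ i)\<^sup>2 * k i)" .
  have lin: "(\<Sum>i\<in>S. ((1 - u) *\<^sub>R x + u *\<^sub>R y) $ i * m i)
      = (1 - u) * (\<Sum>i\<in>S. x $ i * m i) + u * (\<Sum>i\<in>S. y $ i * m i)"
    by (simp add: sum.distrib sum_distrib_left distrib_right mult.assoc)
  have "0 < (\<Sum>i\<in>S. (x $ i - y $ i)\<^sup>2 * k i)"
    using i \<open>i \<in> S\<close> k_pos by (intro sum_pos2[of S i]) (auto simp: less_imp_le)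
  then have "0 < L / 2 * (u * (1 - u) * (\<Sum>i\<in>S. (x $ i - y $ i)\<^sup>2 * k i))"
    using L_pos u by simp
  moreover have "(1 - u) * qp x + u * qp y - qp ((1 - u) *\<^sub>R x + u *\<^sub>R y)
      = L / 2 * (u * (1 - u) * (\<Sum>i\<in>S. (x $ i - y $ i)\<^sup>2 * k i))"
    unfolding qp_def sq lin by (simp add: field_simps)
  ultimately show "qp ((1 - u) *\<^sub>R x + u *\<^sub>R y) < (1 - u) * qp x + u * qp y"
    by linarith
qed

lemma kkt_sum: "(\<Sum>i\<in>S. kkt lam $ i) = (\<Sum>i\<in>S. max (m i - lam) 0 / (L * k i))"
  by (simp add: kkt_def)

lemma kkt_nonneg: "i \<in> S \<Longrightarrow> 0 \<le> kkt lam $ i"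
  using L_pos k_pos[of i] by (simp add: kkt_def)

lemma kkt_antimono: "lam \<le> lam' \<Longrightarrow> i \<in> S \<Longrightarrow> kkt lam' $ i \<le> kkt lam $ i"
  using L_pos k_pos[of i] by (auto simp: kkt_def intro!: divide_right_mono)

lemma ex1_multiplier: "\<exists>!lam. (\<Sum>i\<in>S. kkt lam $ i) = 1"
proof (rule ex_ex1I)
  let ?s = "\<lambda>lam. \<Sum>i\<in>S. kkt lam $ i"
  obtain j where j: "j \<in> S" using S_nonempty by blast
  let ?hi = "Max (m ` S)" and ?lo = "m j - L * k j"
  \<comment> \<open>At \<open>?hi\<close> all weights vanish, while at \<open>?lo\<close> already the weight of \<open>j\<close> is one.\<close>
  have "?s ?hi = 0"
    by (simp add: kkt_sum max_def)
  have "kkt ?lo $ j = 1" using j k_pos[of j] L_pos by (simp add: kkt_def)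
  then have "1 \<le> ?s ?lo"
    using member_le_sum[of j S "\<lambda>i. kkt ?lo $ i"] j kkt_nonneg by simp
  moreover have "?lo \<le> ?hi"
  proof -
    have "m j \<le> ?hi" using j by simp
    moreover have "0 < L * k j" using L_pos k_pos[OF j] by simp
    ultimately show ?thesis by linarith
  qed
  moreover have "continuous_on {?lo..?hi} ?s"
    unfolding kkt_sum using L_pos k_pos by (intro continuous_intros) force
  ultimately show "\<exists>lam. ?s lam = 1"
    using IVT2'[of ?s ?hi 1 ?lo] \<open>?s ?hi = 0\<close> by auto
next
  fix lam lam' assume eq: "(\<Sum>i\<in>S. kkt lam $ i) = 1" "(\<Sum>i\<in>S. kkt lam' $ i) = 1"
  have "\<not> a < b" if ab: "(\<Sum>i\<in>S. kkt a $ i) = 1" "(\<Sum>i\<in>S. kkt b $ i) = 1" for a b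
  proof
    assume "a < b"
    \<comment> \<open>The total is strictly decreasing wherever it is positive.\<close>
    have "\<exists>i\<in>S. kkt b $ i > 0"
      using ab(2) sum_nonpos[of S "\<lambda>i. kkt b $ i"] by (force simp: not_less)
    then obtain i where i: "i \<in> S" "kkt b $ i > 0" by blast
    then have "kkt b $ i < kkt a $ i"
      using \<open>a < b\<close> L_pos k_pos[of i] by (auto simp: kkt_def max_def divide_strict_right_mono split: if_splits)
    then have "(\<Sum>i\<in>S. kkt b $ i) < (\<Sum>i\<in>S. kkt a $ i)"
      using i(1) kkt_antimono \<open>a < b\<close> by (intro sum_strict_mono_ex1) (auto simp: less_imp_le)
    then show False using ab by simp
  qed
  from this[OF eq] this[OF eq(2,1)] show "lam = lam'" by simp
qed

text \<open>The first-order term at the KKT point is nonnegative towards each point of the simplex, by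
  complementary slackness; what remains is the quadratic term.\<close>

lemma qp_growth:
  assumes lam: "(\<Sum>i\<in>S. kkt lam $ i) = 1" and w: "w \<in> weight_simplex S"
  shows "qp (kkt lam) + L / 2 * (\<Sum>i\<in>S. (w $ i - kkt lam $ i)\<^sup>2 * k i) \<le> qp w"
proof -
  let ?v = "kkt lam"
  have "qp w - qp ?v - L / 2 * (\<Sum>i\<in>S. (w $ i - ?v $ i)\<^sup>2 * k i)
      = (\<Sum>i\<in>S. - (w $ i * m i) + ?v $ i * m i + L / 2 * ((w $ i)\<^sup>2 * k i) - L / 2 * ((?v $ i)\<^sup>2 * k i)
          - L / 2 * ((w $ i - ?v $ i)\<^sup>2 * k i))"
    unfolding qp_def by (simp add: sum.distrib sum_subtractf sum_negf sum_distrib_left)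
  also have "\<dots> = (\<Sum>i\<in>S. (L * k i * ?v $ i - m i) * (w $ i - ?v $ i))"
    by (intro sum.cong) (auto simp: power2_eq_square field_simps)
  also have "\<dots> = (\<Sum>i\<in>S. (L * k i * ?v $ i - m i) * (w $ i - ?v $ i))
      + lam * ((\<Sum>i\<in>S. w $ i) - (\<Sum>i\<in>S. ?v $ i))"
    using weight_simplex_D(3)[OF w] lam by simp
  also have "\<dots> = (\<Sum>i\<in>S. (L * k i * ?v $ i - m i + lam) * (w $ i - ?v $ i))"
    by (simp add: sum_distrib_left distrib_right sum.distrib right_diff_distrib sum_subtractf)
  also have "0 \<le> \<dots>"
  proof (rule sum_nonneg)
    fix i assume i: "i \<in> S"
    show "0 \<le> (L * k i * ?v $ i - m i + lam) * (w $ i - ?v $ i)"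
    proof (cases "m i \<le> lam")
      case True
      then show ?thesis using i weight_simplex_D(2)[OF w, of i] by (simp add: kkt_def)
    next
      case False
      then have "L * k i * ?v $ i - m i + lam = 0" using i L_pos k_pos[of i] by (simp add: kkt_def)
      then show ?thesis by simp
    qed
  qed
  finally show ?thesis by simp
qed

lemma is_arg_min_iff_kkt:
  assumes lam: "(\<Sum>i\<in>S. kkt lam $ i) = 1"
  shows "is_arg_min qp (\<lambda>w. w \<in> weight_simplex S) w \<longleftrightarrow> w = kkt lam"
proof -
  have sq: "0 \<le> (\<Sum>i\<in>S. (w $ i - kkt lam $ i)\<^sup>2 * k i)" for w
    using k_pos by (auto intro!: sum_nonneg simp: less_imp_le)
  have kkt: "kkt lam \<in> weight_simplex S"
    using lam kkt_nonneg by (auto simp: weight_simplex_def coord_space_def kkt_def)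
  have le: "qp (kkt lam) \<le> qp w" if "w \<in> weight_simplex S" for w
    using qp_growth[OF lam that] sq[of w] L_pos by (smt (verit) mult_nonneg_nonneg divide_nonneg_nonneg)
  have eq: "w = kkt lam" if w: "w \<in> weight_simplex S" "qp w \<le> qp (kkt lam)" for w
  proof -
    have "L / 2 * (\<Sum>i\<in>S. (w $ i - kkt lam $ i)\<^sup>2 * k i) \<le> 0"
      using qp_growth[OF lam w(1)] w(2) by linarith
    then have "(\<Sum>i\<in>S. (w $ i - kkt lam $ i)\<^sup>2 * k i) = 0"
      using sq[of w] L_pos by (simp add: mult_le_0_iff)
    then have "\<forall>i\<in>S. (w $ i - kkt lam $ i)\<^sup>2 * k i = 0"
      using k_pos by (subst (asm) sum_nonneg_eq_0_iff) (auto simp: less_imp_le)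
    then have "\<forall>i\<in>S. w $ i = kkt lam $ i" using k_pos by fastforce
    then show ?thesis
      using weight_simplex_D(1)[OF w(1)] weight_simplex_D(1)[OF kkt] by (metis vec_eq_iff)
  qed
  show ?thesis
    unfolding is_arg_min_def using kkt le eq by (metis not_less)
qed

end

section \<open>The histories and the adaptedness of the iterates\<close>

lemma borel_measurable_component:
  fixes f :: "'a \<Rightarrow> real^'k"
  assumes "f \<in> borel_measurable N"
  shows "(\<lambda>\<omega>. f \<omega> $ j) \<in> borel_measurable N"
proof -
  have "(\<lambda>v :: real^'k. v $ j) \<in> borel_measurable borel"
    by (intro borel_measurable_continuous_onI continuous_intros)
  then show ?thesis by (rule measurable_compose[OF assms])
qed

lemma local_steps_cong:
  "(\<And>k. k < l \<Longrightarrow> Bs k = Bs' k) \<Longrightarrow> local_steps P i \<eta> Bs ci c x l = local_steps P i \<eta> Bs' ci c x l"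
  by (induction l) auto

lemma iterate_Suc:
  "iterate P A (Suc t) \<omega> = iterate P A t \<omega>
    + (\<Sum>i\<in>active A t \<omega>. (weights A t \<omega> $ i) *\<^sub>R (local_iterate P A i t (horizon P i) \<omega> - iterate P A t \<omega>))"
  by (simp add: iterate_def local_iterate_def node_control_def server_control_def Let_def split: prod.split)

lemma node_control_Suc:
  "node_control P A i (Suc t) \<omega> =
    (if i \<in> active A t \<omega>
     then node_control P A i t \<omega> - server_control P A t \<omega>
       + (1 / (real (horizon P i) * step_size P i (amplitudes A t \<omega> $ i))) *\<^sub>R
           (iterate P A t \<omega> - local_iterate P A i t (horizon P i) \<omega>)
     else node_control P A i t \<omega>)"
  by (simp add: iterate_def local_iterate_def node_control_def server_control_def Let_def split: prod.split)

lemma server_control_Suc: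
  "server_control P A (Suc t) \<omega> = server_control P A t \<omega>
    + (1 / real CARD('n)) *\<^sub>R (\<Sum>i\<in>active A t \<omega>. node_control P A i (Suc t) \<omega> - node_control P A i t \<omega>)"
  for P :: "('n::finite, 'd::finite) problem"
  by (simp add: node_control_def server_control_def Let_def split: prod.split)

text \<open>The server control is always the average of the node controls.\<close>

lemma server_control_eq_average:
  "server_control P A t \<omega> = (1 / real CARD('n)) *\<^sub>R (\<Sum>i\<in>UNIV. node_control P A i t \<omega>)"
  for P :: "('n::finite, 'd::finite) problem"
proof (induction t)
  case 0
  then show ?case by (simp add: server_control_def node_control_def)
next
  case (Suc t)
  have "(\<Sum>i\<in>active A t \<omega>. node_control P A i (Suc t) \<omega> - node_control P A i t \<omega>)
      = (\<Sum>i\<in>UNIV. node_control P A i (Suc t) \<omega> - node_control P A i t \<omega>)"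
    by (rule sum.mono_neutral_left) (auto simp: node_control_Suc)
  then show ?case
    unfolding server_control_Suc by (simp add: Suc sum_subtractf scaleR_diff_right)
qed

text \<open>A run of the algorithm on a problem that satisfies the standing assumptions.\<close>

locale hew_run =
  fixes M :: "'a measure" and P :: "('n::finite, 'd::finite) problem" and A :: "('a, 'n, 'd) run"
  assumes problem: "valid_problem P" and run: "valid_run M P A"

sublocale hew_run \<subseteq> prob_space M
  using run by (simp add: valid_run_def)

context hew_run
begin

lemmas problemD = valid_problemD[OF problem]

lemma init_measurable:
  "init_x A \<in> borel_measurable M" "init_control A i \<in> borel_measurable M"
  using run by (simp_all add: valid_run_def)

lemma batch_measurable: "l < horizon P i \<Longrightarrow> batch A i t l \<in> measurable M (count_space UNIV)"
  using run by (simp add: valid_run_def)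

lemma active_measurable: "active A t \<in> measurable (history M P A t) (count_space UNIV)"
  using run by (simp add: valid_run_def)

lemma weights_measurable: "weights A t \<in> borel_measurable (history M P A t)"
  using run by (simp add: valid_run_def)

lemma amplitudes_measurable: "amplitudes A t \<in> borel_measurable (history M P A t)"
  using run by (simp add: valid_run_def)

lemma active_nonempty: "\<omega> \<in> space M \<Longrightarrow> active A t \<omega> \<noteq> {}"
  using run by (simp add: valid_run_def)

lemma weights_in_simplex: "\<omega> \<in> space M \<Longrightarrow> weights A t \<omega> \<in> weight_simplex (active A t \<omega>)"
  using run by (simp add: valid_run_def)

lemma amplitudes_in_box: "\<omega> \<in> space M \<Longrightarrow> amplitudes A t \<omega> \<in> amplitude_box P (active A t \<omega>)"
  using run by (simp add: valid_run_def)

lemma batch_subset: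
  assumes "\<omega> \<in> space M" "l < horizon P i"
  shows "batch A i t l \<omega> \<subseteq> {1..samples P i}"
  using run assms unfolding valid_run_def by (metis empty_subsetI)

lemma AE_in_ball:
  "AE \<omega> in M. \<forall>t. iterate P A t \<omega> \<in> cball (x_star P) (radius P) \<and>
     (\<forall>i\<in>active A t \<omega>. \<forall>l\<le>horizon P i. local_iterate P A i t l \<omega> \<in> cball (x_star P) (radius P))"
  using run by (simp add: valid_run_def)

lemma AE_unbiased:
  assumes "l < horizon P i"
  shows "AE \<omega> in M. i \<in> active A t \<omega> \<longrightarrow>
    vec_cond_exp M (local_history M P A i t l) (grad_estimate P A i t l) \<omega>
      = gradient (local_obj P i) (local_iterate P A i t l \<omega>)"
  using run assms unfolding valid_run_def by blast

lemma AE_variance: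
  assumes "l < horizon P i"
  shows "AE \<omega> in M. i \<in> active A t \<omega> \<longrightarrow>
    real_cond_exp M (local_history M P A i t l)
      (\<lambda>\<omega>'. (norm (grad_estimate P A i t l \<omega>' - gradient (local_obj P i) (local_iterate P A i t l \<omega>')))\<^sup>2) \<omega>
      \<le> variance_level P i / real (batch_size P i)"
  using run assms unfolding valid_run_def by blast

lemma AE_cond_indep:
  assumes "l < horizon P i"
  shows "AE \<omega> in M. i \<in> active A t \<omega> \<longrightarrow> batches_cond_indep_at M (local_history M P A i t l) P A t C \<omega>"
  using run assms unfolding valid_run_def by blast

text \<open>The generators of the histories; \<open>local_gens\<close> below does the same for the local histories.\<close>

definition history_gens :: "nat \<Rightarrow> 'a set set" where
  "history_gens t = {init_x A -` E \<inter> space M | E. E \<in> sets borel} \<union>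
      {init_control A i -` E \<inter> space M | i E. E \<in> sets borel} \<union>
      {batch A i r l -` C \<inter> space M | i r l C. r < t \<and> l < horizon P i}"

lemma history_eq: "history M P A t = sigma (space M) (history_gens t)"
  by (simp add: history_def history_gens_def)

lemma history_gens_subset: "history_gens t \<subseteq> sets M"
  unfolding history_gens_def
  by (intro Un_least subsetI; clarsimp)
     (auto intro: measurable_sets[OF init_measurable(1)] measurable_sets[OF init_measurable(2)]
       measurable_sets[OF batch_measurable])

lemma sets_history: "sets (history M P A t) = sigma_sets (space M) (history_gens t)"
  unfolding history_eq using history_gens_subset sets.space_closed
  by (intro sets_measure_of) blast

lemma space_history [simp]: "space (history M P A t) = space M"
  unfolding history_eq by (rule space_measure_of_conv)

lemma sets_history_subset: "sets (history M P A t) \<subseteq> sets M"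
  unfolding sets_history by (rule sets.sigma_sets_subset[OF history_gens_subset])

lemma history_subalgebra: "subalgebra M (history M P A t)"
  by (simp add: subalgebra_def sets_history_subset)

lemma history_mono: "s \<le> t \<Longrightarrow> sets (history M P A s) \<subseteq> sets (history M P A t)"
  unfolding sets_history
proof (rule sigma_sets_mono')
  assume "s \<le> t"
  then have "{batch A i r l -` C \<inter> space M | i r l C. r < s \<and> l < horizon P i}
      \<subseteq> {batch A i r l -` C \<inter> space M | i r l C. r < t \<and> l < horizon P i}"
    by (intro Collect_mono) (blast intro: less_le_trans)
  then show "history_gens s \<subseteq> history_gens t"
    unfolding history_gens_def by (intro Un_mono order_refl)
qed

lemma measurable_history_mono:
  assumes "f \<in> measurable (history M P A s) N" "s \<le> t"
  shows "f \<in> measurable (history M P A t) N"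
  using assms history_mono[OF assms(2)] unfolding measurable_def by auto

lemma measurable_from_history: "f \<in> measurable (history M P A t) N \<Longrightarrow> f \<in> measurable M N"
  by (rule measurable_from_subalg[OF history_subalgebra])

lemma history_gensI: "X \<in> history_gens t \<Longrightarrow> X \<in> sets (history M P A t)"
  by (simp add: sets_history)

lemma init_x_history: "init_x A \<in> borel_measurable (history M P A t)"
  by (rule measurableI) (auto intro!: history_gensI simp: history_gens_def)

lemma init_control_history: "init_control A i \<in> borel_measurable (history M P A t)"
proof (rule measurableI)
  fix E :: "(real^'d) set"
  assume "E \<in> sets borel"
  then show "init_control A i -` E \<inter> space (history M P A t) \<in> sets (history M P A t)"
    unfolding space_history by (intro history_gensI) (unfold history_gens_def, blast)
qed simp

lemma batch_history:
  "r < t \<Longrightarrow> l < horizon P i \<Longrightarrow> batch A i r l \<in> measurable (history M P A t) (count_space UNIV)"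
proof (rule measurableI)
  fix C assume "r < t" "l < horizon P i"
  then show "batch A i r l -` C \<inter> space (history M P A t) \<in> sets (history M P A t)"
    unfolding space_history by (intro history_gensI) (unfold history_gens_def, blast)
qed simp

definition local_gens :: "'n \<Rightarrow> nat \<Rightarrow> nat \<Rightarrow> 'a set set" where
  "local_gens i t l = sets (history M P A t) \<union> {batch A i t k -` C \<inter> space M | k C. k < l}"

lemma local_history_eq: "local_history M P A i t l = sigma (space M) (local_gens i t l)"
  by (simp add: local_history_def local_gens_def)

lemma local_gens_subset: "l \<le> horizon P i \<Longrightarrow> local_gens i t l \<subseteq> sets M"
  unfolding local_gens_def
  using sets_history_subset by (auto intro: measurable_sets[OF batch_measurable])

lemma sets_local_history:
  assumes "l \<le> horizon P i"
  shows "sets (local_history M P A i t l) = sigma_sets (space M) (local_gens i t l)"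
  unfolding local_history_eq using local_gens_subset[OF assms] sets.space_closed
  by (intro sets_measure_of) blast

lemma space_local_history [simp]: "space (local_history M P A i t l) = space M"
  unfolding local_history_eq by (rule space_measure_of_conv)

lemma local_history_subalgebra: "l \<le> horizon P i \<Longrightarrow> subalgebra M (local_history M P A i t l)"
  by (simp add: subalgebra_def sets_local_history sets.sigma_sets_subset[OF local_gens_subset])

lemma history_subalgebra_local:
  "l \<le> horizon P i \<Longrightarrow> subalgebra (local_history M P A i t l) (history M P A t)"
  by (auto simp: subalgebra_def sets_local_history local_gens_def)

lemma batch_local_history:
  assumes "k < l" "l \<le> horizon P i"
  shows "batch A i t k \<in> measurable (local_history M P A i t l) (count_space UNIV)"
  using assms by (intro measurableI) (auto simp: sets_local_history local_gens_def)

lemma measurable_history_local: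
  "f \<in> measurable (history M P A t) N \<Longrightarrow> l \<le> horizon P i \<Longrightarrow> f \<in> measurable (local_history M P A i t l) N"
  by (rule measurable_from_subalg[OF history_subalgebra_local])

text \<open>Before the first local step nothing has been added to the history, so that assumptions stated for
  local histories cover the history itself.\<close>

lemma local_history_0: "local_history M P A i t 0 = history M P A t"
proof (rule measure_eqI)
  show "sets (local_history M P A i t 0) = sets (history M P A t)"
    using sets.sigma_sets_eq[of "history M P A t"]
    by (simp add: sets_local_history local_gens_def)
qed (simp add: local_history_eq history_eq emeasure_sigma)

lemma sigma_finite_history: "sigma_finite_subalgebra M (history M P A t)"
  by (intro finite_measure_subalgebra_is_sigma_finite)
     (simp add: finite_measure_subalgebra_def finite_measure_subalgebra_axioms_def
        history_subalgebra finite_measure_axioms)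

lemma sigma_finite_local_history:
  "l \<le> horizon P i \<Longrightarrow> sigma_finite_subalgebra M (local_history M P A i t l)"
  by (intro finite_measure_subalgebra_is_sigma_finite)
     (simp add: finite_measure_subalgebra_def finite_measure_subalgebra_axioms_def
        local_history_subalgebra finite_measure_axioms)

lemma gradient_local_obj_measurable:
  assumes [measurable]: "y \<in> borel_measurable N"
  shows "(\<lambda>\<omega>. gradient (local_obj P i) (y \<omega>)) \<in> borel_measurable N"
  using L_smooth_gradient_measurable[OF local_obj_smooth[OF problem]] problemD(2)
  by (intro measurable_compose[OF assms]) (simp add: less_imp_le)

lemma continuous_on_gradient_local_obj: "continuous_on X (gradient (local_obj P i))"
  using L_smooth_continuous_on_gradient[OF local_obj_smooth[OF problem]] problemD(2)
  by (simp add: less_imp_le)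

lemma continuous_on_stoch_grad:
  assumes "B \<subseteq> {1..samples P i}"
  shows "continuous_on X (stoch_grad P i B)"
  unfolding stoch_grad_def using assms problemD(2)
  by (intro continuous_intros L_smooth_continuous_on_gradient[OF problemD(9)])
     (auto simp: less_imp_le)

lemma stoch_grad_measurable:
  assumes B: "B \<in> measurable N (count_space UNIV)"
    and sub: "\<And>\<omega>. \<omega> \<in> space N \<Longrightarrow> B \<omega> \<subseteq> {1..samples P i}"
    and y: "y \<in> borel_measurable N"
  shows "(\<lambda>\<omega>. stoch_grad P i (B \<omega>) (y \<omega>)) \<in> borel_measurable N"
proof -
  have [measurable]: "Measurable.pred N (\<lambda>\<omega>. j \<in> B \<omega>)" for j
    by (rule measurable_compose[OF B]) simp
  have grad: "(\<lambda>\<omega>. gradient (phi P i j) (y \<omega>)) \<in> borel_measurable N" if "j \<in> {1..samples P i}" for j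
    using L_smooth_gradient_measurable[OF problemD(9)[OF that]] problemD(2)
    by (intro measurable_compose[OF y]) (simp add: less_imp_le)
  have "(\<lambda>\<omega>. (1 / real (batch_size P i)) *\<^sub>R
      (\<Sum>j\<in>{1..samples P i}. if j \<in> B \<omega> then gradient (phi P i j) (y \<omega>) else 0)) \<in> borel_measurable N"
    by (intro borel_measurable_scaleR borel_measurable_const borel_measurable_sum measurable_If grad) auto
  moreover have "(\<Sum>j\<in>{1..samples P i}. if j \<in> B \<omega> then gradient (phi P i j) (y \<omega>) else 0)
      = (\<Sum>j\<in>B \<omega>. gradient (phi P i j) (y \<omega>))" if "\<omega> \<in> space N" for \<omega>
    using sub[OF that] by (intro sum.mono_neutral_cong_right) auto
  ultimately show ?thesis
    unfolding stoch_grad_def by (subst measurable_cong) auto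
qed

lemma local_steps_measurable:
  assumes "\<And>k. k < l \<Longrightarrow> Bs k \<in> measurable N (count_space UNIV)"
    and "\<And>k \<omega>. k < l \<Longrightarrow> \<omega> \<in> space N \<Longrightarrow> Bs k \<omega> \<subseteq> {1..samples P i}"
    and [measurable]: "\<eta> \<in> borel_measurable N" "ci \<in> borel_measurable N" "c \<in> borel_measurable N"
      "x \<in> borel_measurable N"
  shows "(\<lambda>\<omega>. local_steps P i (\<eta> \<omega>) (\<lambda>k. Bs k \<omega>) (ci \<omega>) (c \<omega>) (x \<omega>) l) \<in> borel_measurable N"
  using assms(1,2)
proof (induction l)
  case 0
  then show ?case by simp
next
  case (Suc l)
  then have y [measurable]:
    "(\<lambda>\<omega>. local_steps P i (\<eta> \<omega>) (\<lambda>k. Bs k \<omega>) (ci \<omega>) (c \<omega>) (x \<omega>) l) \<in> borel_measurable N"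
    by simp
  have [measurable]: "(\<lambda>\<omega>. stoch_grad P i (Bs l \<omega>)
      (local_steps P i (\<eta> \<omega>) (\<lambda>k. Bs k \<omega>) (ci \<omega>) (c \<omega>) (x \<omega>) l)) \<in> borel_measurable N"
    using Suc.prems by (intro stoch_grad_measurable y) auto
  show ?case by simp
qed

lemma step_size_measurable:
  assumes "\<theta> \<in> borel_measurable N"
  shows "(\<lambda>\<omega>. step_size P i (\<theta> \<omega> $ i)) \<in> borel_measurable N"
  unfolding step_size_def
  by (intro borel_measurable_divide borel_measurable_const borel_measurable_component assms)

lemma weights_component_measurable:
  "(\<lambda>\<omega>. weights A t \<omega> $ i) \<in> borel_measurable (history M P A t)"
  by (rule borel_measurable_component[OF weights_measurable])

lemma active_pred: "Measurable.pred (history M P A t) (\<lambda>\<omega>. i \<in> active A t \<omega>)"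
  by (rule measurable_compose[OF active_measurable]) simp

lemma local_iterate_measurable:
  assumes N: "space N = space M" "sets (history M P A t) \<subseteq> sets N"
    and batch: "\<And>k. k < l \<Longrightarrow> batch A i t k \<in> measurable N (count_space UNIV)" and l: "l \<le> horizon P i"
    and state: "iterate P A t \<in> borel_measurable (history M P A t)"
      "node_control P A i t \<in> borel_measurable (history M P A t)"
      "server_control P A t \<in> borel_measurable (history M P A t)"
  shows "local_iterate P A i t l \<in> borel_measurable N"
proof -
  have sub: "f \<in> borel_measurable (history M P A t) \<Longrightarrow> f \<in> borel_measurable N" for f :: "'a \<Rightarrow> 'z::topological_space"
    using N by (auto simp: measurable_def)
  show ?thesis
    unfolding local_iterate_def[abs_def] using l N
    by (intro local_steps_measurable batch sub[OF state(1)] sub[OF state(2)] sub[OF state(3)]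
        sub[OF step_size_measurable[OF amplitudes_measurable]])
       (auto dest!: batch_subset)
qed

text \<open>The state before round \<open>t\<close> is determined by the history.\<close>

lemma state_measurable:
  "iterate P A t \<in> borel_measurable (history M P A t) \<and>
   (\<forall>i. node_control P A i t \<in> borel_measurable (history M P A t)) \<and>
   server_control P A t \<in> borel_measurable (history M P A t)"
proof (induction t)
  case 0
  have "iterate P A 0 = init_x A" "node_control P A i 0 = init_control A i" for i
    by (auto simp: iterate_def node_control_def)
  then show ?case
    unfolding server_control_eq_average[abs_def] using init_x_history init_control_history by auto
next
  case (Suc t)
  let ?F = "history M P A (Suc t)"
  note up = measurable_history_mono[OF _ le_SucI[OF order_refl]]
  have [measurable]: "iterate P A t \<in> borel_measurable ?F"
    "\<And>i. node_control P A i t \<in> borel_measurable ?F" "server_control P A t \<in> borel_measurable ?F"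
    using Suc by (auto intro: up)
  have [measurable]: "\<And>i. Measurable.pred ?F (\<lambda>\<omega>. i \<in> active A t \<omega>)"
    "\<And>i. (\<lambda>\<omega>. weights A t \<omega> $ i) \<in> borel_measurable ?F"
    "\<And>i. (\<lambda>\<omega>. step_size P i (amplitudes A t \<omega> $ i)) \<in> borel_measurable ?F"
    by (intro up active_pred weights_component_measurable step_size_measurable amplitudes_measurable)+
  have [measurable]: "local_iterate P A i t (horizon P i) \<in> borel_measurable ?F" for i
    using Suc by (intro local_iterate_measurable) (auto simp: history_mono batch_history)
  have node [measurable]: "node_control P A i (Suc t) \<in> borel_measurable ?F" for i
    unfolding node_control_Suc[abs_def] by measurable
  have "(\<lambda>\<omega>. iterate P A t \<omega> + (\<Sum>i\<in>UNIV. if i \<in> active A t \<omega>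
      then (weights A t \<omega> $ i) *\<^sub>R (local_iterate P A i t (horizon P i) \<omega> - iterate P A t \<omega>) else 0))
    \<in> borel_measurable ?F"
    by measurable
  then have "iterate P A (Suc t) \<in> borel_measurable ?F"
    unfolding iterate_Suc[abs_def] by (simp add: sum.If_cases)
  moreover have "server_control P A (Suc t) \<in> borel_measurable ?F"
    unfolding server_control_eq_average[abs_def] by measurable
  ultimately show ?case using node by blast
qed

lemmas iterate_measurable = state_measurable[THEN conjunct1]
lemmas node_control_measurable = state_measurable[THEN conjunct2, THEN conjunct1, rule_format]
lemmas server_control_measurable = state_measurable[THEN conjunct2, THEN conjunct2]

lemma local_iterate_local_history:
  "l \<le> horizon P i \<Longrightarrow> local_iterate P A i t l \<in> borel_measurable (local_history M P A i t l)"
  using history_subalgebra_local[of l i t]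
  by (intro local_iterate_measurable batch_local_history iterate_measurable node_control_measurable
      server_control_measurable) (auto simp: subalgebra_def)

lemma local_iterate_M: "l \<le> horizon P i \<Longrightarrow> local_iterate P A i t l \<in> borel_measurable M"
  by (rule measurable_from_subalg[OF local_history_subalgebra local_iterate_local_history])

lemma grad_estimate_local_history:
  assumes "k < l" "l \<le> horizon P i"
  shows "grad_estimate P A i t k \<in> borel_measurable (local_history M P A i t l)"
proof -
  have "local_iterate P A i t k \<in> borel_measurable (local_history M P A i t l)"
    using history_subalgebra_local[of l i t] assms
    by (intro local_iterate_measurable batch_local_history iterate_measurable node_control_measurable
        server_control_measurable) (auto simp: subalgebra_def)
  then show ?thesis
    unfolding grad_estimate_def[abs_def] using assms
    by (intro stoch_grad_measurable batch_local_history) (auto dest!: batch_subset)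
qed

lemma grad_estimate_M: "l < horizon P i \<Longrightarrow> grad_estimate P A i t l \<in> borel_measurable M"
  by (rule measurable_from_subalg[OF local_history_subalgebra[OF order_refl] grad_estimate_local_history]) auto

end

section \<open>Conditioning on the minibatches of a round\<close>

text \<open>If a random element takes finitely many values, then conditioning a function of it and of
  \<open>F\<close>-measurable data averages over the conditional probabilities of the values.\<close>

lemma (in sigma_finite_subalgebra) real_cond_exp_finite_valued:
  fixes X :: "'a \<Rightarrow> 'b" and h :: "'b \<Rightarrow> 'a \<Rightarrow> real"
  assumes C: "finite C" "\<And>\<omega>. \<omega> \<in> space M \<Longrightarrow> X \<omega> \<in> C"
    and X: "\<And>b. b \<in> C \<Longrightarrow> {\<omega> \<in> space M. X \<omega> = b} \<in> sets M"
    and h: "\<And>b. b \<in> C \<Longrightarrow> h b \<in> borel_measurable F"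
    and int: "integrable M (\<lambda>\<omega>. h (X \<omega>) \<omega>)"
  shows "AE \<omega> in M. real_cond_exp M F (\<lambda>\<omega>. h (X \<omega>) \<omega>) \<omega>
    = (\<Sum>b\<in>C. real_cond_exp M F (indicator {\<omega> \<in> space M. X \<omega> = b}) \<omega> * h b \<omega>)"
proof -
  define D where "D b = {\<omega> \<in> space M. X \<omega> = b}" for b
  define f where "f b \<omega> = (if b \<in> C then h b \<omega> * indicator (D b) \<omega> else 0)" for b \<omega>
  have D: "D b \<in> sets M" if "b \<in> C" for b using X[OF that] by (simp add: D_def)
  have f_int: "integrable M (f b)" for b
  proof (cases "b \<in> C")
    case True
    have "integrable M (\<lambda>\<omega>. indicator (D b) \<omega> *\<^sub>R h (X \<omega>) \<omega>)"
      by (rule integrable_mult_indicator[OF D[OF True] int])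
    moreover have "indicator (D b) \<omega> *\<^sub>R h (X \<omega>) \<omega> = f b \<omega>" for \<omega>
      using True by (simp add: f_def D_def indicator_def)
    ultimately show ?thesis by (simp add: fun_eq_iff[symmetric])
  next
    case False
    then have "f b = (\<lambda>_. 0)" by (simp add: f_def fun_eq_iff)
    then show ?thesis by simp
  qed
  have eq: "h (X \<omega>) \<omega> = (\<Sum>b\<in>C. f b \<omega>)" if "\<omega> \<in> space M" for \<omega>
  proof -
    have "(\<Sum>b\<in>C. f b \<omega>) = (\<Sum>b\<in>C. if X \<omega> = b then h b \<omega> else 0)"
      using that by (intro sum.cong) (auto simp: f_def D_def)
    then show ?thesis using C that by simp
  qed
  have "AE \<omega> in M. real_cond_exp M F (\<lambda>\<omega>. h (X \<omega>) \<omega>) \<omega> = real_cond_exp M F (\<lambda>\<omega>. \<Sum>b\<in>C. f b \<omega>) \<omega>"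
    using int f_int eq by (intro real_cond_exp_cong AE_I2) auto
  moreover have "AE \<omega> in M. real_cond_exp M F (\<lambda>\<omega>. \<Sum>b\<in>C. f b \<omega>) \<omega> = (\<Sum>b\<in>C. real_cond_exp M F (f b) \<omega>)"
    by (rule real_cond_exp_sum[OF f_int])
  moreover have "AE \<omega> in M. \<forall>b\<in>C. real_cond_exp M F (f b) \<omega> = h b \<omega> * real_cond_exp M F (indicator (D b)) \<omega>"
  proof (rule AE_finite_allI[OF C(1)])
    fix b assume b: "b \<in> C"
    then have f: "f b = (\<lambda>\<omega>. h b \<omega> * indicator (D b) \<omega>)" by (simp add: f_def fun_eq_iff)
    have "integrable M (\<lambda>\<omega>. h b \<omega> * indicator (D b) \<omega>)" using f_int[of b] by (simp add: f)
    then show "AE \<omega> in M. real_cond_exp M F (f b) \<omega> = h b \<omega> * real_cond_exp M F (indicator (D b)) \<omega>"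
      unfolding f using D[OF b] by (intro real_cond_exp_mult h b) auto
  qed
  ultimately show ?thesis
    by eventually_elim (simp add: D_def mult.commute)
qed

text \<open>Functions that agree on an \<open>F\<close>-measurable event have conditional expectations that agree there.\<close>

lemma (in sigma_finite_subalgebra) real_cond_exp_local:
  assumes T: "Measurable.pred F T" and f: "f \<in> borel_measurable M" "g \<in> borel_measurable M"
    and int: "integrable M (\<lambda>\<omega>. of_bool (T \<omega>) * f \<omega>)"
    and eq: "\<And>\<omega>. \<omega> \<in> space M \<Longrightarrow> T \<omega> \<Longrightarrow> f \<omega> = g \<omega>"
  shows "AE \<omega> in M. T \<omega> \<longrightarrow> real_cond_exp M F f \<omega> = real_cond_exp M F g \<omega>"
proof -
  have T_F: "(\<lambda>\<omega>. of_bool (T \<omega>) :: real) \<in> borel_measurable F" using T by measurable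
  have cong: "of_bool (T \<omega>) * f \<omega> = of_bool (T \<omega>) * g \<omega>" if "\<omega> \<in> space M" for \<omega>
    using eq[OF that] by simp
  have int': "integrable M (\<lambda>\<omega>. of_bool (T \<omega>) * g \<omega>)"
    using int cong by (simp cong: Bochner_Integration.integrable_cong)
  have "AE \<omega> in M. real_cond_exp M F (\<lambda>\<omega>. of_bool (T \<omega>) * f \<omega>) \<omega> = of_bool (T \<omega>) * real_cond_exp M F f \<omega>"
    by (rule real_cond_exp_mult[OF T_F f(1) int])
  moreover have "AE \<omega> in M. real_cond_exp M F (\<lambda>\<omega>. of_bool (T \<omega>) * g \<omega>) \<omega> = of_bool (T \<omega>) * real_cond_exp M F g \<omega>"
    by (rule real_cond_exp_mult[OF T_F f(2) int'])
  moreover have "AE \<omega> in M. real_cond_exp M F (\<lambda>\<omega>. of_bool (T \<omega>) * f \<omega>) \<omega>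
      = real_cond_exp M F (\<lambda>\<omega>. of_bool (T \<omega>) * g \<omega>) \<omega>"
    using int int' cong by (intro real_cond_exp_cong AE_I2) auto
  ultimately show ?thesis by eventually_elim auto
qed

text \<open>Minibatch sequences of one node, and of all nodes, in one round; past the horizon a sequence is
  empty.\<close>

definition node_configs :: "('n::finite, 'd::finite) problem \<Rightarrow> 'n \<Rightarrow> (nat \<Rightarrow> nat set) set" where
  "node_configs P i = {a. \<forall>l. (l \<in> {..<horizon P i} \<longrightarrow> a l \<in> Pow {1..samples P i}) \<and>
     (l \<notin> {..<horizon P i} \<longrightarrow> a l = {})}"

definition round_configs :: "('n::finite, 'd::finite) problem \<Rightarrow> ('n \<Rightarrow> nat \<Rightarrow> nat set) set" where
  "round_configs P = {b. \<forall>i. b i \<in> node_configs P i}"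

lemma finite_round_configs: "finite (round_configs P)"
proof -
  have "finite (node_configs P i)" for i
    unfolding node_configs_def by (rule finite_set_of_finite_funs) auto
  then have "finite (PiE UNIV (node_configs P))" by (intro finite_PiE) auto
  then show ?thesis by (simp add: round_configs_def PiE_UNIV_domain Pi_def)
qed

lemma round_configs_D:
  assumes "b \<in> round_configs P"
  shows "b i k \<subseteq> {1..samples P i}" "horizon P i \<le> k \<Longrightarrow> b i k = {}"
proof -
  have "(k \<in> {..<horizon P i} \<longrightarrow> b i k \<in> Pow {1..samples P i}) \<and> (k \<notin> {..<horizon P i} \<longrightarrow> b i k = {})"
    using assms unfolding round_configs_def node_configs_def by blast
  then show "b i k \<subseteq> {1..samples P i}" "horizon P i \<le> k \<Longrightarrow> b i k = {}"
    by (auto simp: not_less)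
qed

context hew_run
begin

definition batches :: "nat \<Rightarrow> 'a \<Rightarrow> 'n \<Rightarrow> nat \<Rightarrow> nat set" where
  "batches t \<omega> i l = (if l < horizon P i then batch A i t l \<omega> else {})"

text \<open>The conditional probability, given the history, that round \<open>t\<close> draws the minibatches \<open>b\<close>.\<close>

definition config_prob :: "nat \<Rightarrow> ('n \<Rightarrow> nat \<Rightarrow> nat set) \<Rightarrow> 'a \<Rightarrow> real" where
  "config_prob t b = real_cond_exp M (history M P A t) (indicator {\<omega> \<in> space M. batches t \<omega> = b})"

text \<open>The local iterate and the gradient noise that node \<open>i\<close> would have if it drew the minibatch
  sequence \<open>a\<close>; for a fixed \<open>a\<close> in \<open>node_configs P i\<close> both are determined by the history.\<close>

definition path :: "nat \<Rightarrow> 'n \<Rightarrow> nat \<Rightarrow> (nat \<Rightarrow> nat set) \<Rightarrow> 'a \<Rightarrow> real^'d" where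
  "path t i l a \<omega> = local_steps P i (step_size P i (amplitudes A t \<omega> $ i)) a
     (node_control P A i t \<omega>) (server_control P A t \<omega>) (iterate P A t \<omega>) l"

definition noise :: "nat \<Rightarrow> 'n \<Rightarrow> nat \<Rightarrow> (nat \<Rightarrow> nat set) \<Rightarrow> 'a \<Rightarrow> real^'d" where
  "noise t i l a \<omega> = stoch_grad P i (a l) (path t i l a \<omega>) - gradient (local_obj P i) (path t i l a \<omega>)"

lemma batches_in_configs: "\<omega> \<in> space M \<Longrightarrow> batches t \<omega> \<in> round_configs P"
  using batch_subset by (fastforce simp: round_configs_def node_configs_def batches_def)

lemma local_iterate_eq_path:
  "l \<le> horizon P i \<Longrightarrow> local_iterate P A i t l \<omega> = path t i l (batches t \<omega> i) \<omega>"
  unfolding local_iterate_def path_def by (rule local_steps_cong) (simp add: batches_def)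

lemma noise_batches:
  assumes "l < horizon P i"
  shows "noise t i l (batches t \<omega> i) \<omega>
    = grad_estimate P A i t l \<omega> - gradient (local_obj P i) (local_iterate P A i t l \<omega>)"
  using local_iterate_eq_path[of l i t \<omega>] assms
  by (simp add: noise_def grad_estimate_def batches_def)

lemma path_measurable:
  assumes "b \<in> round_configs P"
  shows "path t i l (b i) \<in> borel_measurable (history M P A t)"
  unfolding path_def[abs_def] using round_configs_D(1)[OF assms]
  by (intro local_steps_measurable[where Bs = "\<lambda>k _. b i k"] iterate_measurable node_control_measurable
      server_control_measurable step_size_measurable amplitudes_measurable) auto

lemma noise_measurable:
  assumes "b \<in> round_configs P"
  shows "noise t i l (b i) \<in> borel_measurable (history M P A t)"
  unfolding noise_def[abs_def] using round_configs_D(1)[OF assms]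
  by (intro borel_measurable_diff stoch_grad_measurable gradient_local_obj_measurable path_measurable assms) auto

lemma batch_eq_pred: "l < horizon P i \<Longrightarrow> Measurable.pred M (\<lambda>\<omega>. batch A i t l \<omega> \<in> C)"
  by (rule measurable_compose[OF batch_measurable]) auto

lemma node_batches_event:
  assumes "b \<in> round_configs P"
  shows "{\<omega> \<in> space M. \<forall>k\<in>I. batches t \<omega> k = b k} \<in> sets M"
proof -
  have "batches t \<omega> k = b k \<longleftrightarrow> (\<forall>l\<in>{..<horizon P k}. batch A k t l \<omega> \<in> {b k l})" for \<omega> k
    using round_configs_D(2)[OF assms, of k] by (auto simp: batches_def fun_eq_iff)
  then have "{\<omega> \<in> space M. \<forall>k\<in>I. batches t \<omega> k = b k}
      = {\<omega> \<in> space M. \<forall>k\<in>I. \<forall>l\<in>{..<horizon P k}. batch A k t l \<omega> \<in> {b k l}}" by simp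
  also have "\<dots> \<in> sets M"
    by (intro sets.sets_Collect_finite_All batch_eq_pred[unfolded pred_def]) auto
  finally show ?thesis .
qed

lemma batches_event: "b \<in> round_configs P \<Longrightarrow> {\<omega> \<in> space M. batches t \<omega> = b} \<in> sets M"
  using node_batches_event[of b UNIV t] by (simp add: fun_eq_iff)

lemma AE_cond_exp_batches:
  assumes "\<And>b. b \<in> round_configs P \<Longrightarrow> h b \<in> borel_measurable (history M P A t)"
    and "integrable M (\<lambda>\<omega>. h (batches t \<omega>) \<omega>)"
  shows "AE \<omega> in M. real_cond_exp M (history M P A t) (\<lambda>\<omega>. h (batches t \<omega>) \<omega>) \<omega>
    = (\<Sum>b\<in>round_configs P. config_prob t b \<omega> * h b \<omega>)"
proof -
  interpret F: sigma_finite_subalgebra M "history M P A t" by (rule sigma_finite_history)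
  show ?thesis
    unfolding config_prob_def using assms
    by (intro F.real_cond_exp_finite_valued finite_round_configs batches_in_configs batches_event) auto
qed

lemma AE_config_distribution:
  "AE \<omega> in M. finite_distribution (round_configs P) (\<lambda>b. config_prob t b \<omega>)"
proof -
  interpret F: sigma_finite_subalgebra M "history M P A t" by (rule sigma_finite_history)
  have "AE \<omega> in M. \<forall>b\<in>round_configs P. 0 \<le> config_prob t b \<omega>"
    unfolding config_prob_def using batches_event
    by (intro AE_finite_allI finite_round_configs F.real_cond_exp_pos) auto
  moreover have "AE \<omega> in M. real_cond_exp M (history M P A t) (\<lambda>\<omega>. 1) \<omega>
      = (\<Sum>b\<in>round_configs P. config_prob t b \<omega> * 1)"
    by (rule AE_cond_exp_batches[where h = "\<lambda>_ _. 1"]) auto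
  moreover have "AE \<omega> in M. real_cond_exp M (history M P A t) (\<lambda>\<omega>. 1) \<omega> = 1"
    by (rule F.real_cond_exp_F_meas) auto
  ultimately show ?thesis
    by eventually_elim (auto simp: finite_distribution_def finite_round_configs)
qed

lemma AE_gradients_bounded:
  "\<exists>K. AE \<omega> in M. i \<in> active A t \<omega> \<longrightarrow> (\<forall>l<horizon P i. norm (grad_estimate P A i t l \<omega>) \<le> K \<and>
     norm (gradient (local_obj P i) (local_iterate P A i t l \<omega>)) \<le> K)"
proof -
  let ?B = "cball (x_star P) (radius P)"
  let ?X = "(\<Union>D\<in>Pow {1..samples P i}. stoch_grad P i D ` ?B) \<union> gradient (local_obj P i) ` ?B"
  have "bounded ?X"
    unfolding bounded_Un
    by (intro conjI bounded_UN ballI compact_imp_bounded compact_continuous_image continuous_on_stoch_grad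
        continuous_on_gradient_local_obj) auto
  then obtain K where K: "\<forall>v\<in>?X. norm v \<le> K"
    unfolding bounded_iff by (rule exE)
  have "AE \<omega> in M. i \<in> active A t \<omega> \<longrightarrow> (\<forall>l<horizon P i. norm (grad_estimate P A i t l \<omega>) \<le> K \<and>
     norm (gradient (local_obj P i) (local_iterate P A i t l \<omega>)) \<le> K)"
    using AE_in_ball AE_space
  proof eventually_elim
    case (elim \<omega>)
    show ?case
    proof (intro impI allI conjI)
      fix l assume i: "i \<in> active A t \<omega>" and l: "l < horizon P i"
      then have y: "local_iterate P A i t l \<omega> \<in> ?B" using elim(1) by auto
      show "norm (grad_estimate P A i t l \<omega>) \<le> K"
        unfolding grad_estimate_def using batch_subset[OF elim(2) l] y
        by (intro K[rule_format] UnI1 UN_I[of "batch A i t l \<omega>"] imageI) auto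
      show "norm (gradient (local_obj P i) (local_iterate P A i t l \<omega>)) \<le> K"
        using y by (intro K[rule_format] UnI2 imageI)
    qed
  qed
  then show ?thesis ..
qed

text \<open>Tested against anything that is known before local step \<open>l\<close>, the noise of that step averages
  to zero, also conditionally on the history before the round.\<close>

lemma AE_cond_exp_noise_zero:
  assumes l: "l < horizon P i"
    and \<psi>: "\<psi> \<in> borel_measurable (local_history M P A i t l)" "AE \<omega> in M. \<bar>\<psi> \<omega>\<bar> \<le> c"
  shows "integrable M (\<lambda>\<omega>. \<psi> \<omega> * (of_bool (i \<in> active A t \<omega>) * noise t i l (batches t \<omega> i) \<omega> $ j))" (is ?int)
    and "AE \<omega> in M. real_cond_exp M (history M P A t)
      (\<lambda>\<omega>. \<psi> \<omega> * (of_bool (i \<in> active A t \<omega>) * noise t i l (batches t \<omega> i) \<omega> $ j)) \<omega> = 0" (is ?zero)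
proof -
  let ?F = "history M P A t" and ?G = "local_history M P A i t l"
  let ?I = "\<lambda>\<omega>. of_bool (i \<in> active A t \<omega>) :: real"
  let ?g = "\<lambda>\<omega>. grad_estimate P A i t l \<omega> $ j"
  let ?d = "\<lambda>\<omega>. gradient (local_obj P i) (local_iterate P A i t l \<omega>) $ j"
  note lle = less_imp_le[OF l]
  interpret F: sigma_finite_subalgebra M ?F by (rule sigma_finite_history)
  interpret G: sigma_finite_subalgebra M ?G by (rule sigma_finite_local_history[OF lle])
  have noise: "noise t i l (batches t \<omega> i) \<omega> $ j = ?g \<omega> - ?d \<omega>" for \<omega>
    by (simp add: noise_batches[OF l])
  have I_G [measurable]: "?I \<in> borel_measurable ?G"
    using measurable_history_local[OF active_pred lle] by measurable
  have I_M [measurable]: "?I \<in> borel_measurable M"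
    using measurable_from_history[OF active_pred] by measurable
  have d_G [measurable]: "?d \<in> borel_measurable ?G"
    by (intro borel_measurable_component gradient_local_obj_measurable local_iterate_local_history lle)
  have d_M [measurable]: "?d \<in> borel_measurable M"
    by (intro borel_measurable_component gradient_local_obj_measurable local_iterate_M lle)
  have g_M [measurable]: "?g \<in> borel_measurable M"
    by (intro borel_measurable_component grad_estimate_M l)
  have \<psi>_M [measurable]: "\<psi> \<in> borel_measurable M"
    by (rule measurable_from_subalg[OF G.subalg \<psi>(1)])
  obtain K where K: "AE \<omega> in M. i \<in> active A t \<omega> \<longrightarrow> (\<forall>l<horizon P i.
      norm (grad_estimate P A i t l \<omega>) \<le> K \<and> norm (gradient (local_obj P i) (local_iterate P A i t l \<omega>)) \<le> K)"
    using AE_gradients_bounded by blast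
  have bound: "norm (of_bool a * v $ j) \<le> \<bar>K\<bar>" if "a \<longrightarrow> norm v \<le> K" for a and v :: "real^'d"
    using that component_le_norm_cart[of v j] by (cases a) auto
  have bound_g: "AE \<omega> in M. norm (?I \<omega> * ?g \<omega>) \<le> \<bar>K\<bar>"
    using K by eventually_elim (rule bound, use l in blast)
  have bound_d: "AE \<omega> in M. norm (?I \<omega> * ?d \<omega>) \<le> \<bar>K\<bar>"
    using K by eventually_elim (rule bound, use l in blast)
  have int_g: "integrable M (\<lambda>\<omega>. ?I \<omega> * ?g \<omega>)"
    by (rule integrable_const_bound[OF bound_g]) measurable
  have int_d: "integrable M (\<lambda>\<omega>. ?I \<omega> * ?d \<omega>)"
    by (rule integrable_const_bound[OF bound_d]) measurable
  let ?N = "\<lambda>\<omega>. ?I \<omega> * ?g \<omega> - ?I \<omega> * ?d \<omega>"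
  have eq: "\<psi> \<omega> * (?I \<omega> * noise t i l (batches t \<omega> i) \<omega> $ j) = \<psi> \<omega> * ?N \<omega>" for \<omega>
    by (simp add: noise right_diff_distrib)
  have "AE \<omega> in M. norm (\<psi> \<omega> * ?N \<omega>) \<le> \<bar>c\<bar> * (2 * \<bar>K\<bar>)"
    using bound_g bound_d \<psi>(2)
  proof eventually_elim
    case (elim \<omega>)
    then have "\<bar>?N \<omega>\<bar> \<le> 2 * \<bar>K\<bar>" unfolding real_norm_def by linarith
    then show ?case using elim(3) unfolding real_norm_def abs_mult by (intro mult_mono) auto
  qed
  then have int_prod: "integrable M (\<lambda>\<omega>. \<psi> \<omega> * ?N \<omega>)"
    by (rule integrable_const_bound) measurable
  then show ?int unfolding eq .
  have "AE \<omega> in M. real_cond_exp M ?G (\<lambda>\<omega>. ?I \<omega> * ?g \<omega>) \<omega> = ?I \<omega> * real_cond_exp M ?G ?g \<omega>"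
    by (rule G.real_cond_exp_mult[OF I_G g_M int_g])
  moreover have "AE \<omega> in M. real_cond_exp M ?G (\<lambda>\<omega>. ?I \<omega> * ?d \<omega>) \<omega> = ?I \<omega> * ?d \<omega>"
    by (rule G.real_cond_exp_F_meas[OF int_d]) measurable
  moreover have "AE \<omega> in M. real_cond_exp M ?G ?N \<omega>
      = real_cond_exp M ?G (\<lambda>\<omega>. ?I \<omega> * ?g \<omega>) \<omega> - real_cond_exp M ?G (\<lambda>\<omega>. ?I \<omega> * ?d \<omega>) \<omega>"
    by (rule G.real_cond_exp_diff[OF int_g int_d])
  moreover have "AE \<omega> in M. i \<in> active A t \<omega> \<longrightarrow> real_cond_exp M ?G ?g \<omega> = ?d \<omega>"
    using AE_unbiased[OF l, of t] by eventually_elim (auto simp: vec_cond_exp_def vec_eq_iff)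
  moreover have "AE \<omega> in M. real_cond_exp M ?G (\<lambda>\<omega>. \<psi> \<omega> * ?N \<omega>) \<omega> = \<psi> \<omega> * real_cond_exp M ?G ?N \<omega>"
    by (rule G.real_cond_exp_mult[OF \<psi>(1) _ int_prod]) measurable
  ultimately have G0: "AE \<omega> in M. real_cond_exp M ?G (\<lambda>\<omega>. \<psi> \<omega> * ?N \<omega>) \<omega> = 0"
    by eventually_elim auto
  have "AE \<omega> in M. real_cond_exp M ?F (real_cond_exp M ?G (\<lambda>\<omega>. \<psi> \<omega> * ?N \<omega>)) \<omega>
      = real_cond_exp M ?F (\<lambda>\<omega>. \<psi> \<omega> * ?N \<omega>) \<omega>"
    by (rule F.real_cond_exp_nested_subalg[OF G.subalg history_subalgebra_local[OF lle] int_prod])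
  moreover have "AE \<omega> in M. real_cond_exp M ?F (real_cond_exp M ?G (\<lambda>\<omega>. \<psi> \<omega> * ?N \<omega>)) \<omega>
      = real_cond_exp M ?F (\<lambda>\<omega>. 0) \<omega>"
    using G0 by (rule F.real_cond_exp_cong) auto
  moreover have "AE \<omega> in M. real_cond_exp M ?F (\<lambda>\<omega>. 0) \<omega> = 0"
    by (rule F.real_cond_exp_F_meas) auto
  ultimately show ?zero unfolding eq by eventually_elim simp
qed

lemma active_indicator_measurable:
  "(\<lambda>\<omega>. of_bool (i \<in> active A t \<omega>) :: real) \<in> borel_measurable (history M P A t)"
  using active_pred[where t = t and i = i] by measurable

lemma AE_noise_mean:
  assumes l: "l < horizon P i"
  shows "AE \<omega> in M. i \<in> active A t \<omega> \<longrightarrow>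
    (\<Sum>b\<in>round_configs P. config_prob t b \<omega> *\<^sub>R noise t i l (b i) \<omega>) = 0"
proof -
  let ?I = "\<lambda>\<omega>. of_bool (i \<in> active A t \<omega>) :: real"
  have "AE \<omega> in M. \<forall>j\<in>UNIV. (\<Sum>b\<in>round_configs P. config_prob t b \<omega> * (1 * (?I \<omega> * noise t i l (b i) \<omega> $ j))) = 0"
  proof (rule AE_finite_allI)
    fix j
    note zero = AE_cond_exp_noise_zero[OF l, where \<psi> = "\<lambda>_. 1" and t = t and c = 1 and j = j]
    have "AE \<omega> in M. real_cond_exp M (history M P A t)
        (\<lambda>\<omega>. 1 * (?I \<omega> * noise t i l (batches t \<omega> i) \<omega> $ j)) \<omega>
        = (\<Sum>b\<in>round_configs P. config_prob t b \<omega> * (1 * (?I \<omega> * noise t i l (b i) \<omega> $ j)))"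
      by (rule AE_cond_exp_batches[where h = "\<lambda>b \<omega>. 1 * (?I \<omega> * noise t i l (b i) \<omega> $ j)"])
         (use zero(1) in \<open>auto intro!: borel_measurable_times active_indicator_measurable
            borel_measurable_component noise_measurable\<close>)
    moreover have "AE \<omega> in M. real_cond_exp M (history M P A t)
        (\<lambda>\<omega>. 1 * (?I \<omega> * noise t i l (batches t \<omega> i) \<omega> $ j)) \<omega> = 0"
      by (rule zero(2)) auto
    ultimately show "AE \<omega> in M. (\<Sum>b\<in>round_configs P. config_prob t b \<omega> * (1 * (?I \<omega> * noise t i l (b i) \<omega> $ j))) = 0"
      by eventually_elim simp
  qed simp
  then show ?thesis
    by eventually_elim (auto simp: vec_eq_iff)
qed

lemma AE_noise_orthogonal:
  assumes k: "k < l" and l: "l < horizon P i"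
  shows "AE \<omega> in M. i \<in> active A t \<omega> \<longrightarrow>
    (\<Sum>b\<in>round_configs P. config_prob t b \<omega> * (noise t i k (b i) \<omega> \<bullet> noise t i l (b i) \<omega>)) = 0"
proof -
  let ?I = "\<lambda>\<omega>. of_bool (i \<in> active A t \<omega>) :: real"
  note lle = less_imp_le[OF l]
  have kH: "k < horizon P i" using k l by simp
  obtain K where K: "AE \<omega> in M. i \<in> active A t \<omega> \<longrightarrow> (\<forall>l<horizon P i.
      norm (grad_estimate P A i t l \<omega>) \<le> K \<and> norm (gradient (local_obj P i) (local_iterate P A i t l \<omega>)) \<le> K)"
    using AE_gradients_bounded by blast
  have "AE \<omega> in M. \<forall>j\<in>UNIV. (\<Sum>b\<in>round_configs P. config_prob t b \<omega> *
      ((?I \<omega> * noise t i k (b i) \<omega> $ j) * (?I \<omega> * noise t i l (b i) \<omega> $ j))) = 0"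
  proof (rule AE_finite_allI)
    fix j
    let ?\<psi> = "\<lambda>\<omega>. ?I \<omega> * noise t i k (batches t \<omega> i) \<omega> $ j"
    have "local_iterate P A i t k \<in> borel_measurable (local_history M P A i t l)"
      using history_subalgebra_local[OF lle, of t] k l
      by (intro local_iterate_measurable batch_local_history iterate_measurable node_control_measurable
          server_control_measurable) (auto simp: subalgebra_def)
    then have \<psi>: "?\<psi> \<in> borel_measurable (local_history M P A i t l)"
      unfolding noise_batches[OF kH] using k
      by (intro borel_measurable_times borel_measurable_component borel_measurable_diff
          measurable_history_local[OF active_indicator_measurable lle]
          grad_estimate_local_history gradient_local_obj_measurable) (auto simp: lle)
    have bound: "AE \<omega> in M. \<bar>?\<psi> \<omega>\<bar> \<le> 2 * \<bar>K\<bar>"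
      using K
    proof eventually_elim
      case (elim \<omega>)
      show ?case
      proof (cases "i \<in> active A t \<omega>")
        case True
        have "\<bar>noise t i k (batches t \<omega> i) \<omega> $ j\<bar> \<le> norm (noise t i k (batches t \<omega> i) \<omega>)"
          by (rule component_le_norm_cart)
        also have "\<dots> \<le> norm (grad_estimate P A i t k \<omega>)
            + norm (gradient (local_obj P i) (local_iterate P A i t k \<omega>))"
          unfolding noise_batches[OF kH] by (rule norm_triangle_ineq4)
        finally show ?thesis using elim True kH by force
      qed simp
    qed
    have "AE \<omega> in M. real_cond_exp M (history M P A t)
        (\<lambda>\<omega>. ?\<psi> \<omega> * (?I \<omega> * noise t i l (batches t \<omega> i) \<omega> $ j)) \<omega>
        = (\<Sum>b\<in>round_configs P. config_prob t b \<omega> *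
            ((?I \<omega> * noise t i k (b i) \<omega> $ j) * (?I \<omega> * noise t i l (b i) \<omega> $ j)))"
      by (rule AE_cond_exp_batches[where h = "\<lambda>b \<omega>. (?I \<omega> * noise t i k (b i) \<omega> $ j) * (?I \<omega> * noise t i l (b i) \<omega> $ j)"])
         (intro borel_measurable_times active_indicator_measurable borel_measurable_component
            noise_measurable AE_cond_exp_noise_zero(1)[OF l \<psi> bound]; assumption)+
    with AE_cond_exp_noise_zero(2)[OF l \<psi> bound, of j]
    show "AE \<omega> in M. (\<Sum>b\<in>round_configs P. config_prob t b \<omega> *
      ((?I \<omega> * noise t i k (b i) \<omega> $ j) * (?I \<omega> * noise t i l (b i) \<omega> $ j))) = 0"
      by eventually_elim simp
  qed simp
  then show ?thesis
  proof eventually_elim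
    case (elim \<omega>)
    show ?case
    proof
      assume i: "i \<in> active A t \<omega>"
      have "(\<Sum>b\<in>round_configs P. config_prob t b \<omega> * (noise t i k (b i) \<omega> \<bullet> noise t i l (b i) \<omega>))
          = (\<Sum>j\<in>UNIV. \<Sum>b\<in>round_configs P. config_prob t b \<omega> * (noise t i k (b i) \<omega> $ j * noise t i l (b i) \<omega> $ j))"
        unfolding inner_vec_def sum_distrib_left by (subst sum.swap) simp
      also have "\<dots> = 0" using elim i by simp
      finally show "(\<Sum>b\<in>round_configs P. config_prob t b \<omega> * (noise t i k (b i) \<omega> \<bullet> noise t i l (b i) \<omega>)) = 0" .
    qed
  qed
qed

text \<open>The variance assumption concerns active nodes only, and the squared noise need not be integrable
  where the node is inactive. The indicator of activity is therefore inserted before the tower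
  property is used.\<close>

lemma AE_noise_variance:
  assumes l: "l < horizon P i"
  shows "AE \<omega> in M. i \<in> active A t \<omega> \<longrightarrow>
    (\<Sum>b\<in>round_configs P. config_prob t b \<omega> * (norm (noise t i l (b i) \<omega>))\<^sup>2)
      \<le> variance_level P i / real (batch_size P i)"
proof -
  let ?F = "history M P A t" and ?G = "local_history M P A i t l"
  let ?I = "\<lambda>\<omega>. of_bool (i \<in> active A t \<omega>) :: real"
  let ?v = "variance_level P i / real (batch_size P i)"
  let ?Z = "\<lambda>\<omega>. (norm (grad_estimate P A i t l \<omega> - gradient (local_obj P i) (local_iterate P A i t l \<omega>)))\<^sup>2"
  note lle = less_imp_le[OF l]
  interpret F: sigma_finite_subalgebra M ?F by (rule sigma_finite_history)
  interpret G: sigma_finite_subalgebra M ?G by (rule sigma_finite_local_history[OF lle])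
  have I_F [measurable]: "?I \<in> borel_measurable ?F" by (rule active_indicator_measurable)
  have I_G [measurable]: "?I \<in> borel_measurable ?G" by (rule measurable_history_local[OF I_F lle])
  have I_M [measurable]: "?I \<in> borel_measurable M" by (rule measurable_from_history[OF I_F])
  have [measurable]: "grad_estimate P A i t l \<in> borel_measurable M" by (rule grad_estimate_M[OF l])
  have [measurable]: "(\<lambda>\<omega>. gradient (local_obj P i) (local_iterate P A i t l \<omega>)) \<in> borel_measurable M"
    by (intro gradient_local_obj_measurable local_iterate_M lle)
  have Z_M: "?Z \<in> borel_measurable M" by measurable
  obtain K where K: "AE \<omega> in M. i \<in> active A t \<omega> \<longrightarrow> (\<forall>l<horizon P i.
      norm (grad_estimate P A i t l \<omega>) \<le> K \<and> norm (gradient (local_obj P i) (local_iterate P A i t l \<omega>)) \<le> K)"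
    using AE_gradients_bounded by blast
  have "AE \<omega> in M. norm (?I \<omega> * ?Z \<omega>) \<le> (2 * \<bar>K\<bar>)\<^sup>2"
    using K
  proof eventually_elim
    case (elim \<omega>)
    show ?case
    proof (cases "i \<in> active A t \<omega>")
      case True
      have "norm (grad_estimate P A i t l \<omega> - gradient (local_obj P i) (local_iterate P A i t l \<omega>))
          \<le> norm (grad_estimate P A i t l \<omega>) + norm (gradient (local_obj P i) (local_iterate P A i t l \<omega>))"
        by (rule norm_triangle_ineq4)
      also have "\<dots> \<le> 2 * \<bar>K\<bar>" using elim True l by force
      finally have "?Z \<omega> \<le> (2 * \<bar>K\<bar>)\<^sup>2" by (intro power_mono) auto
      then show ?thesis using True by simp
    qed simp
  qed
  then have int: "integrable M (\<lambda>\<omega>. ?I \<omega> * ?Z \<omega>)"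
    by (rule integrable_const_bound) measurable
  have int_v: "integrable M (\<lambda>\<omega>. ?I \<omega> * ?v)"
    by (rule integrable_const_bound[where B = "\<bar>?v\<bar>"]) (auto simp del: abs_divide)
  have "AE \<omega> in M. real_cond_exp M ?G (\<lambda>\<omega>. ?I \<omega> * ?Z \<omega>) \<omega> = ?I \<omega> * real_cond_exp M ?G ?Z \<omega>"
    by (rule G.real_cond_exp_mult[OF I_G Z_M int])
  with AE_variance[OF l, of t]
  have G: "AE \<omega> in M. real_cond_exp M ?G (\<lambda>\<omega>. ?I \<omega> * ?Z \<omega>) \<omega> \<le> ?I \<omega> * ?v"
    by eventually_elim auto
  have "AE \<omega> in M. real_cond_exp M ?F (real_cond_exp M ?G (\<lambda>\<omega>. ?I \<omega> * ?Z \<omega>)) \<omega>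
      \<le> real_cond_exp M ?F (\<lambda>\<omega>. ?I \<omega> * ?v) \<omega>"
    by (rule F.real_cond_exp_mono[OF G G.real_cond_exp_int(1)[OF int] int_v])
  moreover have "AE \<omega> in M. real_cond_exp M ?F (real_cond_exp M ?G (\<lambda>\<omega>. ?I \<omega> * ?Z \<omega>)) \<omega>
      = real_cond_exp M ?F (\<lambda>\<omega>. ?I \<omega> * ?Z \<omega>) \<omega>"
    by (rule F.real_cond_exp_nested_subalg[OF G.subalg history_subalgebra_local[OF lle] int])
  moreover have "AE \<omega> in M. real_cond_exp M ?F (\<lambda>\<omega>. ?I \<omega> * ?v) \<omega> = ?I \<omega> * ?v"
    by (rule F.real_cond_exp_F_meas[OF int_v]) measurable
  moreover have "AE \<omega> in M. real_cond_exp M ?F (\<lambda>\<omega>. ?I \<omega> * ?Z \<omega>) \<omega>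
      = (\<Sum>b\<in>round_configs P. config_prob t b \<omega> * (?I \<omega> * (norm (noise t i l (b i) \<omega>))\<^sup>2))"
    unfolding noise_batches[OF l, symmetric] using int
    by (intro AE_cond_exp_batches[where h = "\<lambda>b \<omega>. ?I \<omega> * (norm (noise t i l (b i) \<omega>))\<^sup>2"]
        borel_measurable_times borel_measurable_power borel_measurable_norm[THEN measurable_compose[rotated]]
        I_F noise_measurable)
       (simp_all add: noise_batches[OF l])
  ultimately show ?thesis by eventually_elim auto
qed

end

context hew_run
begin

text \<open>Given the history, the probability that a set \<open>I\<close> of active nodes draws prescribed sequences
  factorises over the nodes and their steps.\<close>

lemma AE_node_product:
  assumes b: "b \<in> round_configs P"
  shows "AE \<omega> in M. I \<subseteq> active A t \<omega> \<longrightarrow>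
    real_cond_exp M (history M P A t) (indicator {\<omega>' \<in> space M. \<forall>k\<in>I. batches t \<omega>' k = b k}) \<omega>
    = (\<Prod>k\<in>I. \<Prod>l<horizon P k.
        real_cond_exp M (history M P A t) (indicator {\<omega>' \<in> space M. batch A k t l \<omega>' \<in> {b k l}}) \<omega>)"
proof -
  let ?F = "history M P A t"
  \<comment> \<open>The nodes outside \<open>I\<close> are left free and contribute factors of one.\<close>
  let ?C = "\<lambda>k l. if k \<in> I then {b k l} else UNIV"
  let ?E = "{\<omega>' \<in> space M. \<forall>k\<in>active A t \<omega>'. \<forall>l<horizon P k. batch A k t l \<omega>' \<in> ?C k l}"
  let ?D = "{\<omega>' \<in> space M. \<forall>k\<in>I. batches t \<omega>' k = b k}"
  let ?q = "\<lambda>\<omega> k l. real_cond_exp M ?F (indicator {\<omega>' \<in> space M. batch A k t l \<omega>' \<in> ?C k l}) \<omega>"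
  interpret F: sigma_finite_subalgebra M ?F by (rule sigma_finite_history)
  have D: "?D \<in> sets M" by (rule node_batches_event[OF b])
  have "?E = {\<omega>' \<in> space M. \<forall>k\<in>UNIV. k \<in> active A t \<omega>' \<longrightarrow> (\<forall>l\<in>{..<horizon P k}. batch A k t l \<omega>' \<in> ?C k l)}"
    by auto
  also have "\<dots> \<in> sets M"
    using measurable_from_history[OF active_pred]
    by (intro sets.sets_Collect_finite_All sets.sets_Collect_imp batch_eq_pred[unfolded pred_def])
       (auto simp: pred_def)
  finally have E: "?E \<in> sets M" .
  have same: "\<omega> \<in> ?E \<longleftrightarrow> \<omega> \<in> ?D" if "\<omega> \<in> space M" "I \<subseteq> active A t \<omega>" for \<omega>
  proof -
    have "batches t \<omega> k = b k \<longleftrightarrow> (\<forall>l<horizon P k. batch A k t l \<omega> = b k l)" for k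
      using round_configs_D(2)[OF b, of k] by (auto simp: batches_def fun_eq_iff)
    then show ?thesis using that by auto
  qed
  have pred_I: "Measurable.pred ?F (\<lambda>\<omega>. I \<subseteq> active A t \<omega>)"
    by (rule measurable_compose[OF active_measurable]) simp
  have loc: "AE \<omega> in M. I \<subseteq> active A t \<omega> \<longrightarrow>
      real_cond_exp M ?F (indicator ?E) \<omega> = real_cond_exp M ?F (indicator ?D) \<omega>"
  proof (rule F.real_cond_exp_local[OF pred_I])
    have "(\<lambda>\<omega>. of_bool (I \<subseteq> active A t \<omega>) * indicator ?E \<omega> :: real) \<in> borel_measurable M"
      using measurable_from_history[OF pred_I] E by measurable
    then show "integrable M (\<lambda>\<omega>. of_bool (I \<subseteq> active A t \<omega>) * indicator ?E \<omega> :: real)"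
      by (intro integrable_const_bound[where B = 1]) (auto simp: indicator_def)
    show "indicator ?E \<omega> = (indicator ?D \<omega> :: real)" if "\<omega> \<in> space M" "I \<subseteq> active A t \<omega>" for \<omega>
      using same[OF that] by (simp only: indicator_def)
    show "(indicator ?E :: 'a \<Rightarrow> real) \<in> borel_measurable M" "(indicator ?D :: 'a \<Rightarrow> real) \<in> borel_measurable M"
      by (rule borel_measurable_indicator[OF E] borel_measurable_indicator[OF D])+
  qed
  have "AE \<omega> in M. \<forall>i\<in>UNIV. i \<in> active A t \<omega> \<longrightarrow> batches_cond_indep_at M ?F P A t ?C \<omega>"
  proof (rule AE_finite_allI)
    fix i
    have "0 < horizon P i" using problemD(4)[of i] by simp
    from AE_cond_indep[OF this, of t ?C]
    show "AE \<omega> in M. i \<in> active A t \<omega> \<longrightarrow> batches_cond_indep_at M ?F P A t ?C \<omega>"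
      unfolding local_history_0 .
  qed simp
  moreover have "AE \<omega> in M. \<forall>k\<in>-I. \<forall>l\<in>{..<horizon P k}. ?q \<omega> k l = 1"
  proof (intro AE_finite_allI)
    fix k l assume "k \<in> -I"
    have "AE \<omega> in M. real_cond_exp M ?F (indicator (space M)) \<omega> = (indicator (space M) \<omega> :: real)"
      using sets.top[of ?F] by (intro F.real_cond_exp_F_meas borel_measurable_indicator integrable_real_indicator)
         (auto simp: less_top[symmetric])
    then show "AE \<omega> in M. ?q \<omega> k l = 1"
      using AE_space by eventually_elim (use \<open>k \<in> -I\<close> in simp)
  qed auto
  ultimately show ?thesis
    using loc AE_space
  proof eventually_elim
    case (elim \<omega>)
    show ?case
    proof
      assume I: "I \<subseteq> active A t \<omega>"
      have indep: "real_cond_exp M ?F (indicator ?E) \<omega> = (\<Prod>k\<in>active A t \<omega>. \<Prod>l<horizon P k. ?q \<omega> k l)"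
        using elim(1) active_nonempty[OF elim(4), of t] unfolding batches_cond_indep_at_def by blast
      also have "\<dots> = (\<Prod>k\<in>I. \<Prod>l<horizon P k. ?q \<omega> k l)"
      proof (intro prod.mono_neutral_right ballI)
        fix k assume "k \<in> active A t \<omega> - I"
        with elim(2) show "(\<Prod>l<horizon P k. ?q \<omega> k l) = 1" by (intro prod.neutral) blast
      qed (use I in auto)
      finally show "real_cond_exp M ?F (indicator ?D) \<omega> = (\<Prod>k\<in>I. \<Prod>l<horizon P k.
          real_cond_exp M ?F (indicator {\<omega>' \<in> space M. batch A k t l \<omega>' \<in> {b k l}}) \<omega>)"
        using elim(3) I by simp
    qed
  qed
qed

text \<open>The same conditional probability as a marginal of the configuration probabilities.\<close>

lemma AE_node_marginal:
  assumes b: "b \<in> round_configs P"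
  shows "AE \<omega> in M.
    real_cond_exp M (history M P A t) (indicator {\<omega>' \<in> space M. \<forall>k\<in>I. batches t \<omega>' k = b k}) \<omega>
    = (\<Sum>b' | b' \<in> round_configs P \<and> (\<forall>k\<in>I. b' k = b k). config_prob t b' \<omega>)"
proof -
  let ?F = "history M P A t" and ?D = "{\<omega>' \<in> space M. \<forall>k\<in>I. batches t \<omega>' k = b k}"
  let ?h = "\<lambda>b' \<omega>. of_bool (\<forall>k\<in>I. b' k = b k) :: real"
  interpret F: sigma_finite_subalgebra M ?F by (rule sigma_finite_history)
  have D: "?D \<in> sets M" by (rule node_batches_event[OF b])
  have eq: "?h (batches t \<omega>) \<omega> = indicator ?D \<omega>" if "\<omega> \<in> space M" for \<omega>
    using that by (simp add: indicator_def)
  have int_D: "integrable M (indicator ?D :: 'a \<Rightarrow> real)"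
    using D by (intro integrable_real_indicator) (auto simp: less_top[symmetric])
  have int: "integrable M (\<lambda>\<omega>. ?h (batches t \<omega>) \<omega>)"
    using int_D by (subst Bochner_Integration.integrable_cong[OF refl eq]) auto
  have sum_eq: "(\<Sum>b'\<in>round_configs P. config_prob t b' \<omega> * ?h b' \<omega>)
      = (\<Sum>b' | b' \<in> round_configs P \<and> (\<forall>k\<in>I. b' k = b k). config_prob t b' \<omega>)" for \<omega>
    by (intro sum.mono_neutral_cong_right) (auto simp: finite_round_configs)
  have "AE \<omega> in M. real_cond_exp M ?F (\<lambda>\<omega>. ?h (batches t \<omega>) \<omega>) \<omega>
      = (\<Sum>b'\<in>round_configs P. config_prob t b' \<omega> * ?h b' \<omega>)"
    by (rule AE_cond_exp_batches[where h = ?h, OF _ int]) auto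
  moreover have "AE \<omega> in M. real_cond_exp M ?F (\<lambda>\<omega>. ?h (batches t \<omega>) \<omega>) \<omega> = real_cond_exp M ?F (indicator ?D) \<omega>"
    using eq int D by (intro F.real_cond_exp_cong AE_I2) auto
  ultimately show ?thesis by eventually_elim (simp only: sum_eq)
qed

lemma AE_pair_independent:
  assumes ik: "i \<noteq> k"
  shows "AE \<omega> in M. i \<in> active A t \<omega> \<longrightarrow> k \<in> active A t \<omega> \<longrightarrow> (\<forall>b\<in>round_configs P.
    (\<Sum>b' | b' \<in> round_configs P \<and> b' i = b i \<and> b' k = b k. config_prob t b' \<omega>)
    = (\<Sum>b' | b' \<in> round_configs P \<and> b' i = b i. config_prob t b' \<omega>)
      * (\<Sum>b' | b' \<in> round_configs P \<and> b' k = b k. config_prob t b' \<omega>))"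
proof -
  have "AE \<omega> in M. \<forall>b\<in>round_configs P. i \<in> active A t \<omega> \<longrightarrow> k \<in> active A t \<omega> \<longrightarrow>
    (\<Sum>b' | b' \<in> round_configs P \<and> b' i = b i \<and> b' k = b k. config_prob t b' \<omega>)
    = (\<Sum>b' | b' \<in> round_configs P \<and> b' i = b i. config_prob t b' \<omega>)
      * (\<Sum>b' | b' \<in> round_configs P \<and> b' k = b k. config_prob t b' \<omega>)"
  proof (rule AE_finite_allI[OF finite_round_configs])
    fix b :: "'n \<Rightarrow> nat \<Rightarrow> nat set"
    assume b: "b \<in> round_configs P"
    show "AE \<omega> in M. i \<in> active A t \<omega> \<longrightarrow> k \<in> active A t \<omega> \<longrightarrow>
      (\<Sum>b' | b' \<in> round_configs P \<and> b' i = b i \<and> b' k = b k. config_prob t b' \<omega>)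
      = (\<Sum>b' | b' \<in> round_configs P \<and> b' i = b i. config_prob t b' \<omega>)
        * (\<Sum>b' | b' \<in> round_configs P \<and> b' k = b k. config_prob t b' \<omega>)"
      using AE_node_product[OF b, of "{i, k}" t] AE_node_product[OF b, of "{i}" t]
        AE_node_product[OF b, of "{k}" t] AE_node_marginal[OF b, of t "{i, k}"]
        AE_node_marginal[OF b, of t "{i}"] AE_node_marginal[OF b, of t "{k}"]
      by eventually_elim (use ik in simp)
  qed
  then show ?thesis by eventually_elim blast
qed

lemma AE_paths_uncorrelated:
  assumes ik: "i \<noteq> k"
  shows "AE \<omega> in M. i \<in> active A t \<omega> \<longrightarrow> k \<in> active A t \<omega> \<longrightarrow>
    (\<Sum>b\<in>round_configs P. config_prob t b \<omega> *
       (path t i (horizon P i) (b i) \<omega> \<bullet> path t k (horizon P k) (b k) \<omega>))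
    = (\<Sum>b\<in>round_configs P. config_prob t b \<omega> *\<^sub>R path t i (horizon P i) (b i) \<omega>)
      \<bullet> (\<Sum>b\<in>round_configs P. config_prob t b \<omega> *\<^sub>R path t k (horizon P k) (b k) \<omega>)"
  using AE_pair_independent[OF ik, of t] AE_config_distribution[of t]
proof eventually_elim
  case (elim \<omega>)
  interpret finite_distribution "round_configs P" "\<lambda>b. config_prob t b \<omega>" by (rule elim(2))
  show ?case
  proof (intro impI)
    assume act: "i \<in> active A t \<omega>" "k \<in> active A t \<omega>"
    have "mean (\<lambda>b. path t i (horizon P i) (b i) \<omega> \<bullet> path t k (horizon P k) (b k) \<omega>)
        = mean (\<lambda>b. path t i (horizon P i) (b i) \<omega>) \<bullet> mean (\<lambda>b. path t k (horizon P k) (b k) \<omega>)"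
    proof (rule mean_inner_indep[where X = "\<lambda>b. b i" and Y = "\<lambda>b. b k"
          and f = "\<lambda>a. path t i (horizon P i) a \<omega>" and g = "\<lambda>a. path t k (horizon P k) a \<omega>"])
      fix u v assume "u \<in> (\<lambda>b. b i) ` round_configs P" "v \<in> (\<lambda>b. b k) ` round_configs P"
      then obtain b1 b2 where b: "b1 \<in> round_configs P" "u = b1 i" "b2 \<in> round_configs P" "v = b2 k"
        by blast
      have "b1(k := b2 k) \<in> round_configs P" using b by (simp add: round_configs_def)
      with elim(1) act
      show "(\<Sum>b | b \<in> round_configs P \<and> b i = u \<and> b k = v. config_prob t b \<omega>)
          = (\<Sum>b | b \<in> round_configs P \<and> b i = u. config_prob t b \<omega>)
            * (\<Sum>b | b \<in> round_configs P \<and> b k = v. config_prob t b \<omega>)"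
        using ik b by fastforce
    qed
    then show "(\<Sum>b\<in>round_configs P. config_prob t b \<omega> *
       (path t i (horizon P i) (b i) \<omega> \<bullet> path t k (horizon P k) (b k) \<omega>))
      = (\<Sum>b\<in>round_configs P. config_prob t b \<omega> *\<^sub>R path t i (horizon P i) (b i) \<omega>)
        \<bullet> (\<Sum>b\<in>round_configs P. config_prob t b \<omega> *\<^sub>R path t k (horizon P k) (b k) \<omega>)"
      by (simp add: mean_def)
  qed
qed

text \<open>The next iterate as a function of the drawn minibatches.\<close>

definition next_point :: "nat \<Rightarrow> ('n \<Rightarrow> nat \<Rightarrow> nat set) \<Rightarrow> 'a \<Rightarrow> real^'d" where
  "next_point t b \<omega> = iterate P A t \<omega>
    + (\<Sum>i\<in>active A t \<omega>. (weights A t \<omega> $ i) *\<^sub>R (path t i (horizon P i) (b i) \<omega> - iterate P A t \<omega>))"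

lemma iterate_Suc_eq_next_point: "iterate P A (Suc t) \<omega> = next_point t (batches t \<omega>) \<omega>"
  unfolding iterate_Suc next_point_def by (simp add: local_iterate_eq_path)

lemma next_point_measurable:
  assumes "b \<in> round_configs P"
  shows "next_point t b \<in> borel_measurable (history M P A t)"
proof -
  note [measurable] = active_pred weights_component_measurable iterate_measurable path_measurable[OF assms]
  have "(\<lambda>\<omega>. iterate P A t \<omega> + (\<Sum>i\<in>UNIV. if i \<in> active A t \<omega>
      then (weights A t \<omega> $ i) *\<^sub>R (path t i (horizon P i) (b i) \<omega> - iterate P A t \<omega>) else 0))
    \<in> borel_measurable (history M P A t)"
    by measurable
  then show ?thesis
    unfolding next_point_def[abs_def] by (simp add: sum.If_cases)
qed

lemma AE_next_gap:
  "AE \<omega> in M. next_gap M P A t \<omega>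
    = (\<Sum>b\<in>round_configs P. config_prob t b \<omega> * (global_obj P (next_point t b \<omega>) - F_star P))"
proof -
  have cont: "continuous_on X (global_obj P)" for X
    by (rule L_smooth_continuous_on[OF global_obj_smooth[OF problem]])
  have meas: "(\<lambda>\<omega>. global_obj P (f \<omega>) - F_star P) \<in> borel_measurable N"
    if "f \<in> borel_measurable N" for f :: "'a \<Rightarrow> real^'d" and N
    using measurable_compose[OF that borel_measurable_continuous_onI[OF cont]] by simp
  have "bounded (global_obj P ` cball (x_star P) (radius P))"
    by (intro compact_imp_bounded compact_continuous_image cont) simp
  then obtain K where K: "\<forall>v\<in>global_obj P ` cball (x_star P) (radius P). norm v \<le> K"
    unfolding bounded_iff by (rule exE)
  have "AE \<omega> in M. norm (global_obj P (iterate P A (Suc t) \<omega>) - F_star P) \<le> K + \<bar>F_star P\<bar>"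
    using AE_in_ball
  proof eventually_elim
    case (elim \<omega>)
    then have "norm (global_obj P (iterate P A (Suc t) \<omega>)) \<le> K"
      by (intro K[rule_format] imageI) blast
    then show ?case unfolding real_norm_def by linarith
  qed
  then have "integrable M (\<lambda>\<omega>. global_obj P (iterate P A (Suc t) \<omega>) - F_star P)"
    by (rule integrable_const_bound) (rule meas[OF measurable_from_history[OF iterate_measurable]])
  then have "AE \<omega> in M. real_cond_exp M (history M P A t)
      (\<lambda>\<omega>. global_obj P (next_point t (batches t \<omega>) \<omega>) - F_star P) \<omega>
    = (\<Sum>b\<in>round_configs P. config_prob t b \<omega> * (global_obj P (next_point t b \<omega>) - F_star P))"
    unfolding iterate_Suc_eq_next_point
    by (intro AE_cond_exp_batches[where h = "\<lambda>b \<omega>. global_obj P (next_point t b \<omega>) - F_star P"]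
        meas next_point_measurable)
  then show ?thesis
    unfolding next_gap_def iterate_Suc_eq_next_point .
qed

text \<open>The one-round descent inequality, for the controls with which the round is run.\<close>

lemma AE_next_gap_le_objective:
  assumes upper: "admissible_upper_state M P A t U Q"
  shows "AE \<omega> in M. next_gap M P A t \<omega>
    \<le> J_id P (active A t \<omega>) (U \<omega>) (Q \<omega>) (weights A t \<omega>, amplitudes A t \<omega>)"
proof -
  have mean: "AE \<omega> in M. \<forall>i\<in>UNIV. \<forall>l\<in>{..<horizon P i}. i \<in> active A t \<omega> \<longrightarrow>
      (\<Sum>b\<in>round_configs P. config_prob t b \<omega> *\<^sub>R noise t i l (b i) \<omega>) = 0"
    by (intro AE_finite_allI AE_noise_mean) auto
  have orth: "AE \<omega> in M. \<forall>i\<in>UNIV. \<forall>l\<in>{..<horizon P i}. \<forall>k\<in>{..<l}. i \<in> active A t \<omega> \<longrightarrow>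
      (\<Sum>b\<in>round_configs P. config_prob t b \<omega> * (noise t i k (b i) \<omega> \<bullet> noise t i l (b i) \<omega>)) = 0"
    by (intro AE_finite_allI AE_noise_orthogonal) auto
  have var: "AE \<omega> in M. \<forall>i\<in>UNIV. \<forall>l\<in>{..<horizon P i}. i \<in> active A t \<omega> \<longrightarrow>
      (\<Sum>b\<in>round_configs P. config_prob t b \<omega> * (norm (noise t i l (b i) \<omega>))\<^sup>2)
        \<le> variance_level P i / real (batch_size P i)"
    by (intro AE_finite_allI AE_noise_variance) auto
  have uncorr: "AE \<omega> in M. \<forall>i\<in>UNIV. \<forall>k\<in>UNIV - {i}. i \<in> active A t \<omega> \<longrightarrow> k \<in> active A t \<omega> \<longrightarrow>
      (\<Sum>b\<in>round_configs P. config_prob t b \<omega> *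
         (path t i (horizon P i) (b i) \<omega> \<bullet> path t k (horizon P k) (b k) \<omega>))
      = (\<Sum>b\<in>round_configs P. config_prob t b \<omega> *\<^sub>R path t i (horizon P i) (b i) \<omega>)
        \<bullet> (\<Sum>b\<in>round_configs P. config_prob t b \<omega> *\<^sub>R path t k (horizon P k) (b k) \<omega>)"
    by (intro AE_finite_allI AE_paths_uncorrelated) auto
  have state: "AE \<omega> in M. global_obj P (iterate P A t \<omega>) - F_star P \<le> U \<omega> \<and>
      (MAX i\<in>UNIV. (norm (node_control P A i t \<omega> - gradient (local_obj P i) (iterate P A t \<omega>)))\<^sup>2) \<le> Q \<omega>"
    using upper by (simp add: admissible_upper_state_def)
  show ?thesis
    using mean orth var uncorr state AE_config_distribution[of t] AE_in_ball AE_next_gap[of t] AE_space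
  proof eventually_elim
    case (elim \<omega>)
    let ?p = "\<lambda>b. config_prob t b \<omega>" and ?\<Omega> = "round_configs P" and ?S = "active A t \<omega>"
    interpret finite_distribution ?\<Omega> ?p by (rule elim(6))
    have path: "local_path ?\<Omega> ?p (gradient (local_obj P i)) (smooth_const P) (amplitudes A t \<omega> $ i)
        (variance_level P i / real (batch_size P i)) (horizon P i) (iterate P A t \<omega>)
        (server_control P A t \<omega> - node_control P A i t \<omega>)
        (\<lambda>l b. path t i l (b i) \<omega>) (\<lambda>l b. noise t i l (b i) \<omega>)" if i: "i \<in> ?S" for i
    proof unfold_locales
      show "smooth_const P > 0" "horizon P i \<ge> 1" by (rule problemD)+
      show "amplitudes A t \<omega> $ i > 0"
        using amplitudes_in_box[OF elim(9), of t] i problemD(6) by (force simp: amplitude_box_def)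
      show "norm (gradient (local_obj P i) a - gradient (local_obj P i) b) \<le> smooth_const P * norm (a - b)" for a b
        by (rule L_smooth_lipschitz[OF local_obj_smooth[OF problem]])
      show "path t i 0 (b i) \<omega> = iterate P A t \<omega>" for b
        by (simp add: path_def)
      show "path t i (Suc l) (b i) \<omega> = path t i l (b i) \<omega>
          - (amplitudes A t \<omega> $ i / (smooth_const P * real (horizon P i))) *\<^sub>R
            (gradient (local_obj P i) (path t i l (b i) \<omega>) + noise t i l (b i) \<omega>
              + (server_control P A t \<omega> - node_control P A i t \<omega>))" for b l
        by (simp add: path_def noise_def step_size_def algebra_simps)
      show "mean (\<lambda>b. noise t i l (b i) \<omega>) = 0" if "l < horizon P i" for l
        using elim(1) i that by (simp add: mean_def)
      show "mean (\<lambda>b. noise t i k (b i) \<omega> \<bullet> noise t i l (b i) \<omega>) = 0" if "k < l" "l < horizon P i" for k l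
        using elim(2) i that by (simp add: mean_def)
      show "mean (\<lambda>b. (norm (noise t i l (b i) \<omega>))\<^sup>2) \<le> variance_level P i / real (batch_size P i)"
        if "l < horizon P i" for l
        using elim(3) i that by (simp add: mean_def)
    qed
    have "(\<Sum>b\<in>?\<Omega>. ?p b * (global_obj P (iterate P A t \<omega> + (\<Sum>i\<in>?S. (weights A t \<omega> $ i) *\<^sub>R
          (path t i (horizon P i) (b i) \<omega> - iterate P A t \<omega>))) - F_star P))
        \<le> J_id P ?S (U \<omega>) (Q \<omega>) (weights A t \<omega>, amplitudes A t \<omega>)"
    proof (rule finite_round_bound[OF problem weights_in_simplex[OF elim(9)] amplitudes_in_box[OF elim(9)],
          where y = "\<lambda>i l b. path t i l (b i) \<omega>" and \<zeta> = "\<lambda>i l b. noise t i l (b i) \<omega>"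
            and cs = "\<lambda>i. node_control P A i t \<omega>" and c = "server_control P A t \<omega>"])
      show "iterate P A t \<omega> \<in> cball (x_star P) (radius P)" using elim(7) by blast
      show "global_obj P (iterate P A t \<omega>) - F_star P \<le> U \<omega>" using elim(5) by blast
      show "(norm (node_control P A i t \<omega> - gradient (local_obj P i) (iterate P A t \<omega>)))\<^sup>2 \<le> Q \<omega>" for i
        by (rule order_trans[OF Max_ge conjunct2[OF elim(5)]]) auto
      show "server_control P A t \<omega> = (1 / real CARD('n)) *\<^sub>R (\<Sum>i\<in>UNIV. node_control P A i t \<omega>)"
        by (rule server_control_eq_average)
      show "finite_distribution ?\<Omega> ?p" by (rule elim(6))
      show "mean (\<lambda>b. path t i (horizon P i) (b i) \<omega> \<bullet> path t k (horizon P k) (b k) \<omega>)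
          = mean (\<lambda>b. path t i (horizon P i) (b i) \<omega>) \<bullet> mean (\<lambda>b. path t k (horizon P k) (b k) \<omega>)"
        if "i \<in> ?S" "k \<in> ?S" "i \<noteq> k" for i k
        using elim(4) that by (simp add: mean_def)
    qed (rule path)
    then show ?case using elim(8) by (simp add: next_point_def)
  qed
qed

end

section \<open>The objectives and their minimizers\<close>

lemma rho_mono:
  assumes "valid_problem P" "0 \<le> th" "V i \<le> V' i"
  shows "rho P V u q i th \<le> rho P V' u q i th"
  using valid_problemD(2)[OF assms(1)] assms(2,3)
  unfolding rho_def by (intro add_left_mono mult_left_mono divide_right_mono) auto

lemma kappa_mono:
  assumes "valid_problem P" "0 \<le> th" "V i \<le> V' i"
  shows "kappa P V u q i th \<le> kappa P V' u q i th"
  using valid_problemD(2)[OF assms(1)] assms(2,3)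
  unfolding kappa_def by (intro add_left_mono mult_left_mono divide_right_mono) auto

text \<open>Larger variance proxies make the objective larger at each feasible pair.\<close>

lemma objective_mono:
  assumes P: "valid_problem P" and V: "\<forall>i. V i \<le> V' i" and z: "feasible P S z"
  shows "objective P V S u q z \<le> objective P V' S u q z"
proof -
  obtain w \<theta> where z_eq: "z = (w, \<theta>)" by (cases z)
  have w: "w \<in> weight_simplex S" and \<theta>: "\<theta> \<in> amplitude_box P S"
    using z by (auto simp: feasible_def z_eq)
  have th: "0 \<le> \<theta> $ i" if "i \<in> S" for i
    using that \<theta> valid_problemD(6)[OF P] by (force simp: amplitude_box_def)
  have "(\<Sum>i\<in>S. w $ i * mu P V' u q i (\<theta> $ i)) \<le> (\<Sum>i\<in>S. w $ i * mu P V u q i (\<theta> $ i))"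
    using V th by (intro sum_mono mult_left_mono weight_simplex_D(2)[OF w])
       (auto simp: mu_def intro!: rho_mono[OF P])
  moreover have "smooth_const P / 2 * (\<Sum>i\<in>S. (w $ i)\<^sup>2 * kappa P V u q i (\<theta> $ i))
      \<le> smooth_const P / 2 * (\<Sum>i\<in>S. (w $ i)\<^sup>2 * kappa P V' u q i (\<theta> $ i))"
    using V th valid_problemD(2)[OF P]
    by (intro mult_left_mono sum_mono kappa_mono[OF P]) auto
  ultimately show ?thesis by (simp add: objective_def z_eq)
qed

lemma is_arg_min_le: "is_arg_min f C x \<Longrightarrow> C y \<Longrightarrow> f x \<le> (f y :: real)"
  unfolding is_arg_min_def by (meson not_less)

lemma weight_subproblem:
  assumes P: "valid_problem P" and S: "S \<noteq> {}"
    and \<kappa>: "\<forall>i\<in>S. kappa P (variance_level P) u q i (\<theta> $ i) > 0"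
  shows "quadratic_function (\<lambda>w. J_id P S u q (w, \<theta>))"
    and "strictly_convex_on (coord_space S) (\<lambda>w. J_id P S u q (w, \<theta>))"
    and "\<exists>!lam. (\<Sum>i\<in>S. kkt_weights P S u q \<theta> lam $ i) = 1"
    and "(\<Sum>i\<in>S. kkt_weights P S u q \<theta> lam $ i) = 1 \<Longrightarrow>
      is_arg_min (\<lambda>w. J_id P S u q (w, \<theta>)) (\<lambda>w. w \<in> weight_simplex S) w \<longleftrightarrow> w = kkt_weights P S u q \<theta> lam"
proof -
  interpret separable_qp S "\<lambda>i. mu P (variance_level P) u q i (\<theta> $ i)"
      "\<lambda>i. kappa P (variance_level P) u q i (\<theta> $ i)" "smooth_const P" "U_sharp P u"
    using S \<kappa> valid_problemD(2)[OF P] by unfold_locales auto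
  have qp: "qp = (\<lambda>w. J_id P S u q (w, \<theta>))"
    by (simp add: fun_eq_iff qp_def J_id_def objective_def)
  have kkt: "kkt = kkt_weights P S u q \<theta>"
    by (simp add: fun_eq_iff kkt_def kkt_weights_def)
  show "quadratic_function (\<lambda>w. J_id P S u q (w, \<theta>))"
    using quadratic_qp unfolding qp .
  show "strictly_convex_on (coord_space S) (\<lambda>w. J_id P S u q (w, \<theta>))"
    using qp_strictly_convex unfolding qp .
  show "\<exists>!lam. (\<Sum>i\<in>S. kkt_weights P S u q \<theta> lam $ i) = 1"
    using ex1_multiplier unfolding kkt .
  show "(\<Sum>i\<in>S. kkt_weights P S u q \<theta> lam $ i) = 1 \<Longrightarrow>
      is_arg_min (\<lambda>w. J_id P S u q (w, \<theta>)) (\<lambda>w. w \<in> weight_simplex S) w \<longleftrightarrow> w = kkt_weights P S u q \<theta> lam"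
    using is_arg_min_iff_kkt[of lam w] unfolding qp kkt .
qed

theorem theorem3p2:
  fixes M :: "'a measure"
    and P :: "('n::finite, 'd::finite) problem"
    and A :: "('a, 'n, 'd) run"
    and t :: nat
    and U Q :: "'a \<Rightarrow> real"
    and vhat_sq :: "'n \<Rightarrow> 'a \<Rightarrow> real"
    and w_id \<theta>_id w_ex \<theta>_ex :: "'a \<Rightarrow> real^'n"
  assumes problem: "valid_problem P"
    and run: "valid_run M P A"
    and upper_state: "admissible_upper_state M P A t U Q"
    and proxy_measurable: "\<And>i. vhat_sq i \<in> borel_measurable (history M P A t)"
    and proxy: "AE \<omega> in M. \<forall>i. variance_level P i \<le> vhat_sq i \<omega>"
    and id_measurable: "w_id \<in> borel_measurable (history M P A t)"
      "\<theta>_id \<in> borel_measurable (history M P A t)"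
    and id_min: "AE \<omega> in M. is_arg_min (J_id P (active A t \<omega>) (U \<omega>) (Q \<omega>))
        (feasible P (active A t \<omega>)) (w_id \<omega>, \<theta>_id \<omega>)"
    and ex_measurable: "w_ex \<in> borel_measurable (history M P A t)"
      "\<theta>_ex \<in> borel_measurable (history M P A t)"
    and ex_min: "AE \<omega> in M. is_arg_min
        (J_ex P (\<lambda>i. vhat_sq i \<omega>) (active A t \<omega>) (U \<omega>) (Q \<omega>))
        (feasible P (active A t \<omega>)) (w_ex \<omega>, \<theta>_ex \<omega>)"
    and run_with_id: "weights A t = w_id" "amplitudes A t = \<theta>_id"
  shows "(AE \<omega> in M.
      next_gap M P A t \<omega> \<le> J_id P (active A t \<omega>) (U \<omega>) (Q \<omega>) (w_id \<omega>, \<theta>_id \<omega>) \<and>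
      J_id P (active A t \<omega>) (U \<omega>) (Q \<omega>) (w_id \<omega>, \<theta>_id \<omega>)
        \<le> J_ex P (\<lambda>i. vhat_sq i \<omega>) (active A t \<omega>) (U \<omega>) (Q \<omega>) (w_ex \<omega>, \<theta>_ex \<omega>)) \<and>
    (\<forall>w_bar \<theta>_bar \<Gamma>.
      w_bar \<in> borel_measurable (history M P A t) \<and> \<theta>_bar \<in> borel_measurable (history M P A t) \<and>
      (AE \<omega> in M. feasible P (active A t \<omega>) (w_bar \<omega>, \<theta>_bar \<omega>)) \<and>
      \<Gamma> = (\<lambda>\<omega>. J_id P (active A t \<omega>) (U \<omega>) (Q \<omega>) (w_bar \<omega>, \<theta>_bar \<omega>)
                - J_id P (active A t \<omega>) (U \<omega>) (Q \<omega>) (w_id \<omega>, \<theta>_id \<omega>)) \<longrightarrow>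
      (AE \<omega> in M.
         next_gap M P A t \<omega> \<le> J_id P (active A t \<omega>) (U \<omega>) (Q \<omega>) (w_bar \<omega>, \<theta>_bar \<omega>) - \<Gamma> \<omega> \<and>
         \<Gamma> \<omega> \<ge> 0)) \<and>
    (\<forall>\<omega>\<in>space M. \<forall>\<theta>\<in>amplitude_box P (active A t \<omega>).
      (\<forall>i\<in>active A t \<omega>. kappa P (variance_level P) (U \<omega>) (Q \<omega>) i (\<theta> $ i) > 0) \<longrightarrow>
      polyhedron (weight_simplex (active A t \<omega>)) \<and>
      quadratic_function (\<lambda>w. J_id P (active A t \<omega>) (U \<omega>) (Q \<omega>) (w, \<theta>)) \<and>
      strictly_convex_on (coord_space (active A t \<omega>))
        (\<lambda>w. J_id P (active A t \<omega>) (U \<omega>) (Q \<omega>) (w, \<theta>)) \<and>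
      (\<exists>!lam. (\<Sum>i\<in>active A t \<omega>. kkt_weights P (active A t \<omega>) (U \<omega>) (Q \<omega>) \<theta> lam $ i) = 1) \<and>
      (\<forall>lam. (\<Sum>i\<in>active A t \<omega>. kkt_weights P (active A t \<omega>) (U \<omega>) (Q \<omega>) \<theta> lam $ i) = 1 \<longrightarrow>
         (\<forall>w. is_arg_min (\<lambda>w. J_id P (active A t \<omega>) (U \<omega>) (Q \<omega>) (w, \<theta>))
                (\<lambda>w. w \<in> weight_simplex (active A t \<omega>)) w
              \<longleftrightarrow> w = kkt_weights P (active A t \<omega>) (U \<omega>) (Q \<omega>) \<theta> lam)))"
proof -
  interpret hew_run M P A by unfold_locales (rule problem run)+
  let ?S = "\<lambda>\<omega>. active A t \<omega>"
  have descent: "AE \<omega> in M. next_gap M P A t \<omega> \<le> J_id P (?S \<omega>) (U \<omega>) (Q \<omega>) (w_id \<omega>, \<theta>_id \<omega>)"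
    using AE_next_gap_le_objective[OF upper_state] by (simp add: run_with_id)
  have "AE \<omega> in M. J_id P (?S \<omega>) (U \<omega>) (Q \<omega>) (w_id \<omega>, \<theta>_id \<omega>)
      \<le> J_ex P (\<lambda>i. vhat_sq i \<omega>) (?S \<omega>) (U \<omega>) (Q \<omega>) (w_ex \<omega>, \<theta>_ex \<omega>)"
    using id_min ex_min proxy
  proof eventually_elim
    case (elim \<omega>)
    have ex: "feasible P (?S \<omega>) (w_ex \<omega>, \<theta>_ex \<omega>)"
      using elim(2) by (simp add: is_arg_min_def)
    have "J_id P (?S \<omega>) (U \<omega>) (Q \<omega>) (w_id \<omega>, \<theta>_id \<omega>) \<le> J_id P (?S \<omega>) (U \<omega>) (Q \<omega>) (w_ex \<omega>, \<theta>_ex \<omega>)"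
      by (rule is_arg_min_le[OF elim(1) ex])
    also have "\<dots> \<le> J_ex P (\<lambda>i. vhat_sq i \<omega>) (?S \<omega>) (U \<omega>) (Q \<omega>) (w_ex \<omega>, \<theta>_ex \<omega>)"
      unfolding J_id_def J_ex_def by (rule objective_mono[OF problem elim(3) ex])
    finally show ?case .
  qed
  with descent have chain: "AE \<omega> in M.
      next_gap M P A t \<omega> \<le> J_id P (?S \<omega>) (U \<omega>) (Q \<omega>) (w_id \<omega>, \<theta>_id \<omega>) \<and>
      J_id P (?S \<omega>) (U \<omega>) (Q \<omega>) (w_id \<omega>, \<theta>_id \<omega>)
        \<le> J_ex P (\<lambda>i. vhat_sq i \<omega>) (?S \<omega>) (U \<omega>) (Q \<omega>) (w_ex \<omega>, \<theta>_ex \<omega>)"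
    by eventually_elim simp
  have benchmark: "AE \<omega> in M.
      next_gap M P A t \<omega> \<le> J_id P (?S \<omega>) (U \<omega>) (Q \<omega>) (w_bar \<omega>, \<theta>_bar \<omega>) - \<Gamma> \<omega> \<and> \<Gamma> \<omega> \<ge> 0"
    if feas: "AE \<omega> in M. feasible P (?S \<omega>) (w_bar \<omega>, \<theta>_bar \<omega>)"
      and \<Gamma>: "\<Gamma> = (\<lambda>\<omega>. J_id P (?S \<omega>) (U \<omega>) (Q \<omega>) (w_bar \<omega>, \<theta>_bar \<omega>)
        - J_id P (?S \<omega>) (U \<omega>) (Q \<omega>) (w_id \<omega>, \<theta>_id \<omega>))"
    for w_bar \<theta>_bar \<Gamma>
    using descent feas id_min
  proof eventually_elim
    case (elim \<omega>)
    then show ?case using is_arg_min_le[OF elim(3,2)] by (simp add: \<Gamma>)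
  qed
  show ?thesis
  proof (intro conjI[OF chain] conjI)
    show "\<forall>w_bar \<theta>_bar \<Gamma>.
      w_bar \<in> borel_measurable (history M P A t) \<and> \<theta>_bar \<in> borel_measurable (history M P A t) \<and>
      (AE \<omega> in M. feasible P (?S \<omega>) (w_bar \<omega>, \<theta>_bar \<omega>)) \<and>
      \<Gamma> = (\<lambda>\<omega>. J_id P (?S \<omega>) (U \<omega>) (Q \<omega>) (w_bar \<omega>, \<theta>_bar \<omega>)
                - J_id P (?S \<omega>) (U \<omega>) (Q \<omega>) (w_id \<omega>, \<theta>_id \<omega>)) \<longrightarrow>
      (AE \<omega> in M.
         next_gap M P A t \<omega> \<le> J_id P (?S \<omega>) (U \<omega>) (Q \<omega>) (w_bar \<omega>, \<theta>_bar \<omega>) - \<Gamma> \<omega> \<and>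
         \<Gamma> \<omega> \<ge> 0)"
      by (intro allI impI, elim conjE) (rule benchmark)
  next
    show "\<forall>\<omega>\<in>space M. \<forall>\<theta>\<in>amplitude_box P (?S \<omega>).
      (\<forall>i\<in>?S \<omega>. kappa P (variance_level P) (U \<omega>) (Q \<omega>) i (\<theta> $ i) > 0) \<longrightarrow>
      polyhedron (weight_simplex (?S \<omega>)) \<and>
      quadratic_function (\<lambda>w. J_id P (?S \<omega>) (U \<omega>) (Q \<omega>) (w, \<theta>)) \<and>
      strictly_convex_on (coord_space (?S \<omega>)) (\<lambda>w. J_id P (?S \<omega>) (U \<omega>) (Q \<omega>) (w, \<theta>)) \<and>
      (\<exists>!lam. (\<Sum>i\<in>?S \<omega>. kkt_weights P (?S \<omega>) (U \<omega>) (Q \<omega>) \<theta> lam $ i) = 1) \<and>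
      (\<forall>lam. (\<Sum>i\<in>?S \<omega>. kkt_weights P (?S \<omega>) (U \<omega>) (Q \<omega>) \<theta> lam $ i) = 1 \<longrightarrow>
         (\<forall>w. is_arg_min (\<lambda>w. J_id P (?S \<omega>) (U \<omega>) (Q \<omega>) (w, \<theta>)) (\<lambda>w. w \<in> weight_simplex (?S \<omega>)) w
              \<longleftrightarrow> w = kkt_weights P (?S \<omega>) (U \<omega>) (Q \<omega>) \<theta> lam))"
    proof (intro ballI impI)
      fix \<omega> \<theta>
      assume \<omega>: "\<omega> \<in> space M"
        and \<kappa>: "\<forall>i\<in>?S \<omega>. kappa P (variance_level P) (U \<omega>) (Q \<omega>) i (\<theta> $ i) > 0"
      note sub = weight_subproblem[OF problem active_nonempty[OF \<omega>] \<kappa>]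
      show "polyhedron (weight_simplex (?S \<omega>)) \<and>
        quadratic_function (\<lambda>w. J_id P (?S \<omega>) (U \<omega>) (Q \<omega>) (w, \<theta>)) \<and>
        strictly_convex_on (coord_space (?S \<omega>)) (\<lambda>w. J_id P (?S \<omega>) (U \<omega>) (Q \<omega>) (w, \<theta>)) \<and>
        (\<exists>!lam. (\<Sum>i\<in>?S \<omega>. kkt_weights P (?S \<omega>) (U \<omega>) (Q \<omega>) \<theta> lam $ i) = 1) \<and>
        (\<forall>lam. (\<Sum>i\<in>?S \<omega>. kkt_weights P (?S \<omega>) (U \<omega>) (Q \<omega>) \<theta> lam $ i) = 1 \<longrightarrow>
           (\<forall>w. is_arg_min (\<lambda>w. J_id P (?S \<omega>) (U \<omega>) (Q \<omega>) (w, \<theta>)) (\<lambda>w. w \<in> weight_simplex (?S \<omega>)) w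
                \<longleftrightarrow> w = kkt_weights P (?S \<omega>) (U \<omega>) (Q \<omega>) \<theta> lam))"
        using polyhedron_weight_simplex sub(1,2,3) sub(4) by blast
    qed
  qed
qed

end
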